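(* Let $p\in[0,1]$, $\alpha>1$, $\theta\in(0,1)$, and set $$\nu=\alpha\theta,\qquad \beta=-\frac{\tan\frac{\pi\theta}{2}}{\tan\frac{\pi\alpha\theta}{2}},\qquad \sigma=\left(\cos\frac{\pi\theta}{2}\right)^{1/\nu},\qquad \mu=0.$$ Assume $\nu\in(0,2]$, $\nu\ne1$ and $\beta\in[-1,1]$. Let $Y_{2\alpha,\theta}^{(p)}(t)=F_{2\alpha}^{(p)}(S_\theta(t))$ be the asymmetric fractional Fresnel pseudoprocess time-changed with an independent stable subordinator of exponent $\theta$. Then, for every $t>0$, the distribution of $Y_{2\alpha,\theta}^{(p)}(t)$ is a genuine probability distribution, and $$Y_{2\alpha,\theta}^{(p)}(t)\overset{d}{=}\begin{cases}H_{\nu}(\sigma,\beta,\mu;t)&\text{with probability }p,\\-H_{\nu}(\sigma,\beta,\mu;t)&\text{with probability }1-p,\end{cases}$$ where $H_\nu(\sigma,\beta,\mu;t)$ is a stable random variable with characteristic function $$\mathbb{E}\left[e^{i\gamma H_{\nu}(\sigma,\beta,\mu;t)}\right]=\exp\left(-t\sigma^{\nu}|\gamma|^{\nu}\left(1-i\beta\operatorname{sgn}(\gamma)\tan\frac{\pi\nu}{2}\right)+i\mu t\gamma\right),\qquad\gamma\in\mathbb{R},$$ and the random choice of the sign is independent of $H_\nu$.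
   Context: For real $\alpha>1$ the generalized Airy function is $\mathrm{Ai}_{\alpha}(x)=\frac{1}{\pi}\int_0^{+\infty}\cos\left(sx+\frac{s^{\alpha}}{\alpha}\right)ds$, $x\in\mathbb{R}$ (convergent improper Riemann integral). The pseudo-density (density of a signed measure) of the asymmetric fractional Fresnel pseudoprocess $F_{2\alpha}^{(p)}(t)$ is $$u_{2\alpha,p}(x,t)=\frac{1}{(\alpha t)^{1/\alpha}}\left[p\,\mathrm{Ai}_{\alpha}\left(-\frac{x}{(\alpha t)^{1/\alpha}}\right)+(1-p)\,\mathrm{Ai}_{\alpha}\left(\frac{x}{(\alpha t)^{1/\alpha}}\right)\right],\qquad x\in\mathbb{R},\ t>0.$$ The stable subordinator $S_\theta(t)$, $\theta\in(0,1)$, is the positive random variable with characteristic function $\mathbb{E}[e^{i\gamma S_{\theta}(t)}]=\exp\left(-t|\gamma|^{\theta}e^{-i\frac{\pi\theta}{2}\operatorname{sgn}\gamma}\right)$; let $h_\theta(s,t)$, $s>0$, be its probability density. The distribution of $Y_{2\alpha,\theta}^{(p)}(t)$ is by definition the signed measure on $\mathbb{R}$ with density $x\mapsto\int_0^{+\infty}u_{2\alpha,p}(x,s)\,h_{\theta}(s,t)\,ds$; "$\overset{d}{=}$" means that this measure coincides with the law of the random variable on the right-hand side.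
   Formalization: The sign of β is corrected to β = +tan(πθ/2)/tan(παθ/2), since with the printed minus sign the identity fails for every p ≠ 1/2 (e.g. α=3, θ=1/5, p=1); tan(παθ/2) ≠ 0 is made explicit, excluding ν=2, where β is undefined. *)

theory Defs
  imports "HOL-Probability.Probability"
begin

text \<open>The integral is only conditionally convergent, so it is the limit of the proper
  integrals over bounded intervals.\<close>

definition gen_airy :: "real \<Rightarrow> real \<Rightarrow> real" where
  "gen_airy \<alpha> x = 1 / pi *
     Lim at_top (\<lambda>R. integral {0..R} (\<lambda>s. cos (s * x + s powr \<alpha> / \<alpha>)))"

definition fresnel_density :: "real \<Rightarrow> real \<Rightarrow> real \<Rightarrow> real \<Rightarrow> real" where
  "fresnel_density \<alpha> p x t = 1 / (\<alpha> * t) powr (1 / \<alpha>) *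
     (p * gen_airy \<alpha> (- x / (\<alpha> * t) powr (1 / \<alpha>)) +
      (1 - p) * gen_airy \<alpha> (x / (\<alpha> * t) powr (1 / \<alpha>)))"

text \<open>\<open>h\<close> is a probability density of the stable subordinator at time \<open>t\<close>; being the density
  of a positive random variable, it is taken to vanish on the nonpositive half-line.\<close>

definition stable_subordinator_density :: "real \<Rightarrow> real \<Rightarrow> (real \<Rightarrow> real) \<Rightarrow> bool" where
  "stable_subordinator_density \<theta> t h \<longleftrightarrow>
     h \<in> borel_measurable borel \<and> (\<forall>s. 0 \<le> h s) \<and> (\<forall>s\<le>0. h s = 0) \<and>
     prob_space (density lborel h) \<and>
     (\<forall>\<gamma>. char (density lborel h) \<gamma> =
        exp (- complex_of_real (t * \<bar>\<gamma>\<bar> powr \<theta>)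
             * exp (- \<i> * complex_of_real (pi * \<theta> / 2 * sgn \<gamma>))))"

definition Y_density ::
    "real \<Rightarrow> real \<Rightarrow> (real \<Rightarrow> real \<Rightarrow> real) \<Rightarrow> real \<Rightarrow> real \<Rightarrow> real" where
  "Y_density \<alpha> p h t x = (LINT s:{0<..}|lborel. fresnel_density \<alpha> p x s * h s t)"

text \<open>A real-valued set function: the signed measure with density \<open>Y_density \<alpha> p h t\<close>.
  (The library's \<open>density\<close> would truncate negative values of the density to zero.)\<close>

definition Y_distribution ::
    "real \<Rightarrow> real \<Rightarrow> (real \<Rightarrow> real \<Rightarrow> real) \<Rightarrow> real \<Rightarrow> real set \<Rightarrow> real" where
  "Y_distribution \<alpha> p h t A = (LINT x:A|lborel. Y_density \<alpha> p h t x)"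

definition stable_cf :: "real \<Rightarrow> real \<Rightarrow> real \<Rightarrow> real \<Rightarrow> real \<Rightarrow> real \<Rightarrow> complex" where
  "stable_cf \<nu> \<sigma> \<beta> \<mu> t \<gamma> =
     exp (- complex_of_real (t * \<sigma> powr \<nu> * \<bar>\<gamma>\<bar> powr \<nu>)
            * (1 - \<i> * complex_of_real (\<beta> * sgn \<gamma> * tan (pi * \<nu> / 2)))
          + \<i> * complex_of_real (\<mu> * t * \<gamma>))"

text \<open>In the theorem the skewness \<open>\<beta>\<close> is \<open>+ tan (pi * \<theta> / 2) / tan (pi * \<alpha> * \<theta> / 2)\<close>.  The opposite sign, which is
  the one printed in the source, does not fit the other conventions fixed above.  Indeed, in the
  distributional sense, the Fourier transform of \<open>\<lambda>x. fresnel_density \<alpha> 1 x s\<close> at \<open>\<gamma>\<close> is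
  \<open>exp (\<i> * s * sgn \<gamma> * \<bar>\<gamma>\<bar> powr \<alpha>)\<close>, so for \<open>p = 1\<close> the subordinated one is
  \<open>exp (- t * \<bar>\<gamma>\<bar> powr (\<alpha> * \<theta>) * exp (- \<i> * pi * \<theta> / 2 * sgn \<gamma>))\<close>, and this is
  \<open>stable_cf \<nu> \<sigma> \<beta> 0 t \<gamma>\<close> exactly when \<open>\<beta> * tan (pi * \<nu> / 2) = tan (pi * \<theta> / 2)\<close>.\<close>

end

(* The Fourier transform of the density with p = 1 at time s is exp (i s sgn(g) |g|^alpha). Averaging
   over the subordinator turns the conditionally convergent Airy integral into the absolutely
   convergent inverse Fourier transform f of phi(g) = exp (-t |g|^nu exp (-i (pi theta / 2) sgn g)).
   The interchange is dominated by a van der Corput bound of order s^(-1/(alpha-1)) + s^(-1/alpha),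
   so it needs finite negative moments of the subordinator. These follow from its Laplace transform
   exp (-t l^theta), the analytic continuation of the given characteristic function.

   Nonnegativity of f is not visible from the formula. It holds because phi is a characteristic
   function: totally skewed stable laws are limits of normalised sums of mixtures of exponentials,
   whose characteristic functions are explicit, and a general skewness is obtained as the difference
   of two independent totally skewed variables. By Fourier inversion f is the density of this law,
   and Y has density p f(x) + (1 - p) f(-x). *)

theory Submission
  imports Defs "HOL-Complex_Analysis.Complex_Analysis" "HOL-Real_Asymp.Real_Asymp"
begin

section \<open>Beta integrals and the Cauchy kernel\<close>

text \<open>The mixtures come from the Levy measure of a totally skewed stable law: its density
  x^(-1-\<nu>) on x > 0 is, up to a constant, the integral of y^(\<nu>-1) * y exp(-x y) over all
  rates y > 0. The weight y^(\<nu>-1) has infinite mass, so it is cut off at y = b and normalised;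
  the cutoff drops the fast rates, which carry the mass near x = 0. The number of summands grows
  like b^\<nu> to undo the normalisation. Since 1 - y / (y - i\<gamma>) = -i\<gamma> / (y -
  i\<gamma>), the limit exponent is -i\<gamma>\<nu> times the integral of y^(\<nu>-1) / (y -
  i\<gamma>), which converges only for \<nu> < 1. For 1 < \<nu> < 2 the mean must be compensated,
  and the same kernel returns with the power y^(\<nu>-2); hence two existence proofs. The limit law
  is not known beforehand and has to be produced by tightness. A bound |1 - char| \<le>
  C|\<gamma>|^\<nu>, uniform along the sequence, yields it.\<close>

lemma has_integral_nonneg_imp_set_integrable:
  fixes f :: "real \<Rightarrow> real"
  assumes [measurable]: "f \<in> borel_measurable borel" "S \<in> sets borel"
    and nn: "\<And>x. x \<in> S \<Longrightarrow> 0 \<le> f x" and I: "(f has_integral r) S"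
  shows "set_integrable lborel S f" and "(LBINT x:S. f x) = r"
proof -
  have "f absolutely_integrable_on S"
    using I nn by (intro nonnegative_absolutely_integrable_1) (auto simp: has_integral_integrable)
  then show *: "set_integrable lborel S f"
    unfolding set_integrable_def by (subst (asm) integrable_completion) auto
  show "(LBINT x:S. f x) = r"
    using set_borel_integral_eq_integral(2)[OF *] I by (simp add: integral_unique)
qed

lemma powr_set_integral_Ioo:
  fixes a c :: real
  assumes "0 < a" "0 \<le> c"
  shows "set_integrable lborel {0<..<c} (\<lambda>x. x powr (a - 1))"
    and "(LBINT x:{0<..<c}. x powr (a - 1)) = c powr a / a"
proof -
  have "((\<lambda>x. x powr (a - 1)) has_integral (c powr a / a)) {0<..<c}"
    using has_integral_powr_from_0[of "a - 1" c] assms by (simp add: has_integral_Icc_iff_Ioo)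
  from has_integral_nonneg_imp_set_integrable[OF _ _ _ this]
  show "set_integrable lborel {0<..<c} (\<lambda>x. x powr (a - 1))"
    and "(LBINT x:{0<..<c}. x powr (a - 1)) = c powr a / a" by auto
qed

lemma Beta_reflection_real:
  fixes a :: real
  assumes "0 < a" "a < 1"
  shows "Beta a (1 - a) = pi / sin (pi * a)"
proof -
  have "Gamma (complex_of_real a) * Gamma (complex_of_real (1 - a)) = of_real pi / sin (of_real (pi * a))"
    using Gamma_reflection_complex[of "of_real a"] by simp
  then have "complex_of_real (Gamma a * Gamma (1 - a)) = complex_of_real (pi / sin (pi * a))"
    by (simp only: Gamma_complex_of_real of_real_mult of_real_divide sin_of_real[symmetric])
  then have "Gamma a * Gamma (1 - a) = pi / sin (pi * a)" by (simp only: of_real_eq_iff)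
  then show ?thesis by (simp add: Beta_def)
qed

text \<open>The substitution t = y^2 / (y^2 + \<gamma>^2), whose inverse is \<open>g\<close>, turns
  the integral into the Beta function at (r/2, 1 - r/2), and the reflection formula evaluates it.
  Convergence at 0 needs r > 0, at infinity r < 2.\<close>

lemma powr_over_square_integral:
  fixes r \<gamma> :: real
  assumes r: "0 < r" "r < 2" and \<gamma>: "\<gamma> \<noteq> 0"
  shows "set_integrable lborel {0<..} (\<lambda>y. y powr (r - 1) / (y^2 + \<gamma>^2))"
    and "(LBINT y:{0<..}. y powr (r - 1) / (y^2 + \<gamma>^2)) = \<bar>\<gamma>\<bar> powr (r - 2) * (pi / 2 / sin (pi * r / 2))"
proof -
  define g where "g t = \<bar>\<gamma>\<bar> * (t / (1 - t)) powr (1 / 2)" for t :: real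
  define g' where "g' t = \<bar>\<gamma>\<bar> * (1 / 2 * (t / (1 - t)) powr (1 / 2 - 1) * (1 / (1 - t)^2))" for t :: real
  define f where "f y = y powr (r - 1) / (y^2 + \<gamma>^2)" for y :: real
  have img: "g ` {0<..<1} = {0<..}"
  proof
    show "g ` {0<..<1} \<subseteq> {0<..}" using \<gamma> by (auto simp: g_def)
    show "{0<..} \<subseteq> g ` {0<..<1}"
    proof
      fix y :: real assume y: "y \<in> {0<..}"
      define t where "t = y^2 / (y^2 + \<gamma>^2)"
      have p: "0 < y^2" "0 < \<gamma>^2" using y \<gamma> by auto
      have pp: "0 < y^2 + \<gamma>^2" by (rule add_pos_pos[OF p])
      have "t < 1" unfolding t_def by (subst divide_less_eq_1_pos[OF pp]) (use p in simp)
      moreover have "0 < t" unfolding t_def using p(1) pp by (rule divide_pos_pos)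
      ultimately have t: "t \<in> {0<..<1}" by simp
      have "t * (y^2 + \<gamma>^2) = y^2" using pp by (simp add: t_def)
      then have "t * \<gamma>^2 = y^2 * (1 - t)" by (simp add: algebra_simps)
      then have "t / (1 - t) = (y / \<bar>\<gamma>\<bar>)^2"
        using p t by (simp add: power_divide frac_eq_eq)
      then have "g t = y" using y \<gamma> by (simp add: g_def powr_half_sqrt)
      with t show "y \<in> g ` {0<..<1}" by blast
    qed
  qed
  have inj: "inj_on g {0<..<1}"
  proof (rule inj_onI)
    fix s t :: real assume st: "s \<in> {0<..<1}" "t \<in> {0<..<1}" and eq: "g s = g t"
    then have "s / (1 - s) = t / (1 - t)" using \<gamma> by (simp add: g_def powr_half_sqrt)
    then have "s * (1 - t) = t * (1 - s)" using st by (simp add: frac_eq_eq)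
    then show "s = t" by (simp add: algebra_simps)
  qed
  have deriv: "(g has_field_derivative g' t) (at t within {0<..<1})" if "t \<in> {0<..<1}" for t
  proof -
    have "((\<lambda>t. t / (1 - t)) has_field_derivative (1 / (1 - t)^2)) (at t)"
      using that by (auto intro!: derivative_eq_intros simp: power2_eq_square)
    moreover have "0 < t / (1 - t)" using that by simp
    ultimately have "((\<lambda>t. (t / (1 - t)) powr (1 / 2)) has_field_derivative
        (1 / 2 * (t / (1 - t)) powr (1 / 2 - 1) * (1 / (1 - t)^2))) (at t)"
      by (rule DERIV_fun_powr[where r="1 / 2", unfolded of_nat_1])
    then show ?thesis
      unfolding g_def g'_def by (rule has_field_derivative_at_within[OF DERIV_cmult])
  qed
  define C where "C = \<bar>\<gamma>\<bar> powr (r - 2) / 2"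
  have integrand: "\<bar>g' t\<bar> * f (g t) = C * (t powr (r / 2 - 1) * (1 - t) powr (1 - r / 2 - 1))"
    if t: "t \<in> {0<..<1}" for t
  proof -
    \<comment> \<open>With q = (g t / |\<gamma>|)^2 the denominator is \<gamma>^2 (1 + q), and 1 + q
      = 1 / (1 - t), so only powers of t and 1 - t remain.\<close>
    define q where "q = t / (1 - t)"
    have q: "0 < q" using t by (simp add: q_def)
    have "1 - t \<noteq> 0" using t by simp
    then have q1: "1 + q = 1 / (1 - t)" using add_divide_distrib[of "1 - t" t "1 - t"] by (simp add: q_def)
    have gg: "g t = \<bar>\<gamma>\<bar> * q powr (1/2)" by (simp add: g_def q_def)
    have "(q powr (1/2))^2 = q" using q by (simp add: powr_half_sqrt)
    then have den: "(g t)^2 + \<gamma>^2 = \<gamma>^2 * (1 + q)"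
      unfolding gg power_mult_distrib power2_abs by (simp only: distrib_left mult_1_right add.commute)
    have num: "g t powr (r - 1) = \<bar>\<gamma>\<bar> powr (r - 1) * q powr ((r - 1) / 2)"
      unfolding gg by (simp add: powr_mult powr_powr)
    have "\<bar>g' t\<bar> = \<bar>\<gamma>\<bar> / 2 * q powr (- 1 / 2) * (1 / (1 - t)^2)"
      using t q by (simp add: g'_def q_def abs_mult)
    then have "\<bar>g' t\<bar> * f (g t) = (\<bar>\<gamma>\<bar> * \<bar>\<gamma>\<bar> powr (r - 1) / \<gamma>^2) / 2 * (q powr (- 1 / 2) * q powr ((r - 1) / 2)) * ((1 / (1 - t)^2) * (1 - t))"
      unfolding f_def den num q1 by (simp add: mult_ac)
    also have "\<bar>\<gamma>\<bar> * \<bar>\<gamma>\<bar> powr (r - 1) / \<gamma>^2 = \<bar>\<gamma>\<bar> powr (r - 2)"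
      using \<gamma> by (simp add: powr_diff powr_numeral)
    also have "q powr (- 1 / 2) * q powr ((r - 1) / 2) = q powr (r / 2 - 1)"
      by (simp add: powr_add[symmetric] diff_divide_distrib)
    also have "\<dots> = t powr (r / 2 - 1) * (1 - t) powr (- (r / 2 - 1))"
      unfolding q_def powr_minus_divide using t by (simp add: powr_divide)
    also have "(1 / (1 - t)^2) * (1 - t) = (1 - t) powr (- 1)"
      using t by (simp add: powr_minus power2_eq_square inverse_eq_divide)
    also have "\<bar>\<gamma>\<bar> powr (r - 2) / 2 * (t powr (r / 2 - 1) * (1 - t) powr (- (r / 2 - 1))) * (1 - t) powr (- 1)
        = C * (t powr (r / 2 - 1) * ((1 - t) powr (- (r / 2 - 1)) * (1 - t) powr (- 1)))"
      by (simp add: C_def)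
    also have "(1 - t) powr (- (r / 2 - 1)) * (1 - t) powr (- 1) = (1 - t) powr (1 - r / 2 - 1)"
      unfolding powr_add[symmetric] by (rule arg_cong[where f="\<lambda>c. (1 - t) powr c"]) simp
    finally show ?thesis .
  qed
  have "((\<lambda>t. t powr (r / 2 - 1) * (1 - t) powr (1 - r / 2 - 1)) has_integral Beta (r / 2) (1 - r / 2)) {0<..<1}"
    using has_integral_Beta_real[of "r / 2" "1 - r / 2"] r by (simp add: has_integral_Icc_iff_Ioo)
  then have "((\<lambda>t. C * (t powr (r / 2 - 1) * (1 - t) powr (1 - r / 2 - 1))) has_integral C * Beta (r / 2) (1 - r / 2)) {0<..<1}"
    by (rule has_integral_mult_right)
  then have B: "((\<lambda>t. \<bar>g' t\<bar> * f (g t)) has_integral C * Beta (r / 2) (1 - r / 2)) {0<..<1}"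
    by (rule has_integral_eq[rotated]) (simp add: integrand)
  \<comment> \<open>The integrand is nonnegative, so gauge integrability is already absolute, as the
    change of variables requires.\<close>
  then have abs: "(\<lambda>t. \<bar>g' t\<bar> * f (g t)) absolutely_integrable_on {0<..<1}"
    by (intro nonnegative_absolutely_integrable_1) (auto simp: f_def has_integral_integrable)
  have "f absolutely_integrable_on g ` {0<..<1} \<and> integral (g ` {0<..<1}) f = C * Beta (r / 2) (1 - r / 2)"
    by (rule iffD1[OF has_absolute_integral_change_of_variables_1'[OF _ deriv inj] conjI[OF abs integral_unique[OF B]]]) auto
  then have fi: "f absolutely_integrable_on {0<..}" and fe: "integral {0<..} f = C * Beta (r / 2) (1 - r / 2)"
    unfolding img by auto
  have "(f has_integral C * Beta (r / 2) (1 - r / 2)) {0<..}"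
    using fe set_lebesgue_integral_eq_integral(1)[OF fi] by (simp add: has_integral_iff)
  then have I: "(f has_integral \<bar>\<gamma>\<bar> powr (r - 2) * (pi / 2 / sin (pi * r / 2))) {0<..}"
    using r by (simp add: Beta_reflection_real C_def)
  show "set_integrable lborel {0<..} (\<lambda>y. y powr (r - 1) / (y^2 + \<gamma>^2))"
    and "(LBINT y:{0<..}. y powr (r - 1) / (y^2 + \<gamma>^2)) = \<bar>\<gamma>\<bar> powr (r - 2) * (pi / 2 / sin (pi * r / 2))"
    using has_integral_nonneg_imp_set_integrable[OF _ _ _ I[unfolded f_def]] by auto
qed

text \<open>1 / (y - i\<gamma>) = (y + i\<gamma>) / (y^2 + \<gamma>^2), so the real and imaginary
  parts are the preceding integral at r = s + 1 and r = s; s < 1 keeps the larger exponent below 2.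
  The shift by one turns the sine into the cosine, and the norm bound is the sum of the two
  parts.\<close>

lemma Cauchy_kernel_integral:
  fixes s \<gamma> :: real
  assumes s: "0 < s" "s < 1" and \<gamma>: "\<gamma> \<noteq> 0"
  shows "set_integrable lborel {0<..} (\<lambda>y. y powr (s - 1) / (y - \<i> * \<gamma>))"
    and "(CLBINT y:{0<..}. y powr (s - 1) / (y - \<i> * \<gamma>)) =
      of_real (\<bar>\<gamma>\<bar> powr (s - 1) * (pi / 2)) * (1 / cos (pi * s / 2) + \<i> * sgn \<gamma> / sin (pi * s / 2))"
    and "(LBINT y:{0<..}. norm (y powr (s - 1) / (y - \<i> * \<gamma>))) \<le>
      \<bar>\<gamma>\<bar> powr (s - 1) * (pi / 2 / cos (pi * s / 2) + pi / 2 / sin (pi * s / 2))"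
proof -
  define G where "G r y = y powr (r - 1) / (y^2 + \<gamma>^2)" for r y :: real
  have G: "set_integrable lborel {0<..} (G r)"
      "(LBINT y:{0<..}. G r y) = \<bar>\<gamma>\<bar> powr (r - 2) * (pi / 2 / sin (pi * r / 2))"
    if "0 < r" "r < 2" for r
    using powr_over_square_integral[OF that \<gamma>] unfolding G_def by auto
  have Gn: "0 \<le> G r y" for r y by (simp add: G_def)
  have nz: "y\<^sup>2 + \<gamma>\<^sup>2 \<noteq> 0" for y :: real using \<gamma> by (simp add: sum_power2_eq_zero_iff)
  have split: "y powr (s - 1) / (y - \<i> * \<gamma>) = of_real (G (s + 1) y) + \<i> * \<gamma> * of_real (G s y)"
    if "0 < y" for y :: real
  proof -
    have "y powr (s - 1) * y = y powr s"
      using powr_mult_base[of y "s - 1"] that by (simp add: mult.commute)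
    moreover have "X * (y\<^sup>2 + \<gamma>\<^sup>2) / (y\<^sup>2 + \<gamma>\<^sup>2)\<^sup>2 = X / (y\<^sup>2 + \<gamma>\<^sup>2)" for X
      using nz[of y] by (simp add: power2_eq_square[of "y\<^sup>2 + \<gamma>\<^sup>2"])
    ultimately show ?thesis
      by (simp add: complex_eq_iff Re_divide Im_divide G_def mult.commute)
  qed
  have int1: "set_integrable lborel {0<..} (\<lambda>y. complex_of_real (G (s + 1) y))"
    and int2: "set_integrable lborel {0<..} (\<lambda>y. \<i> * \<gamma> * complex_of_real (G s y))"
  proof -
    have of_real: "set_integrable lborel {0<..} (\<lambda>y. complex_of_real (G r y))" if "0 < r" "r < 2" for r
      using G(1)[OF that] by (simp add: set_integrable_def scaleR_conv_of_real flip: of_real_mult)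
    show "set_integrable lborel {0<..} (\<lambda>y. complex_of_real (G (s + 1) y))"
      and "set_integrable lborel {0<..} (\<lambda>y. \<i> * \<gamma> * complex_of_real (G s y))"
      using of_real[of "s + 1"] of_real[of s] s by (auto intro!: set_integrable_mult_right)
  qed
  have cong: "set_integrable lborel {0<..} (\<lambda>y. y powr (s - 1) / (y - \<i> * \<gamma>)) \<longleftrightarrow>
      set_integrable lborel {0<..} (\<lambda>y. complex_of_real (G (s + 1) y) + \<i> * \<gamma> * complex_of_real (G s y))"
    by (rule set_integrable_cong) (auto simp: split)
  show int: "set_integrable lborel {0<..} (\<lambda>y. y powr (s - 1) / (y - \<i> * \<gamma>))"
    unfolding cong by (intro set_integral_add int1 int2)
  have pw: "\<bar>\<gamma>\<bar> * \<bar>\<gamma>\<bar> powr (s - 2) = \<bar>\<gamma>\<bar> powr (s - 1)"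
    using powr_mult_base[of "\<bar>\<gamma>\<bar>" "s - 2"] by simp
  then have sgn: "\<gamma> * \<bar>\<gamma>\<bar> powr (s - 2) = sgn \<gamma> * \<bar>\<gamma>\<bar> powr (s - 1)"
    by (metis mult.assoc sgn_mult_abs)
  have sin_shift: "sin (pi * (s + 1) / 2) = cos (pi * s / 2)"
  proof -
    have "pi * (s + 1) / 2 = pi * s / 2 + pi / 2" by (simp add: algebra_simps)
    then show ?thesis
      by (simp only: sin_add sin_pi_half cos_pi_half mult_zero_right mult_1_right add_0_left)
  qed
  have "(CLBINT y:{0<..}. y powr (s - 1) / (y - \<i> * \<gamma>)) =
      (CLBINT y:{0<..}. complex_of_real (G (s + 1) y) + \<i> * \<gamma> * complex_of_real (G s y))"
    by (rule set_lebesgue_integral_cong) (auto simp: split)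
  also have "\<dots> = of_real (LBINT y:{0<..}. G (s + 1) y) + \<i> * \<gamma> * of_real (LBINT y:{0<..}. G s y)"
    by (simp add: set_integral_add(2)[OF int1 int2] set_integral_complex_of_real)
  also have "\<dots> = of_real (\<bar>\<gamma>\<bar> powr (s - 1) * (pi / 2 / cos (pi * s / 2)))
      + \<i> * of_real ((\<gamma> * \<bar>\<gamma>\<bar> powr (s - 2)) * (pi / 2 / sin (pi * s / 2)))"
    using G(2)[of "s + 1"] G(2)[of s] s by (simp add: sin_shift)
  also have "\<dots> = of_real (\<bar>\<gamma>\<bar> powr (s - 1) * (pi / 2)) * (1 / cos (pi * s / 2) + \<i> * sgn \<gamma> / sin (pi * s / 2))"
    unfolding sgn by (simp add: distrib_left)
  finally show "(CLBINT y:{0<..}. y powr (s - 1) / (y - \<i> * \<gamma>)) =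
      of_real (\<bar>\<gamma>\<bar> powr (s - 1) * (pi / 2)) * (1 / cos (pi * s / 2) + \<i> * sgn \<gamma> / sin (pi * s / 2))" .
  have "(LBINT y:{0<..}. norm (y powr (s - 1) / (y - \<i> * \<gamma>))) \<le> (LBINT y:{0<..}. G (s + 1) y + \<bar>\<gamma>\<bar> * G s y)"
  proof (rule set_integral_mono)
    show "set_integrable lborel {0<..} (\<lambda>y. norm (y powr (s - 1) / (y - \<i> * \<gamma>)))"
      by (rule set_integrable_norm[OF int])
    show "set_integrable lborel {0<..} (\<lambda>y. G (s + 1) y + \<bar>\<gamma>\<bar> * G s y)"
      using G(1)[of "s + 1"] G(1)[of s] s by (intro set_integral_add set_integrable_mult_right) auto
    fix y :: real assume "y \<in> {0<..}"
    then have eq: "y powr (s - 1) / (y - \<i> * \<gamma>) = of_real (G (s + 1) y) + \<i> * \<gamma> * of_real (G s y)"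
      by (simp add: split)
    show "norm (y powr (s - 1) / (y - \<i> * \<gamma>)) \<le> G (s + 1) y + \<bar>\<gamma>\<bar> * G s y"
      unfolding eq using Gn[of _ y] by (intro order_trans[OF norm_triangle_ineq]) (simp add: norm_mult)
  qed
  also have "\<dots> = \<bar>\<gamma>\<bar> powr (s - 1) * (pi / 2 / cos (pi * s / 2)) + \<bar>\<gamma>\<bar> * \<bar>\<gamma>\<bar> powr (s - 2) * (pi / 2 / sin (pi * s / 2))"
    using G[of "s + 1"] G[of s] s by (simp add: sin_shift set_integral_add(2) set_integrable_mult_right)
  also note pw
  finally show "(LBINT y:{0<..}. norm (y powr (s - 1) / (y - \<i> * \<gamma>))) \<le>
      \<bar>\<gamma>\<bar> powr (s - 1) * (pi / 2 / cos (pi * s / 2) + pi / 2 / sin (pi * s / 2))"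
    by (simp add: algebra_simps)
qed

section \<open>Tightness from characteristic functions\<close>

text \<open>Averaging 1 - char(u z) over a standard normal z replaces the oscillating exponentials
  by 1 - exp(-(u x)^2 / 2), which is nonnegative and at least 1 - exp(-1/2) once |x| u \<ge>
  1.\<close>

lemma real_distribution_tail_le_char:
  assumes M: "real_distribution M" and C: "0 \<le> C" and \<nu>: "0 < \<nu>" "\<nu> \<le> 2"
    and bound: "\<And>\<gamma>. norm (1 - char M \<gamma>) \<le> C * \<bar>\<gamma>\<bar> powr \<nu>" and u: "0 < u"
  shows "(1 - exp (- 1 / 2)) * measure M {x. 1 \<le> \<bar>x\<bar> * u} \<le> 2 * C * u powr \<nu>"
proof -
  interpret M: real_distribution M by fact
  interpret N: real_distribution std_normal_distribution by (rule real_dist_normal_dist)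
  interpret P: pair_prob_space M std_normal_distribution ..
  let ?N = "std_normal_distribution"
  have "(CLINT z|?N. char M (u * z)) = (CLINT z|?N. CLINT x|M. iexp (u * z * x))"
    by (simp add: char_def)
  also have "\<dots> = (CLINT x|M. CLINT z|?N. iexp (u * z * x))"
    by (rule P.Fubini_integral, rule P.integrable_const_bound[where B=1]) auto
  also have "\<dots> = (CLINT x|M. char ?N (u * x))"
    by (simp add: char_def ac_simps)
  also have "\<dots> = of_real (LINT x|M. exp (- ((u * x)^2) / 2))"
    by (simp only: char_std_normal_distribution integral_complex_of_real)
  finally have eq: "(CLINT z|?N. char M (u * z)) = of_real (LINT x|M. exp (- ((u * x)^2) / 2))" .
  have int1: "integrable ?N (\<lambda>z. char M (u * z))"
    by (rule N.integrable_const_bound[where B=1]) (auto simp: M.cmod_char_le_1)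
  have int2: "integrable M (\<lambda>x. exp (- ((u * x)^2) / 2))"
    by (rule M.integrable_const_bound[where B=1]) auto
  have int3: "integrable ?N (\<lambda>z. C * u powr \<nu> * (1 + z^2))"
    using integrable_std_normal_distribution_moment[of 2] by (intro integrable_mult_right integrable_add) auto
  \<comment> \<open>\<nu> \<le> 2 lets the Gaussian second moment control |z|^\<nu>; the factor 2 in
    the conclusion is the mean of 1 + z^2.\<close>
  have pw: "\<bar>z\<bar> powr \<nu> \<le> 1 + z^2" for z :: real
  proof (cases "\<bar>z\<bar> \<le> 1")
    case True
    then have "\<bar>z\<bar> powr \<nu> \<le> 1" using \<nu> powr_le1 by simp
    then show ?thesis by (smt (verit) zero_le_power2)
  next
    case False
    then have "\<bar>z\<bar> powr \<nu> \<le> \<bar>z\<bar> powr 2" using \<nu> by (intro powr_mono) auto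
    then show ?thesis using False by (simp add: powr_numeral)
  qed
  have "measure M {x. 1 \<le> \<bar>x\<bar> * u} * (1 - exp (- 1 / 2))
      = (LINT x|M. indicator {x. 1 \<le> \<bar>x\<bar> * u} x * (1 - exp (- 1 / 2)))"
    by simp
  also have "\<dots> \<le> (LINT x|M. 1 - exp (- ((u * x)^2) / 2))"
  proof (rule integral_mono)
    fix x :: real
    have "1 - exp (- 1 / 2) \<le> 1 - exp (- ((u * x)^2) / 2)" if "1 \<le> \<bar>x\<bar> * u"
    proof -
      have "1 \<le> (\<bar>x\<bar> * u)^2" using that by (simp add: one_le_power)
      then show ?thesis by (simp add: power_mult_distrib mult.commute)
    qed
    then show "indicator {x. 1 \<le> \<bar>x\<bar> * u} x * (1 - exp (- 1 / 2)) \<le> 1 - exp (- ((u * x)^2) / 2)"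
      by (auto split: split_indicator)
  qed (use int2 in \<open>auto intro: M.integrable_const_bound[where B=1]\<close>)
  also have "\<dots> = Re (CLINT z|?N. 1 - char M (u * z))"
    using int1 int2 eq M.prob_space N.prob_space by (simp add: Bochner_Integration.integral_diff)
  also have "\<dots> \<le> norm (CLINT z|?N. 1 - char M (u * z))" by (rule complex_Re_le_cmod)
  also have "\<dots> \<le> (LINT z|?N. C * u powr \<nu> * (1 + z^2))"
  proof (rule Bochner_Integration.integral_norm_bound_integral)
    fix z :: real
    have "norm (1 - char M (u * z)) \<le> C * \<bar>u * z\<bar> powr \<nu>" by (rule bound)
    also have "\<dots> = C * u powr \<nu> * \<bar>z\<bar> powr \<nu>" using u by (simp add: abs_mult powr_mult)
    also have "\<dots> \<le> C * u powr \<nu> * (1 + z^2)" using C pw by (intro mult_left_mono) auto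
    finally show "norm (1 - char M (u * z)) \<le> C * u powr \<nu> * (1 + z^2)" .
  qed (use int1 int3 in auto)
  also have "\<dots> = C * u powr \<nu> * 2"
    using std_normal_distribution_even_moments[of 1] N.prob_space
    by (simp add: Bochner_Integration.integral_add)
  finally show ?thesis by (simp add: ac_simps)
qed

text \<open>The uniform bound makes the tails small uniformly in n, so a subsequence converges
  weakly; the pointwise limit \<phi> then identifies the characteristic function of its
  limit.\<close>

lemma char_limit_exists:
  fixes M :: "nat \<Rightarrow> real measure"
  assumes M: "\<And>n. real_distribution (M n)" and C: "0 \<le> C" and \<nu>: "0 < \<nu>" "\<nu> \<le> 2"
    and bound: "\<And>n \<gamma>. norm (1 - char (M n) \<gamma>) \<le> C * \<bar>\<gamma>\<bar> powr \<nu>"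
    and lim: "\<And>\<gamma>. (\<lambda>n. char (M n) \<gamma>) \<longlonglongrightarrow> \<phi> \<gamma>"
  shows "\<exists>L. real_distribution L \<and> char L = \<phi>"
proof -
  define c :: real where "c = 1 - exp (- 1 / 2)"
  have c: "0 < c" by (simp add: c_def)
  have "tight M"
    unfolding tight_def
  proof (intro conjI allI impI M)
    fix \<epsilon> :: real assume \<epsilon>: "0 < \<epsilon>"
    \<comment> \<open>Solves (4C + 1) u^\<nu> = \<epsilon> c; using 4C + 1 in place of 2C makes the
      tail estimate strict and avoids a zero denominator when C = 0.\<close>
    define u where "u = (\<epsilon> * c / (4 * C + 1)) powr (1 / \<nu>)"
    have u: "0 < u" using \<epsilon> c C by (simp add: u_def)
    have "u powr \<nu> = \<epsilon> * c / (4 * C + 1)" using \<epsilon> c C \<nu> by (simp add: u_def powr_powr)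
    then have "(4 * C + 1) * u powr \<nu> = \<epsilon> * c" using C by (simp add: field_simps)
    moreover have "2 * C * u powr \<nu> < (4 * C + 1) * u powr \<nu>"
      using u C by (intro mult_strict_right_mono) auto
    ultimately have small: "2 * C * u powr \<nu> < \<epsilon> * c" by simp
    have "1 - \<epsilon> < measure (M n) {- 1 / u <.. 1 / u}" for n
    proof -
      interpret real_distribution "M n" by (rule M)
      have "c * measure (M n) {x. 1 \<le> \<bar>x\<bar> * u} < \<epsilon> * c"
        using real_distribution_tail_le_char[OF M C \<nu> bound u, of n] small by (simp only: c_def)
      then have *: "measure (M n) {x. 1 \<le> \<bar>x\<bar> * u} < \<epsilon>"
        using c by (metis mult.commute mult_less_cancel_left_pos)
      have "1 - measure (M n) {- 1 / u <.. 1 / u} = measure (M n) (space (M n) - {- 1 / u <.. 1 / u})"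
        by (subst prob_compl) auto
      also have "\<dots> \<le> measure (M n) {x. 1 \<le> \<bar>x\<bar> * u}"
      proof (intro finite_measure_mono subsetI)
        fix x assume "x \<in> space (M n) - {- 1 / u <.. 1 / u}"
        then have "1 / u \<le> \<bar>x\<bar>" by auto
        then show "x \<in> {x. 1 \<le> \<bar>x\<bar> * u}" using u by (simp add: pos_divide_le_eq)
      qed auto
      finally show ?thesis using * by simp
    qed
    then show "\<exists>a b. a < b \<and> (\<forall>n. 1 - \<epsilon> < measure (M n) {a<..b})"
      using u by (intro exI[of _ "- 1 / u"] exI[of _ "1 / u"]) (auto simp: field_simps)
  qed
  then obtain r L where r: "strict_mono r" and L: "real_distribution L" and w: "weak_conv_m (M \<circ> id \<circ> r) L"
    using tight_imp_convergent_subsubsequence[of M id] by (auto simp: strict_mono_id)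
  have "char L \<gamma> = \<phi> \<gamma>" for \<gamma>
  proof (rule LIMSEQ_unique)
    show "(\<lambda>n. char ((M \<circ> id \<circ> r) n) \<gamma>) \<longlonglongrightarrow> char L \<gamma>"
      using M by (intro levy_continuity1 L w) auto
    show "(\<lambda>n. char ((M \<circ> id \<circ> r) n) \<gamma>) \<longlonglongrightarrow> \<phi> \<gamma>"
      using LIMSEQ_subseq_LIMSEQ[OF lim r] by (simp add: comp_def)
  qed
  then show ?thesis using L by blast
qed

section \<open>Products and limits of characteristic functions\<close>

lemma real_distribution_distr:
  assumes "prob_space M" "f \<in> borel_measurable M"
  shows "real_distribution (distr M borel f)"
  using assms by (intro prob_space.real_distribution_distr) auto

lemma char_distr_scale:
  assumes "real_distribution M"
  shows "real_distribution (distr M borel (\<lambda>x. k * x))"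
    and "char (distr M borel (\<lambda>x. k * x)) \<gamma> = char M (k * \<gamma>)"
proof -
  interpret real_distribution M by fact
  show "real_distribution (distr M borel (\<lambda>x. k * x))"
    by (rule real_distribution_distr) (auto intro: prob_space_axioms)
  show "char (distr M borel (\<lambda>x. k * x)) \<gamma> = char M (k * \<gamma>)"
    unfolding char_def by (subst integral_distr) (auto simp: ac_simps)
qed

lemma char_mult_exists:
  assumes "real_distribution M" "real_distribution N"
  shows "\<exists>L. real_distribution L \<and> (\<forall>\<gamma>. char L \<gamma> = char M \<gamma> * char N \<gamma>)"
proof (intro exI conjI allI)
  interpret M: real_distribution M by fact
  interpret N: real_distribution N by fact
  interpret P: pair_prob_space M N ..
  let ?L = "distr (M \<Otimes>\<^sub>M N) borel (\<lambda>z. fst z + snd z)"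
  show "real_distribution ?L"
    by (rule real_distribution_distr) (auto intro: P.prob_space_axioms)
  fix \<gamma>
  have "char ?L \<gamma> = (CLINT z|M \<Otimes>\<^sub>M N. iexp (\<gamma> * (fst z + snd z)))"
    unfolding char_def by (subst integral_distr) auto
  also have "\<dots> = (CLINT x|M. CLINT y|N. iexp (\<gamma> * (fst (x, y) + snd (x, y))))"
    by (rule P.integral_fst'[symmetric], rule P.integrable_const_bound[where B=1]) auto
  also have "\<dots> = (CLINT x|M. iexp (\<gamma> * x) * (CLINT y|N. iexp (\<gamma> * y)))"
    by (simp add: distrib_left exp_add)
  finally show "char ?L \<gamma> = char M \<gamma> * char N \<gamma>"
    by (simp add: char_def)
qed

lemma char_power_exists:
  assumes "real_distribution M"
  shows "\<exists>L. real_distribution L \<and> (\<forall>\<gamma>. char L \<gamma> = char M \<gamma> ^ Suc n)"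
proof (induction n)
  case 0
  then show ?case using assms by auto
next
  case (Suc n)
  then obtain L where L: "real_distribution L" "\<forall>\<gamma>. char L \<gamma> = char M \<gamma> ^ Suc n" by blast
  with char_mult_exists[OF assms L(1)] show ?case by auto
qed

text \<open>For z near 1 the power z^n behaves like exp(-n (1 - z)). No logarithm is taken: in the
  closed unit disc |z^n - w^n| \<le> n |z - w|, which compares \<open>char (Q n) \<gamma>\<close>
  with the root exp(-\<psi> \<gamma> / (n + 1)) of the limit. The same inequality with w = 1 carries
  the bound over to the powers.\<close>

lemma char_exp_limit_exists:
  fixes Q :: "nat \<Rightarrow> real measure"
  assumes Q: "\<And>n. real_distribution (Q n)" and C: "0 \<le> C" and \<nu>: "0 < \<nu>" "\<nu> \<le> 2"
    and bound: "\<And>n \<gamma>. norm (of_nat (Suc n) * (1 - char (Q n) \<gamma>)) \<le> C * \<bar>\<gamma>\<bar> powr \<nu>"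
    and lim: "\<And>\<gamma>. (\<lambda>n. of_nat (Suc n) * (1 - char (Q n) \<gamma>)) \<longlonglongrightarrow> \<psi> \<gamma>"
  shows "\<exists>L. real_distribution L \<and> (\<forall>\<gamma>. char L \<gamma> = exp (- \<psi> \<gamma>))"
proof -
  have "\<forall>n. \<exists>L. real_distribution L \<and> (\<forall>\<gamma>. char L \<gamma> = char (Q n) \<gamma> ^ Suc n)"
    using char_power_exists[OF Q] by blast
  then obtain M where M: "\<And>n. real_distribution (M n)" "\<And>n \<gamma>. char (M n) \<gamma> = char (Q n) \<gamma> ^ Suc n"
    by metis
  have Q1: "norm (char (Q n) \<gamma>) \<le> 1" for n \<gamma> by (rule real_distribution.cmod_char_le_1[OF Q])
  have "\<exists>L. real_distribution L \<and> char L = (\<lambda>\<gamma>. exp (- \<psi> \<gamma>))"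
  proof (rule char_limit_exists[OF M(1) C \<nu>])
    fix n \<gamma>
    have "norm (1 - char (M n) \<gamma>) = norm (1 ^ Suc n - char (Q n) \<gamma> ^ Suc n)" by (simp add: M)
    also have "\<dots> \<le> Suc n * norm (1 - char (Q n) \<gamma>)"
      by (rule norm_power_diff) (use Q1 in auto)
    also have "\<dots> = norm (of_nat (Suc n) * (1 - char (Q n) \<gamma>))" by (simp only: norm_mult norm_of_nat)
    also have "\<dots> \<le> C * \<bar>\<gamma>\<bar> powr \<nu>" by (rule bound)
    finally show "norm (1 - char (M n) \<gamma>) \<le> C * \<bar>\<gamma>\<bar> powr \<nu>" .
  next
    fix \<gamma>
    let ?w = "\<lambda>n. exp (- \<psi> \<gamma> / of_nat (Suc n))"
    \<comment> \<open>Places \<open>?w n\<close> in the closed unit disc, where the power comparison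
      applies.\<close>
    have Re: "0 \<le> Re (\<psi> \<gamma>)"
    proof (rule tendsto_lowerbound)
      show "(\<lambda>n. Re (of_nat (Suc n) * (1 - char (Q n) \<gamma>))) \<longlonglongrightarrow> Re (\<psi> \<gamma>)"
        by (intro tendsto_Re lim)
      have "0 \<le> Re (of_nat (Suc n) * (1 - char (Q n) \<gamma>))" for n
        using complex_Re_le_cmod[of "char (Q n) \<gamma>"] Q1[of n \<gamma>]
        by (simp del: of_nat_Suc)
      then show "\<forall>\<^sub>F n in sequentially. 0 \<le> Re (of_nat (Suc n) * (1 - char (Q n) \<gamma>))" by simp
    qed simp
    have w1: "norm (?w n) \<le> 1" for n using Re by (simp del: of_nat_Suc)
    have wS: "?w n ^ Suc n = exp (- \<psi> \<gamma>)" for n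
      by (simp add: exp_of_nat_mult[symmetric] del: of_nat_Suc power_Suc)
    \<comment> \<open>The limit is the derivative of exp at 0; its difference quotient needs a
      nonzero increment, hence the case split.\<close>
    have wlim: "(\<lambda>n. of_nat (Suc n) * (1 - ?w n)) \<longlonglongrightarrow> \<psi> \<gamma>"
    proof (cases "\<psi> \<gamma> = 0")
      case False
      have "((\<lambda>z::complex. (exp z - 1) / z) \<longlongrightarrow> 1) (at 0)"
        using DERIV_exp[of "0::complex"] by (simp add: DERIV_def)
      moreover have "filterlim (\<lambda>n. - \<psi> \<gamma> / of_nat (Suc n)) (at 0) sequentially"
      proof -
        have "(\<lambda>n. - \<psi> \<gamma> * inverse (of_nat (Suc n))) \<longlonglongrightarrow> - \<psi> \<gamma> * 0"
          by (rule tendsto_mult_left[OF LIMSEQ_Suc[OF lim_inverse_n]])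
        then show ?thesis using False by (simp add: filterlim_at divide_inverse del: of_nat_Suc)
      qed
      ultimately have "(\<lambda>n. (exp (- \<psi> \<gamma> / of_nat (Suc n)) - 1) / (- \<psi> \<gamma> / of_nat (Suc n))) \<longlonglongrightarrow> 1"
        by (rule filterlim_compose)
      then have "(\<lambda>n. \<psi> \<gamma> * ((exp (- \<psi> \<gamma> / of_nat (Suc n)) - 1) / (- \<psi> \<gamma> / of_nat (Suc n)))) \<longlonglongrightarrow> \<psi> \<gamma> * 1"
        by (rule tendsto_mult_left)
      moreover have "\<psi> \<gamma> * ((exp (- \<psi> \<gamma> / of_nat (Suc n)) - 1) / (- \<psi> \<gamma> / of_nat (Suc n)))
          = of_nat (Suc n) * (1 - ?w n)" for n
        using False by (simp add: field_simps del: of_nat_Suc)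
      ultimately show ?thesis by simp
    qed simp
    have "(\<lambda>n. char (M n) \<gamma> - exp (- \<psi> \<gamma>)) \<longlonglongrightarrow> 0"
    proof (rule Lim_null_comparison)
      show "(\<lambda>n. norm (of_nat (Suc n) * (1 - ?w n) - of_nat (Suc n) * (1 - char (Q n) \<gamma>))) \<longlonglongrightarrow> 0"
        using tendsto_norm_zero[of "\<lambda>n. of_nat (Suc n) * (1 - ?w n) - of_nat (Suc n) * (1 - char (Q n) \<gamma>)"]
          tendsto_diff[OF wlim lim[of \<gamma>]] by simp
      have "norm (char (M n) \<gamma> - exp (- \<psi> \<gamma>))
          \<le> norm (of_nat (Suc n) * (1 - ?w n) - of_nat (Suc n) * (1 - char (Q n) \<gamma>))" for n
      proof -
        have "norm (char (M n) \<gamma> - exp (- \<psi> \<gamma>)) = norm (char (Q n) \<gamma> ^ Suc n - ?w n ^ Suc n)"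
          by (simp only: M wS)
        also have "\<dots> \<le> Suc n * norm (char (Q n) \<gamma> - ?w n)"
          by (rule norm_power_diff) (use Q1 w1 in auto)
        also have "\<dots> = norm (of_nat (Suc n) * (char (Q n) \<gamma> - ?w n))" by (simp only: norm_mult norm_of_nat)
        also have "of_nat (Suc n) * (char (Q n) \<gamma> - ?w n)
            = of_nat (Suc n) * (1 - ?w n) - of_nat (Suc n) * (1 - char (Q n) \<gamma>)"
          by (simp only: right_diff_distrib) simp
        finally show ?thesis .
      qed
      then show "\<forall>\<^sub>F n in sequentially. norm (char (M n) \<gamma> - exp (- \<psi> \<gamma>))
          \<le> norm (of_nat (Suc n) * (1 - ?w n) - of_nat (Suc n) * (1 - char (Q n) \<gamma>))" by simp
    qed
    then show "(\<lambda>n. char (M n) \<gamma>) \<longlonglongrightarrow> exp (- \<psi> \<gamma>)" by (rule LIM_zero_cancel)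
  qed
  then show ?thesis by auto
qed

section \<open>Mixtures of exponential laws\<close>

lemma exponential_integral_iexp:
  "(CLINT x|density lborel (exponential_density 1). iexp (\<gamma> * x)) = 1 / (1 - \<i> * \<gamma>)"
proof -
  define c where "c = 1 - \<i> * complex_of_real \<gamma>"
  have c: "c \<noteq> 0" by (simp add: c_def complex_eq_iff)
  have "integrable lborel (\<lambda>x. exponential_density 1 x)"
    using prob_space.emeasure_space_1[OF prob_space_exponential_density[of 1]]
    by (intro integrableI_nonneg) (auto simp: emeasure_density cong: nn_integral_cong)
  then have int: "set_integrable lborel {0<..} (\<lambda>x. exp (- c * of_real x))"
    unfolding set_integrable_def
    by (rule Bochner_Integration.integrable_bound)
       (auto simp: c_def exponential_density_def split: split_indicator)
  have "(CLINT x|density lborel (exponential_density 1). iexp (\<gamma> * x))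
      = (CLBINT x. exponential_density 1 x *\<^sub>R iexp (\<gamma> * x))"
    by (rule integral_density) (auto simp: exponential_density_nonneg)
  also have "\<dots> = (CLBINT x:{0<..}. exp (- c * of_real x))"
    unfolding set_lebesgue_integral_def
    by (rule integral_cong_AE, simp, simp, rule AE_mp[OF AE_lborel_singleton[of 0]])
       (auto simp: exponential_density_def c_def scaleR_conv_of_real exp_of_real[symmetric]
          exp_add[symmetric] algebra_simps split: split_indicator)
  also have "\<dots> = (CLBINT x=0..\<infinity>. exp (- c * of_real x))"
    by (simp add: interval_integral_to_infinity_eq zero_ereal_def)
  also have "\<dots> = 0 - (- 1 / c)"
  proof (rule interval_integral_FTC_integrable[where F="\<lambda>x. - exp (- c * of_real x) / c"])
    show "((\<lambda>x. - exp (- c * of_real x) / c) has_vector_derivative exp (- c * of_real x)) (at x)" for x :: real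
    proof -
      have "((\<lambda>z. - exp (- c * z) / c) has_field_derivative exp (- c * of_real x)) (at (of_real x))"
        using c by (auto intro!: derivative_eq_intros)
      then show ?thesis by (rule has_vector_derivative_real_field)
    qed
    have "isCont (\<lambda>x::real. - exp (- c * of_real x) / c) 0" using c by (intro continuous_intros) auto
    then have "((\<lambda>x::real. - exp (- c * of_real x) / c) \<longlongrightarrow> - 1 / c) (at_right 0)"
      unfolding isCont_def by (intro tendsto_within_subset[where S=UNIV and T="{0<..}"]) auto
    then show "(((\<lambda>x. - exp (- c * of_real x) / c) \<circ> real_of_ereal) \<longlongrightarrow> - 1 / c) (at_right 0)"
      by (simp add: zero_ereal_def ereal_tendsto_simps)
    have "((\<lambda>x::real. - exp (- c * of_real x) / c) \<longlongrightarrow> 0) at_top"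
    proof (rule Lim_null_comparison)
      show "\<forall>\<^sub>F x in at_top. norm (- exp (- c * of_real x) / c) \<le> exp (- x) / norm c"
        by (simp add: norm_divide c_def)
      have "((\<lambda>x::real. exp (- x)) \<longlongrightarrow> 0) at_top"
        by (rule filterlim_compose[OF exp_at_bot filterlim_uminus_at_bot_at_top])
      then show "((\<lambda>x::real. exp (- x) / norm c) \<longlongrightarrow> 0) at_top" by (rule tendsto_divide_zero)
    qed
    then show "(((\<lambda>x. - exp (- c * of_real x) / c) \<circ> real_of_ereal) \<longlongrightarrow> 0) (at_left \<infinity>)"
      by (simp add: ereal_tendsto_simps)
    show "set_integrable lborel (einterval 0 \<infinity>) (\<lambda>x. exp (- c * of_real x))"
      using int by (simp add: zero_ereal_def)
  qed auto
  finally show ?thesis by (simp add: c_def)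
qed

text \<open>\<open>Q\<close> is the law of a standard exponential variable divided by an independent variable with law \<open>N\<close>.\<close>

lemma exponential_mixture_exists:
  assumes N: "real_distribution N" and pos: "AE y in N. 0 < y"
  shows "\<exists>Q. real_distribution Q \<and> (\<forall>\<gamma>. char Q \<gamma> = (CLINT y|N. y / (y - \<i> * \<gamma>)))"
proof (intro exI conjI allI)
  let ?E = "density lborel (exponential_density 1)"
  interpret N: real_distribution N by fact
  interpret E: prob_space ?E by (rule prob_space_exponential_density) simp
  interpret P: pair_prob_space ?E N ..
  let ?Q = "distr (?E \<Otimes>\<^sub>M N) borel (\<lambda>z. fst z / snd z)"
  show "real_distribution ?Q"
    by (rule real_distribution_distr) (auto intro: P.prob_space_axioms)
  fix \<gamma>
  have "char ?Q \<gamma> = (CLINT z|?E \<Otimes>\<^sub>M N. iexp (\<gamma> * (fst z / snd z)))"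
    unfolding char_def by (subst integral_distr) auto
  also have "\<dots> = (CLINT y|N. CLINT x|?E. iexp (\<gamma> * (x / y)))"
  proof -
    have "integrable (?E \<Otimes>\<^sub>M N) (case_prod (\<lambda>x y. iexp (\<gamma> * (x / y))))"
      by (rule P.integrable_const_bound[where B=1]) auto
    from P.integral_snd[OF this] show ?thesis by (simp add: case_prod_beta')
  qed
  also have "\<dots> = (CLINT y|N. y / (y - \<i> * \<gamma>))"
  proof (rule integral_cong_AE)
    show "AE y in N. (CLINT x|?E. iexp (\<gamma> * (x / y))) = y / (y - \<i> * \<gamma>)"
      using pos
    proof eventually_elim
      case (elim y)
      have "(CLINT x|?E. iexp (\<gamma> * (x / y))) = 1 / (1 - \<i> * of_real (\<gamma> / y))"
        using exponential_integral_iexp[of "\<gamma> / y"] by simp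
      also have "\<dots> = y / (y - \<i> * \<gamma>)" using elim by (simp add: field_simps)
      finally show ?case .
    qed
  qed auto
  finally show "char ?Q \<gamma> = (CLINT y|N. y / (y - \<i> * \<gamma>))" .
qed

section \<open>Existence of stable laws\<close>

lemma powr_complex_set_integral_Ioo:
  fixes a c k :: real
  assumes "0 < a" "0 \<le> c"
  shows "set_integrable lborel {0<..<c} (\<lambda>x. complex_of_real (k * x powr (a - 1)))"
    and "(CLBINT x:{0<..<c}. complex_of_real (k * x powr (a - 1))) = k * (c powr a / a)"
proof -
  have "set_integrable lborel {0<..<c} (\<lambda>x. k * x powr (a - 1))"
    by (rule set_integrable_mult_right[OF powr_set_integral_Ioo(1)[OF assms]])
  then have "integrable lborel (\<lambda>x. complex_of_real (indicator {0<..<c} x *\<^sub>R (k * x powr (a - 1))))"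
    unfolding set_integrable_def by (rule integrable_of_real)
  then show "set_integrable lborel {0<..<c} (\<lambda>x. complex_of_real (k * x powr (a - 1)))"
    by (simp add: set_integrable_def scaleR_conv_of_real)
  show "(CLBINT x:{0<..<c}. complex_of_real (k * x powr (a - 1))) = k * (c powr a / a)"
    unfolding set_integral_complex_of_real using powr_set_integral_Ioo(2)[OF assms] by simp
qed

lemma power_mixture_exists:
  fixes \<nu> b :: real
  assumes \<nu>: "0 < \<nu>" and b: "0 < b"
  shows "\<exists>Q. real_distribution Q \<and> (\<forall>\<gamma>. char Q \<gamma> =
    (CLBINT y:{0<..<b}. of_real (\<nu> / b powr \<nu> * y powr (\<nu> - 1)) * (y / (y - \<i> * \<gamma>))))"
proof -
  define w where "w y = indicator {0<..<b} y * (\<nu> / b powr \<nu> * y powr (\<nu> - 1))" for y :: real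
  have [measurable]: "w \<in> borel_measurable borel" unfolding w_def by measurable
  have w0: "0 \<le> w y" for y using \<nu> by (simp add: w_def)
  have wint: "integrable lborel w"
    using set_integrable_mult_right[OF powr_set_integral_Ioo(1)[OF \<nu>, of b], of "\<nu> / b powr \<nu>"] b
    by (simp only: set_integrable_def w_def[abs_def] real_scaleR_def less_imp_le)
  have "integral\<^sup>L lborel w = (LBINT y:{0<..<b}. \<nu> / b powr \<nu> * y powr (\<nu> - 1))"
    by (simp only: set_lebesgue_integral_def w_def[abs_def] real_scaleR_def)
  also have "\<dots> = 1" using \<nu> b by (simp add: powr_set_integral_Ioo)
  finally have w1: "integral\<^sup>L lborel w = 1" .
  let ?N = "density lborel w"
  have "emeasure ?N (space ?N) = 1"
    using nn_integral_eq_integral[OF wint] w0 w1 by (simp add: emeasure_density)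
  then have "prob_space ?N" by (rule prob_spaceI)
  then have N: "real_distribution ?N"
    by (simp add: real_distribution_def real_distribution_axioms_def)
  have "AE y in ?N. 0 < y"
    by (subst AE_density) (auto simp: w_def split: split_indicator_asm)
  from exponential_mixture_exists[OF N this] obtain Q where Q: "real_distribution Q"
    "\<And>\<gamma>. char Q \<gamma> = (CLINT y|?N. y / (y - \<i> * \<gamma>))" by blast
  have "char Q \<gamma> = (CLBINT y:{0<..<b}. of_real (\<nu> / b powr \<nu> * y powr (\<nu> - 1)) * (y / (y - \<i> * \<gamma>)))" for \<gamma>
  proof -
    have "char Q \<gamma> = (CLBINT y. w y *\<^sub>R (y / (y - \<i> * \<gamma>)))"
      unfolding Q by (rule integral_density) (use w0 in auto)
    also have "\<dots> = (CLBINT y:{0<..<b}. of_real (\<nu> / b powr \<nu> * y powr (\<nu> - 1)) * (y / (y - \<i> * \<gamma>)))"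
      unfolding set_lebesgue_integral_def
      by (intro Bochner_Integration.integral_cong refl) (simp add: w_def scaleR_conv_of_real split: split_indicator)
    finally show ?thesis .
  qed
  with Q(1) show ?thesis by blast
qed

text \<open>The full kernel is integrable and dominates every truncation. The bound is therefore
  free of b, and the cutoffs can be sent to infinity.\<close>

lemma truncated_Cauchy_kernel:
  fixes s \<gamma> :: real
  assumes s: "0 < s" "s < 1" and \<gamma>: "\<gamma> \<noteq> 0"
  shows "set_integrable lborel {0<..<b} (\<lambda>y. y powr (s - 1) / (y - \<i> * \<gamma>))"
    and "norm (CLBINT y:{0<..<b}. y powr (s - 1) / (y - \<i> * \<gamma>)) \<le>
      \<bar>\<gamma>\<bar> powr (s - 1) * (pi / 2 / cos (pi * s / 2) + pi / 2 / sin (pi * s / 2))"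
    and "filterlim B at_top sequentially \<Longrightarrow>
      (\<lambda>n. CLBINT y:{0<..<B n}. y powr (s - 1) / (y - \<i> * \<gamma>)) \<longlonglongrightarrow>
      of_real (\<bar>\<gamma>\<bar> powr (s - 1) * (pi / 2)) * (1 / cos (pi * s / 2) + \<i> * sgn \<gamma> / sin (pi * s / 2))"
proof -
  define k where "k y = indicator {0<..} y *\<^sub>R (y powr (s - 1) / (y - \<i> * \<gamma>))" for y :: real
  have k: "integrable lborel k"
    using Cauchy_kernel_integral(1)[OF s \<gamma>] by (simp only: set_integrable_def k_def[abs_def])
  have eq: "indicator {0<..<b} y *\<^sub>R (y powr (s - 1) / (y - \<i> * \<gamma>)) = indicator {..<b} y *\<^sub>R k y" for y b :: real
    by (auto simp: k_def split: split_indicator)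
  show "set_integrable lborel {0<..<b} (\<lambda>y. y powr (s - 1) / (y - \<i> * \<gamma>))" for b
    unfolding set_integrable_def eq by (rule integrable_mult_indicator[OF _ k]) simp
  then have int: "integrable lborel (\<lambda>y. indicator {..<b} y *\<^sub>R k y)" for b
    unfolding set_integrable_def eq .
  have Teq: "(CLBINT y:{0<..<b}. y powr (s - 1) / (y - \<i> * \<gamma>)) = (CLBINT y. indicator {..<b} y *\<^sub>R k y)" for b
    unfolding set_lebesgue_integral_def eq ..
  have "norm (CLBINT y:{0<..<b}. y powr (s - 1) / (y - \<i> * \<gamma>)) \<le> (LBINT y. norm (k y))"
    unfolding Teq
    by (rule Bochner_Integration.integral_norm_bound_integral) (use k int in \<open>auto split: split_indicator\<close>)
  also have "\<dots> = (LBINT y:{0<..}. norm (y powr (s - 1) / (y - \<i> * \<gamma>)))"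
    by (simp add: set_lebesgue_integral_def k_def)
  also note Cauchy_kernel_integral(3)[OF s \<gamma>]
  finally show "norm (CLBINT y:{0<..<b}. y powr (s - 1) / (y - \<i> * \<gamma>)) \<le>
      \<bar>\<gamma>\<bar> powr (s - 1) * (pi / 2 / cos (pi * s / 2) + pi / 2 / sin (pi * s / 2))" .
  assume B: "filterlim B at_top sequentially"
  have "(\<lambda>n. CLBINT y. indicator {..<B n} y *\<^sub>R k y) \<longlonglongrightarrow> (CLBINT y. k y)"
  proof (rule integral_dominated_convergence[where w="\<lambda>y. norm (k y)"])
    show "AE y in lborel. (\<lambda>n. indicator {..<B n} y *\<^sub>R k y) \<longlonglongrightarrow> k y"
    proof (rule AE_I2, rule tendsto_eventually)
      fix y
      have "\<forall>\<^sub>F n in sequentially. y < B n"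
        using B by (simp add: filterlim_at_top_dense)
      then show "\<forall>\<^sub>F n in sequentially. indicator {..<B n} y *\<^sub>R k y = k y"
        by eventually_elim (simp split: split_indicator)
    qed
  qed (use k in \<open>auto split: split_indicator\<close>)
  also have "(CLBINT y. k y) = (CLBINT y:{0<..}. y powr (s - 1) / (y - \<i> * \<gamma>))"
    by (simp add: set_lebesgue_integral_def k_def)
  also note Cauchy_kernel_integral(2)[OF s \<gamma>]
  finally show "(\<lambda>n. CLBINT y:{0<..<B n}. y powr (s - 1) / (y - \<i> * \<gamma>)) \<longlonglongrightarrow>
      of_real (\<bar>\<gamma>\<bar> powr (s - 1) * (pi / 2)) * (1 / cos (pi * s / 2) + \<i> * sgn \<gamma> / sin (pi * s / 2))"
    unfolding Teq .
qed

lemma powr_abs_mult: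
  fixes \<gamma> :: real
  shows "\<bar>\<gamma>\<bar> * \<bar>\<gamma>\<bar> powr (s - 1) = \<bar>\<gamma>\<bar> powr s"
  using powr_mult_base[of "\<bar>\<gamma>\<bar>" "s - 1"] by simp

text \<open>The scaled defect \<open>of_nat (Suc n) * (1 - char (Q n) \<gamma>)\<close> is exactly a
  multiple of a truncated Cauchy kernel integral with s = \<nu>. \<open>k0\<close> collects the
  constants of its limit and is scaled away in \<open>one_sided_stable_exists\<close>.\<close>

lemma normalized_one_sided_stable_exists_lt1:
  fixes \<nu> :: real
  assumes \<nu>: "0 < \<nu>" "\<nu> < 1"
  defines "k0 \<equiv> \<nu> * (pi / 2) / sin (pi * \<nu> / 2)"
  shows "\<exists>L. real_distribution L \<and> (\<forall>\<gamma>. char L \<gamma> =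
    exp (- (of_real (k0 * \<bar>\<gamma>\<bar> powr \<nu>) * (1 - \<i> * of_real (sgn \<gamma> * tan (pi * \<nu> / 2))))))"
proof -
  \<comment> \<open>Gives b^\<nu> = n + 1, so the normalisation \<nu> / b^\<nu> of the mixture
    cancels the number of summands.\<close>
  define b where "b n = real (Suc n) powr (1 / \<nu>)" for n
  have b: "0 < b n" for n by (simp add: b_def)
  have bm: "b n powr \<nu> = Suc n" for n using \<nu> by (simp add: b_def powr_powr)
  have blim: "filterlim b at_top sequentially" unfolding b_def using \<nu> by real_asymp
  define T where "T n \<gamma> = (CLBINT y:{0<..<b n}. y powr (\<nu> - 1) / (y - \<i> * complex_of_real \<gamma>))" for n \<gamma>
  define C where "C = pi / 2 / cos (pi * \<nu> / 2) + pi / 2 / sin (pi * \<nu> / 2)"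
  have sc: "0 < sin (pi * \<nu> / 2)" "0 < cos (pi * \<nu> / 2)"
    using \<nu> by (auto intro!: sin_gt_zero cos_gt_zero)
  then have C: "0 \<le> C" by (simp add: C_def)
  obtain Q where Q: "\<And>n. real_distribution (Q n)"
    "\<And>n \<gamma>. char (Q n) \<gamma> = (CLBINT y:{0<..<b n}. of_real (\<nu> / b n powr \<nu> * y powr (\<nu> - 1)) * (y / (y - \<i> * \<gamma>)))"
    using power_mixture_exists[OF \<nu>(1) b] by metis
  have char_Q: "of_nat (Suc n) * (1 - char (Q n) \<gamma>) = - \<i> * \<gamma> * \<nu> * T n \<gamma>" if \<gamma>: "\<gamma> \<noteq> 0" for n \<gamma>
  proof -
    define w where "w y = \<nu> / b n powr \<nu> * y powr (\<nu> - 1)" for y :: real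
    have wint: "set_integrable lborel {0<..<b n} (\<lambda>y. complex_of_real (w y))"
      unfolding w_def using b[of n] \<nu> by (intro powr_complex_set_integral_Ioo) auto
    have w1: "(CLBINT y:{0<..<b n}. complex_of_real (w y)) = 1"
      unfolding w_def using b[of n] \<nu> by (subst powr_complex_set_integral_Ioo(2)) auto
    have Tint: "set_integrable lborel {0<..<b n} (\<lambda>y. \<i> * \<gamma> * \<nu> / b n powr \<nu> * (y powr (\<nu> - 1) / (y - \<i> * \<gamma>)))"
      by (intro set_integrable_mult_right truncated_Cauchy_kernel \<nu> \<gamma>)
    have "char (Q n) \<gamma> = (CLBINT y:{0<..<b n}. of_real (w y) + \<i> * \<gamma> * \<nu> / b n powr \<nu> * (y powr (\<nu> - 1) / (y - \<i> * \<gamma>)))"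
      unfolding Q w_def
    proof (rule set_lebesgue_integral_cong)
      show "\<forall>y. y \<in> {0<..<b n} \<longrightarrow> of_real (\<nu> / b n powr \<nu> * y powr (\<nu> - 1)) * (y / (y - \<i> * \<gamma>)) =
          of_real (\<nu> / b n powr \<nu> * y powr (\<nu> - 1)) + \<i> * \<gamma> * \<nu> / b n powr \<nu> * (y powr (\<nu> - 1) / (y - \<i> * \<gamma>))"
      proof (intro allI impI)
        fix y assume "y \<in> {0<..<b n}"
        then have nz: "complex_of_real y - \<i> * \<gamma> \<noteq> 0" by (auto simp: complex_eq_iff)
        then have "y / (y - \<i> * \<gamma>) = 1 + \<i> * \<gamma> / (y - \<i> * \<gamma>)" by (simp add: add_divide_eq_iff)
        then show "of_real (\<nu> / b n powr \<nu> * y powr (\<nu> - 1)) * (y / (y - \<i> * \<gamma>)) =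
          of_real (\<nu> / b n powr \<nu> * y powr (\<nu> - 1)) + \<i> * \<gamma> * \<nu> / b n powr \<nu> * (y powr (\<nu> - 1) / (y - \<i> * \<gamma>))"
          by (simp add: distrib_left)
      qed
    qed simp
    also have "\<dots> = 1 + \<i> * \<gamma> * \<nu> / b n powr \<nu> * T n \<gamma>"
      by (simp only: set_integral_add(2)[OF wint Tint] set_integral_mult_right w1 T_def)
    finally show ?thesis by (simp add: bm del: of_nat_Suc)
  qed
  show ?thesis
  proof (rule char_exp_limit_exists[OF Q(1), where C="\<nu> * C" and \<nu>=\<nu>])
    show "0 \<le> \<nu> * C" "0 < \<nu>" "\<nu> \<le> 2" using C \<nu> by auto
  next
    fix n \<gamma>
    show "norm (of_nat (Suc n) * (1 - char (Q n) \<gamma>)) \<le> \<nu> * C * \<bar>\<gamma>\<bar> powr \<nu>"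
    proof (cases "\<gamma> = 0")
      case False
      have "norm (of_nat (Suc n) * (1 - char (Q n) \<gamma>)) = \<bar>\<gamma>\<bar> * \<nu> * norm (T n \<gamma>)"
        unfolding char_Q[OF False] using \<nu> by (simp add: norm_mult)
      also have "\<dots> \<le> \<bar>\<gamma>\<bar> * \<nu> * (\<bar>\<gamma>\<bar> powr (\<nu> - 1) * C)"
        unfolding C_def T_def by (intro mult_left_mono truncated_Cauchy_kernel False \<nu>) (use \<nu> in auto)
      also have "\<dots> = \<nu> * C * (\<bar>\<gamma>\<bar> * \<bar>\<gamma>\<bar> powr (\<nu> - 1))" by simp
      finally show ?thesis by (simp only: powr_abs_mult)
    qed (simp add: real_distribution.char_zero[OF Q(1)])
  next
    fix \<gamma>
    show "(\<lambda>n. of_nat (Suc n) * (1 - char (Q n) \<gamma>)) \<longlonglongrightarrow>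
      of_real (k0 * \<bar>\<gamma>\<bar> powr \<nu>) * (1 - \<i> * of_real (sgn \<gamma> * tan (pi * \<nu> / 2)))"
    proof (cases "\<gamma> = 0")
      case False
      let ?K = "of_real (\<bar>\<gamma>\<bar> powr (\<nu> - 1) * (pi / 2)) * (1 / cos (pi * \<nu> / 2) + \<i> * sgn \<gamma> / sin (pi * \<nu> / 2))"
      have "(\<lambda>n. - \<i> * \<gamma> * \<nu> * T n \<gamma>) \<longlonglongrightarrow> - \<i> * \<gamma> * \<nu> * ?K"
        unfolding T_def by (intro tendsto_mult_left truncated_Cauchy_kernel blim \<nu> False)
      \<comment> \<open>Multiplication by -i sgn \<gamma> exchanges the parts of \<open>?K\<close>:
        1 / sin becomes the real and 1 / cos the imaginary one, and their quotient is the
        tangent.\<close>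
      moreover have "- \<i> * \<gamma> * \<nu> * ?K = of_real (k0 * \<bar>\<gamma>\<bar> powr \<nu>) * (1 - \<i> * of_real (sgn \<gamma> * tan (pi * \<nu> / 2)))"
      proof -
        have 1: "\<gamma> * \<bar>\<gamma>\<bar> powr (\<nu> - 1) = sgn \<gamma> * \<bar>\<gamma>\<bar> powr \<nu>"
          using powr_abs_mult[of \<gamma> \<nu>] by (metis mult.assoc sgn_mult_abs)
        have 2: "sgn \<gamma> * sgn \<gamma> = 1" using False by (simp add: sgn_if)
        have "- \<i> * \<gamma> * \<nu> * ?K = of_real (\<nu> * (pi / 2)) * (- \<i> * of_real (\<gamma> * \<bar>\<gamma>\<bar> powr (\<nu> - 1)) *
            (of_real (1 / cos (pi * \<nu> / 2)) + \<i> * of_real (sgn \<gamma> / sin (pi * \<nu> / 2))))"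
          by simp
        also have "\<dots> = of_real (\<nu> * (pi / 2) * \<bar>\<gamma>\<bar> powr \<nu>) * (of_real (sgn \<gamma> * sgn \<gamma> / sin (pi * \<nu> / 2))
            - \<i> * of_real (sgn \<gamma> / cos (pi * \<nu> / 2)))"
          unfolding 1 using 2 by (simp add: algebra_simps flip: of_real_mult)
        also have "of_real (sgn \<gamma> * sgn \<gamma> / sin (pi * \<nu> / 2)) - \<i> * of_real (sgn \<gamma> / cos (pi * \<nu> / 2))
            = of_real (1 / sin (pi * \<nu> / 2)) * (1 - \<i> * of_real (sgn \<gamma> * tan (pi * \<nu> / 2)))"
          using sc unfolding 2 by (simp add: tan_def right_diff_distrib)
        finally show ?thesis by (simp add: k0_def)
      qed
      ultimately show ?thesis by (simp only: char_Q[OF False])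
    qed (simp add: real_distribution.char_zero[OF Q(1)])
  qed
qed

text \<open>For \<open>\<nu> > 1\<close> the mixture has a mean \<open>\<mu> n\<close>. Subtracting an independent exponential variable with the
  same mean, instead of the constant, keeps the characteristic functions rational in \<open>\<gamma>\<close> under the integral.\<close>

lemma normalized_one_sided_stable_exists_gt1:
  fixes \<nu> :: real
  assumes \<nu>: "1 < \<nu>" "\<nu> < 2"
  defines "k0 \<equiv> \<nu> * (pi / 2) / sin (pi * \<nu> / 2)"
  shows "\<exists>L. real_distribution L \<and> (\<forall>\<gamma>. char L \<gamma> =
    exp (- (of_real (k0 * \<bar>\<gamma>\<bar> powr \<nu>) * (1 - \<i> * of_real (sgn \<gamma> * tan (pi * \<nu> / 2))))))"
proof -
  \<comment> \<open>Compensating the mean lowers the power from y^(\<nu>-1) to y^(\<nu>-2) =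
    y^(s-1), which is back in the range of the Cauchy kernel.\<close>
  define s where "s = \<nu> - 1"
  have s: "0 < s" "s < 1" and \<nu>0: "0 < \<nu>" using \<nu> by (auto simp: s_def)
  have s2: "\<nu> - 2 = s - 1" by (simp add: s_def)
  define b where "b n = real (Suc n) powr (1 / \<nu>)" for n
  have b: "0 < b n" for n by (simp add: b_def)
  have bm: "b n powr \<nu> = Suc n" for n using \<nu> by (simp add: b_def powr_powr)
  have blim: "filterlim b at_top sequentially" unfolding b_def using \<nu> by real_asymp
  \<comment> \<open>An exponential of rate y has mean 1 / y; averaging over the rate density \<nu>
    y^(\<nu>-1) / b^\<nu> on (0, b) gives this value, finite because \<nu> > 1.\<close>
  define \<mu> where "\<mu> n = \<nu> / (\<nu> - 1) / b n" for n
  have \<mu>lim: "\<mu> \<longlonglongrightarrow> 0" unfolding \<mu>_def by (intro tendsto_divide_0[OF tendsto_const] filterlim_at_top_imp_at_infinity blim)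
  define T where "T n \<gamma> = (CLBINT y:{0<..<b n}. y powr (s - 1) / (y - \<i> * complex_of_real \<gamma>))" for n \<gamma>
  define C where "C = pi / 2 / cos (pi * s / 2) + pi / 2 / sin (pi * s / 2)"
  have sc: "0 < sin (pi * s / 2)" "0 < cos (pi * s / 2)"
    using s by (auto intro!: sin_gt_zero cos_gt_zero)
  then have C: "0 \<le> C" by (simp add: C_def)
  have shift: "pi * s / 2 = pi * \<nu> / 2 - pi / 2" by (simp add: s_def algebra_simps diff_divide_distrib)
  have cos_s: "cos (pi * s / 2) = sin (pi * \<nu> / 2)" and sin_s: "sin (pi * s / 2) = - cos (pi * \<nu> / 2)"
    unfolding shift by (simp_all add: cos_diff sin_diff)
  obtain Q where Q: "\<And>n. real_distribution (Q n)"
    "\<And>n \<gamma>. char (Q n) \<gamma> = (CLBINT y:{0<..<b n}. of_real (\<nu> / b n powr \<nu> * y powr (\<nu> - 1)) * (y / (y - \<i> * \<gamma>)))"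
    using power_mixture_exists[OF \<nu>0 b] by metis
  have nzc: "1 + \<i> * \<gamma> * \<mu> n \<noteq> 0" for \<gamma> :: real and n by (simp add: complex_eq_iff)
  have char_Q: "char (Q n) \<gamma> = 1 + \<i> * \<gamma> * \<mu> n - \<gamma>^2 * \<nu> / of_nat (Suc n) * T n \<gamma>" if \<gamma>: "\<gamma> \<noteq> 0" for n \<gamma>
  proof -
    define w1 where "w1 y = \<nu> / b n powr \<nu> * y powr (\<nu> - 1)" for y :: real
    define w2 where "w2 y = \<nu> / b n powr \<nu> * y powr (s - 1)" for y :: real
    have w1int: "set_integrable lborel {0<..<b n} (\<lambda>y. complex_of_real (w1 y))"
      unfolding w1_def using b[of n] \<nu> by (intro powr_complex_set_integral_Ioo) auto
    have w2int: "set_integrable lborel {0<..<b n} (\<lambda>y. \<i> * \<gamma> * complex_of_real (w2 y))"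
      unfolding w2_def using b[of n] s by (intro set_integrable_mult_right powr_complex_set_integral_Ioo) auto
    have w1: "(CLBINT y:{0<..<b n}. complex_of_real (w1 y)) = 1"
      unfolding w1_def using b[of n] \<nu> by (subst powr_complex_set_integral_Ioo(2)) auto
    have w2: "(CLBINT y:{0<..<b n}. complex_of_real (w2 y)) = \<mu> n"
    proof -
      have "b n powr s = b n powr \<nu> / b n" using b[of n] by (simp add: s_def powr_diff)
      then have "\<nu> / b n powr \<nu> * (b n powr s / s) = \<mu> n" using b[of n] by (simp add: \<mu>_def s_def)
      then show ?thesis
        unfolding w2_def using b[of n] s by (subst powr_complex_set_integral_Ioo(2)) auto
    qed
    have Tint: "set_integrable lborel {0<..<b n} (\<lambda>y. - (\<gamma>^2) * \<nu> / b n powr \<nu> * (y powr (s - 1) / (y - \<i> * \<gamma>)))"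
      by (intro set_integrable_mult_right truncated_Cauchy_kernel s \<gamma>)
    have "char (Q n) \<gamma> = (CLBINT y:{0<..<b n}. (of_real (w1 y) + \<i> * \<gamma> * of_real (w2 y))
        + - (\<gamma>^2) * \<nu> / b n powr \<nu> * (y powr (s - 1) / (y - \<i> * \<gamma>)))"
      unfolding Q
    proof (rule set_lebesgue_integral_cong)
      show "\<forall>y. y \<in> {0<..<b n} \<longrightarrow> of_real (\<nu> / b n powr \<nu> * y powr (\<nu> - 1)) * (y / (y - \<i> * \<gamma>)) =
          (of_real (w1 y) + \<i> * \<gamma> * of_real (w2 y)) + - (\<gamma>^2) * \<nu> / b n powr \<nu> * (y powr (s - 1) / (y - \<i> * \<gamma>))"
      proof (intro allI impI)
        fix y assume y: "y \<in> {0<..<b n}"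
        then have nz: "complex_of_real y - \<i> * \<gamma> \<noteq> 0" by (auto simp: complex_eq_iff)
        have "y powr (\<nu> - 1) = y powr (s - 1) * y"
          using powr_mult_base[of y "s - 1"] y by (simp add: s_def mult.commute)
        then have w12: "complex_of_real (w1 y) = of_real (w2 y) * y" by (simp add: w1_def w2_def)
        \<comment> \<open>Division of y^2 by y - i\<gamma>: the quotient y + i\<gamma> supplies the
          mass and mean terms, the remainder -\<gamma>^2 the kernel.\<close>
        have kern: "y * (y / (y - \<i> * \<gamma>)) = y + \<i> * \<gamma> - \<gamma>^2 * (1 / (y - \<i> * \<gamma>))"
        proof -
          have "(y + \<i> * \<gamma>) * (y - \<i> * \<gamma>) = y * y + \<gamma>^2"
            by (simp add: algebra_simps power2_eq_square)
          then have "y * y = (y + \<i> * \<gamma>) * (y - \<i> * \<gamma>) - \<gamma>^2" by simp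
          then have "y * y / (y - \<i> * \<gamma>) = (y + \<i> * \<gamma>) - \<gamma>^2 / (y - \<i> * \<gamma>)"
            using nz by (simp add: diff_divide_distrib)
          then show ?thesis by simp
        qed
        have "of_real (w1 y) * (y / (y - \<i> * \<gamma>)) = of_real (w2 y) * (y * (y / (y - \<i> * \<gamma>)))"
          unfolding w12 by simp
        also have "\<dots> = (of_real (w1 y) + \<i> * \<gamma> * of_real (w2 y)) + - (\<gamma>^2) * of_real (w2 y) * (1 / (y - \<i> * \<gamma>))"
          unfolding kern w12 by (simp add: algebra_simps)
        finally show "of_real (\<nu> / b n powr \<nu> * y powr (\<nu> - 1)) * (y / (y - \<i> * \<gamma>)) =
          (of_real (w1 y) + \<i> * \<gamma> * of_real (w2 y)) + - (\<gamma>^2) * \<nu> / b n powr \<nu> * (y powr (s - 1) / (y - \<i> * \<gamma>))"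
          by (simp add: w2_def w1_def)
      qed
    qed simp
    also have "\<dots> = 1 + \<i> * \<gamma> * \<mu> n + - (\<gamma>^2) * \<nu> / b n powr \<nu> * T n \<gamma>"
      by (simp only: set_integral_add(2)[OF set_integral_add(1)[OF w1int w2int] Tint]
          set_integral_add(2)[OF w1int w2int] set_integral_mult_right w1 w2 T_def)
    finally show ?thesis by (simp add: bm)
  qed
  \<comment> \<open>The factor 1 / (1 + i\<gamma>\<mu>) belongs to minus an exponential of mean
    \<mu>; it divides out the leading terms 1 + i\<gamma>\<mu> of \<open>char (Q n) \<gamma>\<close>
    exactly.\<close>
  have "\<exists>R. real_distribution R \<and> (\<forall>\<gamma>. char R \<gamma> = char (Q n) \<gamma> * (1 / (1 + \<i> * \<gamma> * \<mu> n)))" for n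
  proof -
    let ?E = "density lborel (exponential_density 1)"
    have E: "real_distribution ?E"
      using prob_space_exponential_density[of 1] by (simp add: real_distribution_def real_distribution_axioms_def)
    have "char (distr ?E borel (\<lambda>x. - \<mu> n * x)) \<gamma> = 1 / (1 + \<i> * \<gamma> * \<mu> n)" for \<gamma>
      unfolding char_distr_scale(2)[OF E] using exponential_integral_iexp[of "- \<mu> n * \<gamma>"]
      by (simp add: char_def mult_ac)
    then show ?thesis
      using char_mult_exists[OF Q(1) char_distr_scale(1)[OF E], of n "- \<mu> n"] by simp
  qed
  then obtain R where R: "\<And>n. real_distribution (R n)"
    "\<And>n \<gamma>. char (R n) \<gamma> = char (Q n) \<gamma> * (1 / (1 + \<i> * \<gamma> * \<mu> n))" by metis
  have char_R: "of_nat (Suc n) * (1 - char (R n) \<gamma>) = \<gamma>^2 * \<nu> * T n \<gamma> / (1 + \<i> * \<gamma> * \<mu> n)" if \<gamma>: "\<gamma> \<noteq> 0" for n \<gamma>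
  proof -
    have "1 - char (R n) \<gamma> = (\<gamma>^2 * \<nu> / of_nat (Suc n) * T n \<gamma>) / (1 + \<i> * \<gamma> * \<mu> n)"
      unfolding R char_Q[OF \<gamma>] using nzc[of \<gamma> n] by (simp add: diff_divide_distrib del: of_nat_Suc)
    then show ?thesis by (simp del: of_nat_Suc)
  qed
  show ?thesis
  proof (rule char_exp_limit_exists[OF R(1), where C="\<nu> * C" and \<nu>=\<nu>])
    show "0 \<le> \<nu> * C" "0 < \<nu>" "\<nu> \<le> 2" using C \<nu> by auto
  next
    fix n \<gamma>
    show "norm (of_nat (Suc n) * (1 - char (R n) \<gamma>)) \<le> \<nu> * C * \<bar>\<gamma>\<bar> powr \<nu>"
    proof (cases "\<gamma> = 0")
      case False
      \<comment> \<open>The compensating denominator has real part 1, so dividing by it cannot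
        increase the norm.\<close>
      have "1 \<le> norm (1 + \<i> * complex_of_real \<gamma> * \<mu> n)"
        using abs_Re_le_cmod[of "1 + \<i> * complex_of_real \<gamma> * \<mu> n"] by simp
      then have "norm (of_nat (Suc n) * (1 - char (R n) \<gamma>)) \<le> norm (complex_of_real (\<gamma>^2 * \<nu>) * T n \<gamma>)"
        unfolding char_R[OF False] norm_divide
        using divide_left_mono[of 1 "norm (1 + \<i> * complex_of_real \<gamma> * \<mu> n)" "norm (complex_of_real (\<gamma>^2 * \<nu>) * T n \<gamma>)"]
          nzc[of \<gamma> n] by simp
      also have "\<dots> = \<bar>\<gamma>\<bar>^2 * \<nu> * norm (T n \<gamma>)" using \<nu> by (simp add: norm_mult norm_power)
      also have "\<dots> \<le> \<bar>\<gamma>\<bar>^2 * \<nu> * (\<bar>\<gamma>\<bar> powr (s - 1) * C)"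
        unfolding C_def T_def by (intro mult_left_mono truncated_Cauchy_kernel False s) (use \<nu> in auto)
      also have "\<dots> = \<nu> * C * (\<bar>\<gamma>\<bar> * (\<bar>\<gamma>\<bar> * \<bar>\<gamma>\<bar> powr (s - 1)))" by (simp add: power2_eq_square)
      also have "\<dots> = \<nu> * C * \<bar>\<gamma>\<bar> powr \<nu>" unfolding powr_abs_mult using powr_abs_mult[of \<gamma> \<nu>] by (simp add: s_def)
      finally show ?thesis .
    qed (simp add: real_distribution.char_zero[OF R(1)])
  next
    fix \<gamma>
    show "(\<lambda>n. of_nat (Suc n) * (1 - char (R n) \<gamma>)) \<longlonglongrightarrow>
      of_real (k0 * \<bar>\<gamma>\<bar> powr \<nu>) * (1 - \<i> * of_real (sgn \<gamma> * tan (pi * \<nu> / 2)))"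
    proof (cases "\<gamma> = 0")
      case False
      let ?K = "of_real (\<bar>\<gamma>\<bar> powr (s - 1) * (pi / 2)) * (1 / cos (pi * s / 2) + \<i> * sgn \<gamma> / sin (pi * s / 2))"
      have "(\<lambda>n. complex_of_real (\<gamma>^2 * \<nu>) * T n \<gamma> / (1 + \<i> * \<gamma> * \<mu> n)) \<longlonglongrightarrow> complex_of_real (\<gamma>^2 * \<nu>) * ?K / (1 + \<i> * \<gamma> * of_real 0)"
        unfolding T_def
        by (intro tendsto_divide tendsto_mult_left tendsto_add tendsto_const tendsto_of_real \<mu>lim truncated_Cauchy_kernel blim s False) simp
      moreover have "complex_of_real (\<gamma>^2 * \<nu>) * ?K / (1 + \<i> * \<gamma> * of_real 0) = of_real (k0 * \<bar>\<gamma>\<bar> powr \<nu>) * (1 - \<i> * of_real (sgn \<gamma> * tan (pi * \<nu> / 2)))"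
      proof -
        have "\<gamma>^2 * \<bar>\<gamma>\<bar> powr (s - 1) = \<bar>\<gamma>\<bar> * (\<bar>\<gamma>\<bar> * \<bar>\<gamma>\<bar> powr (s - 1))"
          by (simp add: power2_eq_square)
        then have 1: "\<gamma>^2 * \<bar>\<gamma>\<bar> powr (s - 1) = \<bar>\<gamma>\<bar> powr \<nu>"
          unfolding powr_abs_mult using powr_abs_mult[of \<gamma> \<nu>] by (simp add: s_def)
        have nz: "sin (pi * \<nu> / 2) \<noteq> 0" "cos (pi * \<nu> / 2) \<noteq> 0" using sc cos_s sin_s by auto
        have "complex_of_real (\<gamma>^2 * \<nu>) * ?K = of_real (\<nu> * (pi / 2)) * (of_real (\<gamma>^2 * \<bar>\<gamma>\<bar> powr (s - 1)) *
            (of_real (1 / cos (pi * s / 2)) + \<i> * of_real (sgn \<gamma> / sin (pi * s / 2))))"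
          by simp
        also have "of_real (1 / cos (pi * s / 2)) + \<i> * of_real (sgn \<gamma> / sin (pi * s / 2))
            = of_real (1 / sin (pi * \<nu> / 2)) * (1 - \<i> * of_real (sgn \<gamma> * tan (pi * \<nu> / 2)))"
          unfolding cos_s sin_s using nz by (simp add: tan_def right_diff_distrib)
        finally show ?thesis unfolding 1 by (simp add: k0_def mult_ac)
      qed
      ultimately show ?thesis by (simp only: char_R[OF False] of_real_mult of_real_power)
    qed (simp add: real_distribution.char_zero[OF R(1)])
  qed
qed

text \<open>Scaling by k multiplies \<open>k0\<close> by k^\<nu>. The degenerate case c = 0 is kept
  because \<beta> = 1 and \<beta> = -1 produce it in \<open>stable_exists\<close>.\<close>

lemma one_sided_stable_exists:
  fixes \<nu> c :: real
  assumes \<nu>: "0 < \<nu>" "\<nu> < 2" "\<nu> \<noteq> 1" and c: "0 \<le> c"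
  shows "\<exists>L. real_distribution L \<and> (\<forall>\<gamma>. char L \<gamma> =
    exp (- (of_real (c * \<bar>\<gamma>\<bar> powr \<nu>) * (1 - \<i> * of_real (sgn \<gamma> * tan (pi * \<nu> / 2))))))"
proof -
  define k0 where "k0 = \<nu> * (pi / 2) / sin (pi * \<nu> / 2)"
  have "0 < sin (pi * \<nu> / 2)" using \<nu> by (intro sin_gt_zero) auto
  then have k0: "0 < k0" using \<nu> by (simp add: k0_def)
  define k where "k = (c / k0) powr (1 / \<nu>)"
  obtain L where L: "real_distribution L" "\<And>\<gamma>. char L \<gamma> =
    exp (- (of_real (k0 * \<bar>\<gamma>\<bar> powr \<nu>) * (1 - \<i> * of_real (sgn \<gamma> * tan (pi * \<nu> / 2)))))"
    using normalized_one_sided_stable_exists_lt1[of \<nu>] normalized_one_sided_stable_exists_gt1[of \<nu>] \<nu>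
    unfolding k0_def by (metis linorder_neqE_linordered_idom)
  have "char (distr L borel (\<lambda>x. k * x)) \<gamma> =
    exp (- (of_real (c * \<bar>\<gamma>\<bar> powr \<nu>) * (1 - \<i> * of_real (sgn \<gamma> * tan (pi * \<nu> / 2)))))" for \<gamma>
  proof (cases "c = 0")
    case True
    then have "k = 0" by (simp add: k_def)
    then show ?thesis using True by (simp only: char_distr_scale(2)[OF L(1)] L(2)) simp
  next
    case False
    then have k: "0 < k" using c k0 by (simp add: k_def)
    have "\<bar>k * \<gamma>\<bar> powr \<nu> = k powr \<nu> * \<bar>\<gamma>\<bar> powr \<nu>" using k by (simp add: abs_mult powr_mult)
    also have "k powr \<nu> = c / k0" using \<nu> c k0 by (simp add: k_def powr_powr)
    finally have "k0 * \<bar>k * \<gamma>\<bar> powr \<nu> = c * \<bar>\<gamma>\<bar> powr \<nu>" using k0 by simp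
    moreover have "sgn (k * \<gamma>) = sgn \<gamma>" using k by (simp add: sgn_mult)
    ultimately show ?thesis by (simp only: char_distr_scale(2)[OF L(1)] L(2))
  qed
  then show ?thesis using char_distr_scale(1)[OF L(1)] by blast
qed

text \<open>The condition \<beta> in [-1, 1] makes the two scales c (1 + \<beta>) / 2 and c (1 -
  \<beta>) / 2 nonnegative. Reflection flips the sign of the skewness, so the scales add in the real
  part of the exponent and subtract in the imaginary part, leaving c and c \<beta>.\<close>

lemma stable_exists:
  fixes \<nu> \<beta> c :: real
  assumes \<nu>: "0 < \<nu>" "\<nu> < 2" "\<nu> \<noteq> 1" and c: "0 \<le> c" and \<beta>: "-1 \<le> \<beta>" "\<beta> \<le> 1"
  shows "\<exists>L. real_distribution L \<and> (\<forall>\<gamma>. char L \<gamma> =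
    exp (- (of_real (c * \<bar>\<gamma>\<bar> powr \<nu>) * (1 - \<i> * of_real (\<beta> * sgn \<gamma> * tan (pi * \<nu> / 2))))))"
proof -
  obtain L1 where L1: "real_distribution L1" "\<And>\<gamma>. char L1 \<gamma> =
    exp (- (of_real (c * (1 + \<beta>) / 2 * \<bar>\<gamma>\<bar> powr \<nu>) * (1 - \<i> * of_real (sgn \<gamma> * tan (pi * \<nu> / 2)))))"
    using one_sided_stable_exists[OF \<nu>, of "c * (1 + \<beta>) / 2"] c \<beta> by auto
  obtain L2 where L2: "real_distribution L2" "\<And>\<gamma>. char L2 \<gamma> =
    exp (- (of_real (c * (1 - \<beta>) / 2 * \<bar>\<gamma>\<bar> powr \<nu>) * (1 - \<i> * of_real (sgn \<gamma> * tan (pi * \<nu> / 2)))))"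
    using one_sided_stable_exists[OF \<nu>, of "c * (1 - \<beta>) / 2"] c \<beta> by auto
  obtain L where L: "real_distribution L"
    "\<And>\<gamma>. char L \<gamma> = char L1 \<gamma> * char (distr L2 borel (\<lambda>x. - 1 * x)) \<gamma>"
    using char_mult_exists[OF L1(1) char_distr_scale(1)[OF L2(1)]] by blast
  have "char L \<gamma> = exp (- (of_real (c * \<bar>\<gamma>\<bar> powr \<nu>) * (1 - \<i> * of_real (\<beta> * sgn \<gamma> * tan (pi * \<nu> / 2)))))" for \<gamma>
    unfolding L char_distr_scale(2)[OF L2(1)] L1 L2 exp_add[symmetric]
    by (rule arg_cong[where f=exp]) (simp add: complex_eq_iff field_simps)
  then show ?thesis using L(1) by blast
qed

section \<open>Fourier inversion\<close>

text \<open>The factor (e^(-ita) - e^(-itb)) / (it) in Levy's inversion formula is the integral of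
  e^(-itx) over [a, b]. Once \<open>char M\<close> is integrable, the symmetric cutoff disappears by
  dominated convergence and Fubini exposes the density.\<close>

lemma (in real_distribution) measure_Ioc_char_integrable:
  assumes int: "integrable lborel (char M)" and ab: "a \<le> b"
    and at: "measure M {a} = 0" "measure M {b} = 0"
  defines "f \<equiv> \<lambda>x. Re (1 / (2 * pi) * (CLBINT \<gamma>. iexp (- (\<gamma> * x)) * char M \<gamma>))"
  shows "measure M {a<..b} = (LBINT x:{a..b}. f x)"
proof -
  \<comment> \<open>\<open>G 0\<close> is 0 by the convention on division instead of b - a; the
    identity \<open>G_eq\<close> is therefore stated for t \<noteq> 0 and used almost
    everywhere.\<close>
  define G where "G t = (iexp (-(t * a)) - iexp (-(t * b))) / (\<i> * t) * char M t" for t :: real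
  have [measurable]: "G \<in> borel_measurable borel" unfolding G_def by measurable
  have Gb: "norm (G t) \<le> (b - a) * norm (char M t)" for t
  proof (cases "t = 0")
    case False
    have "norm ((iexp (-(t * a)) - iexp (-(t * b))) / (\<i> * t)) \<le> b - a"
      using Levy_Inversion_aux2[of "-b" "-a" t] ab False by simp
    then show ?thesis unfolding G_def norm_mult by (rule mult_right_mono) simp
  qed (use ab in \<open>simp add: G_def\<close>)
  have Gint: "integrable lborel G"
    by (rule Bochner_Integration.integrable_bound[where f="\<lambda>t. (b - a) * norm (char M t)"])
       (use int Gb ab in auto)
  have "(\<lambda>n::nat. CLBINT t=ereal (- real n)..ereal (real n). G t) \<longlonglongrightarrow> (CLBINT t. G t)"
  proof -
    have "(\<lambda>n::nat. CLBINT t. indicator {-real n<..<real n} t *\<^sub>R G t) \<longlonglongrightarrow> (CLBINT t. G t)"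
    proof (rule integral_dominated_convergence[where w="\<lambda>t. norm (G t)"])
      show "AE t in lborel. (\<lambda>n. indicator {-real n<..<real n} t *\<^sub>R G t) \<longlonglongrightarrow> G t"
      proof (rule AE_I2, rule tendsto_eventually)
        fix t :: real
        obtain N :: nat where "\<bar>t\<bar> < N" using reals_Archimedean2 by blast
        then show "\<forall>\<^sub>F n in sequentially. indicator {-real n<..<real n} t *\<^sub>R G t = G t"
          by (intro eventually_sequentiallyI[of N]) (auto split: split_indicator)
      qed
    qed (use Gint in \<open>auto split: split_indicator\<close>)
    then show ?thesis
      by (simp add: interval_lebesgue_integral_def set_lebesgue_integral_def)
  qed
  then have "(\<lambda>n::nat. 1 / (2 * pi) * (CLBINT t=ereal (- real n)..ereal (real n). G t)) \<longlonglongrightarrow> 1 / (2 * pi) * (CLBINT t. G t)"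
    by (rule tendsto_mult_left)
  then have "complex_of_real (measure M {a<..b}) = 1 / (2 * pi) * (CLBINT t. G t)"
    using Levy_Inversion[OF ab at] unfolding G_def by (intro LIMSEQ_unique) auto
  moreover have "(CLBINT t. G t) = (CLBINT x. indicator {a..b} x *\<^sub>R (CLBINT t. iexp (- (t * x)) * char M t))"
  proof -
    have G_eq: "G t = (CLBINT x. indicator {a..b} x *\<^sub>R (iexp (- (t * x)) * char M t))" if "t \<noteq> 0" for t
    proof -
      have "(CLBINT x:{a..b}. iexp (- (t * x))) = (iexp (-(t * a)) - iexp (-(t * b))) / (\<i> * t)"
      proof -
        have "(CLBINT x=a..b. iexp (- (t * x))) = \<i> / t * iexp (- (t * b)) - \<i> / t * iexp (- (t * a))"
          using ab that
          by (intro interval_integral_FTC_finite)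
             (auto intro!: derivative_eq_intros continuous_intros
                simp: has_vector_derivative_complex_iff Re_exp Im_exp)
        also have "\<dots> = (iexp (-(t * a)) - iexp (-(t * b))) / (\<i> * t)"
          using that by (simp add: field_simps)
        finally show ?thesis using ab by (simp add: interval_integral_Icc)
      qed
      then have "G t = (CLBINT x:{a..b}. iexp (- (t * x))) * char M t"
        by (simp add: G_def)
      then show ?thesis
        by (simp add: set_lebesgue_integral_def flip: integral_mult_left_zero)
    qed
    have "AE t in lborel. t \<noteq> (0::real)" by (rule AE_lborel_singleton)
    then have "AE t in lborel. G t = (CLBINT x. indicator {a..b} x *\<^sub>R (iexp (- (t * x)) * char M t))"
      by eventually_elim (rule G_eq)
    then have "(CLBINT t. G t) = (CLBINT t. CLBINT x. indicator {a..b} x *\<^sub>R (iexp (- (t * x)) * char M t))"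
      by (intro integral_cong_AE) auto
    also have "\<dots> = (CLBINT x. CLBINT t. indicator {a..b} x *\<^sub>R (iexp (- (t * x)) * char M t))"
    proof (rule lborel_pair.Fubini_integral, rule lborel_pair.Fubini_integrable)
      show "AE x in lborel. complex_integrable lborel
         (\<lambda>y. case (x, y) of (x, t) \<Rightarrow> indicat_real {a..b} x *\<^sub>R (iexp (- (t * x)) * char M t))"
        by (intro AE_I2, rule Bochner_Integration.integrable_bound[OF int])
           (auto simp: norm_mult split: split_indicator)
      show "integrable lborel (\<lambda>x. LBINT y. norm (case (x, y) of (x, t) \<Rightarrow>
          indicat_real {a..b} x *\<^sub>R (iexp (- (t * x)) * char M t)))"
        using int ab by (simp add: norm_mult integrable_indicator_iff emeasure_lborel_Icc)
    qed auto
    finally show ?thesis by simp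
  qed
  ultimately have "complex_of_real (measure M {a<..b}) =
      (CLBINT x. 1 / (2 * pi) * (indicator {a..b} x *\<^sub>R (CLBINT t. iexp (- (t * x)) * char M t)))"
    by (simp only: integral_mult_right_zero)
  then have "complex_of_real (measure M {a<..b}) =
      (CLBINT x. indicator {a..b} x *\<^sub>R (1 / (2 * pi) * (CLBINT t. iexp (- (t * x)) * char M t)))"
    by (simp only: mult_scaleR_right)
  then have "measure M {a<..b} =
      Re (CLBINT x. indicator {a..b} x *\<^sub>R (1 / (2 * pi) * (CLBINT t. iexp (- (t * x)) * char M t)))"
    by (metis Re_complex_of_real)
  also have "\<dots> = (LBINT x. Re (indicator {a..b} x *\<^sub>R (1 / (2 * pi) * (CLBINT t. iexp (- (t * x)) * char M t))))"
  proof (rule integral_Re[symmetric], rule integrableI_bounded_set_indicator)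
    show "AE x in lborel. x \<in> {a..b} \<longrightarrow> norm (1 / (2 * pi) * (CLBINT t. iexp (- (t * x)) * char M t))
         \<le> 1 / (2 * pi) * (LBINT t. norm (char M t))"
    proof (intro AE_I2 impI)
      fix x :: real
      have "norm (CLBINT t. iexp (- (t * x)) * char M t) \<le> (LBINT t. norm (iexp (- (t * x)) * char M t))"
        by (rule integral_norm_bound)
      also have "\<dots> = (LBINT t. norm (char M t))" by (simp add: norm_mult)
      finally show "norm (1 / (2 * pi) * (CLBINT t. iexp (- (t * x)) * char M t))
         \<le> 1 / (2 * pi) * (LBINT t. norm (char M t))"
        by (simp add: norm_mult norm_divide divide_right_mono)
    qed
    show "emeasure lborel {a..b} < \<infinity>" using ab by simp
  qed auto
  also have "\<dots> = (LBINT x:{a..b}. f x)"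
    by (simp add: set_lebesgue_integral_def f_def)
  finally show ?thesis .
qed

lemma isCont_fourier_integral:
  fixes \<phi> :: "real \<Rightarrow> complex"
  assumes int: "integrable lborel \<phi>"
  shows "isCont (\<lambda>x. CLBINT \<gamma>. iexp (- (\<gamma> * x)) * \<phi> \<gamma>) x"
  unfolding continuous_at_sequentially comp_def
proof safe
  fix X :: "nat \<Rightarrow> real" assume X: "X \<longlonglongrightarrow> x"
  have [measurable]: "\<phi> \<in> borel_measurable borel" using int by (simp add: borel_measurable_integrable)
  show "(\<lambda>n. CLBINT \<gamma>. iexp (- (\<gamma> * X n)) * \<phi> \<gamma>) \<longlonglongrightarrow> (CLBINT \<gamma>. iexp (- (\<gamma> * x)) * \<phi> \<gamma>)"
  proof (rule integral_dominated_convergence[where w="\<lambda>\<gamma>. norm (\<phi> \<gamma>)"])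
    show "AE \<gamma> in lborel. (\<lambda>n. iexp (- (\<gamma> * X n)) * \<phi> \<gamma>) \<longlonglongrightarrow> iexp (- (\<gamma> * x)) * \<phi> \<gamma>"
      by (intro AE_I2 tendsto_intros X)
    show "AE \<gamma> in lborel. norm (iexp (- (\<gamma> * X n)) * \<phi> \<gamma>) \<le> norm (\<phi> \<gamma>)" for n
      by (simp add: norm_mult)
  qed (use int in auto)
qed

text \<open>Levy inversion is available only for endpoints that are not atoms. Atoms are countable,
  so good endpoints are dense, and boundedness of f then shows that there are no atoms at all.
  Nonnegativity follows from continuity: a negative value would give some interval negative
  measure.\<close>

lemma (in real_distribution) Fourier_inversion:
  assumes int: "integrable lborel (char M)"
  defines "f \<equiv> \<lambda>x. Re (1 / (2 * pi) * (CLBINT \<gamma>. iexp (- (\<gamma> * x)) * char M \<gamma>))"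
  shows "0 \<le> f x" and "M = density lborel f"
proof -
  have cont: "isCont f x" for x
    unfolding f_def
    by (intro isCont_Re continuous_mult continuous_const isCont_fourier_integral int)
  then have contf: "continuous_on A f" for A by (simp add: continuous_at_imp_continuous_on)
  then have [measurable]: "f \<in> borel_measurable borel" by (rule borel_measurable_continuous_onI)
  have intf: "set_integrable lborel {a..b} f" for a b
    by (rule borel_integrable_compact[OF compact_Icc contf, folded set_integrable_def])
  define K where "K = 1 / (2 * pi) * (LBINT t. norm (char M t))"
  have fK: "f x \<le> K" for x
  proof -
    have "f x \<le> norm (1 / (2 * pi) * (CLBINT t. iexp (- (t * x)) * char M t))"
      unfolding f_def by (rule complex_Re_le_cmod)
    also have "\<dots> = 1 / (2 * pi) * norm (CLBINT t. iexp (- (t * x)) * char M t)"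
      by (simp add: norm_mult norm_divide)
    also have "\<dots> \<le> 1 / (2 * pi) * (LBINT t. norm (iexp (- (t * x)) * char M t))"
      by (intro mult_left_mono integral_norm_bound) simp
    also have "\<dots> = K" by (simp add: norm_mult K_def)
    finally show ?thesis .
  qed
  have K0: "0 \<le> K" by (simp add: K_def)
  define A where "A = {x. measure M {x} \<noteq> 0}"
  have count: "countable A" unfolding A_def by (rule countable_support)
  have good: "measure M {a<..b} = (LBINT x:{a..b}. f x)" if "a \<le> b" "a \<notin> A" "b \<notin> A" for a b
    using measure_Ioc_char_integrable[OF int] that unfolding f_def A_def by simp
  have dense: "\<exists>y. a < y \<and> y < b \<and> y \<notin> A" if "a < b" for a b
    using open_minus_countable[OF count, of "{a<..<b}"] that by auto
  have atom: "measure M {x} \<le> e" if "0 < e" for x e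
  proof -
    \<comment> \<open>An interval of length below 2d has mass at most 2dK \<le> e; the summand 2
      avoids division by zero when K = 0.\<close>
    define d where "d = e / (2 * K + 2)"
    have d: "0 < d" using that K0 by (simp add: d_def)
    obtain a b where a: "x - d < a" "a < x" "a \<notin> A" and b: "x < b" "b < x + d" "b \<notin> A"
      using dense[of "x - d" x] dense[of x "x + d"] d by auto
    have "measure M {x} \<le> measure M {a<..b}" using a b by (intro finite_measure_mono) auto
    also have "\<dots> = (LBINT x:{a..b}. f x)" using a b by (intro good) auto
    also have "\<dots> \<le> (LBINT x:{a..b}. K)" by (intro set_integral_mono intf fK borel_integrable_compact[OF compact_Icc continuous_on_const, folded set_integrable_def])
    also have "\<dots> = (b - a) * K" using a b by (simp add: set_lebesgue_integral_def)
    also have "\<dots> \<le> (2 * d) * K" using a b K0 by (intro mult_right_mono) auto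
    also have "\<dots> \<le> e" using K0 that by (simp add: d_def field_simps)
    finally show ?thesis .
  qed
  have "measure M {x} = 0" for x
    using field_le_epsilon[of "measure M {x}" 0] atom by (simp add: measure_le_0_iff)
  then have all: "measure M {a<..b} = (LBINT x:{a..b}. f x)" if "a \<le> b" for a b
    using good[OF that] by (simp add: A_def)
  show nn: "0 \<le> f x" for x
  proof (rule ccontr)
    assume "\<not> 0 \<le> f x"
    then have neg: "f x < 0" by simp
    from cont[of x] neg obtain d where d: "0 < d" "\<And>y. \<bar>y - x\<bar> < d \<Longrightarrow> \<bar>f y - f x\<bar> < - f x / 2"
      unfolding continuous_at_eps_delta dist_real_def by (metis half_gt_zero neg_0_less_iff_less)
    have le: "f y \<le> f x / 2" if "y \<in> {x..x + d/2}" for y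
      using d(2)[of y] that d(1) by auto
    have "0 \<le> (LBINT x:{x..x+d/2}. f x)" using all[of x "x + d/2"] d by (metis measure_nonneg le_add_same_cancel1 half_gt_zero less_imp_le)
    also have "\<dots> \<le> (LBINT y:{x..x + d/2}. f x / 2)"
      by (intro set_integral_mono intf le borel_integrable_compact[OF compact_Icc continuous_on_const, folded set_integrable_def]) auto
    also have "\<dots> = d / 2 * (f x / 2)" using d by (simp add: set_lebesgue_integral_def)
    also have "\<dots> < 0" using d neg by (simp add: mult_pos_neg)
    finally show False by simp
  qed
  show "M = density lborel f"
  proof (rule measure_eqI_generator_eq[where \<Omega>=UNIV and E="range (\<lambda>(a, b). {a<..b})" and A="\<lambda>n::nat. {- real n<..real n}"])
    show "Int_stable (range (\<lambda>(a, b). {a<..b::real}))"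
      by (auto simp: Int_stable_def)
    show "emeasure M X = emeasure (density lborel f) X" if X_range: "X \<in> range (\<lambda>(a, b). {a<..b})" for X
    proof -
      obtain a b where X: "X = {a<..b}" using X_range by auto
      show ?thesis
      proof (cases "a \<le> b")
        case True
        have "emeasure (density lborel f) X = (\<integral>\<^sup>+x. ennreal (indicator {a<..b} x * f x) \<partial>lborel)"
          unfolding X by (subst emeasure_density) (auto intro!: nn_integral_cong split: split_indicator)
        also have "\<dots> = (\<integral>\<^sup>+x. ennreal (indicator {a..b} x * f x) \<partial>lborel)"
          by (rule nn_integral_cong_AE, rule AE_mp[OF AE_lborel_singleton[of a]]) (auto split: split_indicator)
        also have "\<dots> = ennreal (LBINT x:{a..b}. f x)"
          using intf nn by (subst nn_integral_eq_integral) (auto simp: set_integrable_def set_lebesgue_integral_def)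
        finally show ?thesis using all[OF True] X by (simp add: emeasure_eq_measure)
      qed (simp add: X)
    qed
    show "sets M = sigma_sets UNIV (range (\<lambda>(a, b). {a<..b}))"
      by (simp add: borel_sigma_sets_Ioc)
    show "sets (density lborel f) = sigma_sets UNIV (range (\<lambda>(a, b). {a<..b}))"
      by (simp add: borel_sigma_sets_Ioc)
    show "(\<Union>n::nat. {- real n<..real n}) = UNIV"
    proof -
      have "\<exists>n::nat. - real n < x \<and> x \<le> real n" for x
        using reals_Archimedean2[of "\<bar>x\<bar>"] by (auto intro: less_imp_le simp: abs_less_iff) (metis abs_less_iff less_imp_le minus_less_iff)
      then show ?thesis by auto
    qed
  qed auto
qed

section \<open>The oscillatory integral\<close>

text \<open>With \<open>\<phi>\<close> the phase and \<open>\<phi>'\<close> increasing, the integrand lies between the derivatives of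
  \<open>(sin \<phi> + 1) / \<phi>'\<close> and \<open>(sin \<phi> - 1) / \<phi>'\<close>.\<close>

lemma van_der_Corput_power:
  fixes \<alpha> s a b x :: real
  assumes \<alpha>: "1 < \<alpha>" and s: "0 < s" and a: "0 < a" "a \<le> b"
    and x: "2 * \<bar>x\<bar> \<le> s * \<alpha> * a powr (\<alpha> - 1)"
  shows "\<bar>integral {a..b} (\<lambda>\<gamma>. cos (s * \<gamma> powr \<alpha> - x * \<gamma>))\<bar> \<le> 4 / (s * \<alpha> * a powr (\<alpha> - 1))"
proof -
  define ph where "ph \<gamma> = s * \<gamma> powr \<alpha> - x * \<gamma>" for \<gamma>
  define d where "d \<gamma> = s * \<alpha> * \<gamma> powr (\<alpha> - 1) - x" for \<gamma>
  define d' where "d' \<gamma> = s * \<alpha> * (\<alpha> - 1) * \<gamma> powr (\<alpha> - 2)" for \<gamma>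
  \<comment> \<open>The hypothesis on x leaves at least half of the leading term of the phase
    derivative from a on.\<close>
  have d_ge: "s * \<alpha> * a powr (\<alpha> - 1) / 2 \<le> d \<gamma>" if "a \<le> \<gamma>" for \<gamma>
  proof -
    have "s * \<alpha> * a powr (\<alpha> - 1) \<le> s * \<alpha> * \<gamma> powr (\<alpha> - 1)"
      using s \<alpha> a that by (intro mult_left_mono powr_mono2) auto
    then show ?thesis using x by (simp add: d_def)
  qed
  have pos0: "0 < s * \<alpha> * a powr (\<alpha> - 1) / 2" using s \<alpha> a by simp
  have dpos: "0 < d \<gamma>" if "a \<le> \<gamma>" for \<gamma> using d_ge[OF that] pos0 by linarith
  have d': "0 \<le> d' \<gamma>" for \<gamma> using s \<alpha> by (simp add: d'_def)
  have ph_deriv: "(ph has_real_derivative d \<gamma>) (at \<gamma>)" if "a \<le> \<gamma>" for \<gamma>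
    unfolding ph_def d_def using that a
    by (auto intro!: DERIV_cong[OF DERIV_diff[OF DERIV_cmult[OF has_real_derivative_powr] DERIV_cmult[OF DERIV_ident]]])
  have d_deriv: "(d has_real_derivative d' \<gamma>) (at \<gamma>)" if "a \<le> \<gamma>" for \<gamma>
    unfolding d_def d'_def using that a
    by (auto intro!: DERIV_cong[OF DERIV_diff[OF DERIV_cmult[OF has_real_derivative_powr] DERIV_const]])
  \<comment> \<open>\<open>c\<close> will be -1 for the upper bound and 1 for the lower one.\<close>
  have U_deriv: "((\<lambda>\<gamma>. (sin (ph \<gamma>) + c) / d \<gamma>) has_vector_derivative
      (cos (ph \<gamma>) - (sin (ph \<gamma>) + c) * (d' \<gamma> / (d \<gamma>)^2))) (at \<gamma> within {a..b})" if "\<gamma> \<in> {a..b}" for c \<gamma>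
  proof -
    have \<gamma>: "a \<le> \<gamma>" and nz: "d \<gamma> \<noteq> 0" using that dpos[of \<gamma>] by auto
    have "((\<lambda>\<gamma>. (sin (ph \<gamma>) + c) / d \<gamma>) has_real_derivative
        ((cos (ph \<gamma>) * d \<gamma> + 0) * d \<gamma> - (sin (ph \<gamma>) + c) * d' \<gamma>) / (d \<gamma> * d \<gamma>)) (at \<gamma>)"
      by (intro DERIV_divide DERIV_add DERIV_const DERIV_fun_sin ph_deriv[OF \<gamma>] d_deriv[OF \<gamma>] nz)
    moreover have "((cos (ph \<gamma>) * d \<gamma> + 0) * d \<gamma> - (sin (ph \<gamma>) + c) * d' \<gamma>) / (d \<gamma> * d \<gamma>)
        = cos (ph \<gamma>) - (sin (ph \<gamma>) + c) * (d' \<gamma> / (d \<gamma>)^2)"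
      using nz by (simp add: diff_divide_distrib power2_eq_square)
    ultimately show ?thesis
      unfolding has_real_derivative_iff_has_vector_derivative[symmetric]
      by (metis has_field_derivative_at_within)
  qed
  have U_int: "((\<lambda>\<gamma>. cos (ph \<gamma>) - (sin (ph \<gamma>) + c) * (d' \<gamma> / (d \<gamma>)^2)) has_integral
      ((sin (ph b) + c) / d b - (sin (ph a) + c) / d a)) {a..b}" for c
    by (rule fundamental_theorem_of_calculus[OF a(2) U_deriv])
  have cont: "continuous_on {a..b} (\<lambda>\<gamma>. cos (ph \<gamma>))"
    unfolding ph_def using a by (intro continuous_intros) auto
  then have C_int: "((\<lambda>\<gamma>. cos (ph \<gamma>)) has_integral (integral {a..b} (\<lambda>\<gamma>. cos (ph \<gamma>)))) {a..b}"
    by (intro integrable_integral integrable_continuous_real)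
  have e: "2 / d a \<le> 4 / (s * \<alpha> * a powr (\<alpha> - 1))"
    using divide_left_mono[OF d_ge[of a], of 2] pos0 dpos[of a] by simp
  have q: "0 \<le> d' \<gamma> / (d \<gamma>)^2" for \<gamma> using d' by simp
  have "integral {a..b} (\<lambda>\<gamma>. cos (ph \<gamma>)) \<le> (sin (ph b) + (-1)) / d b - (sin (ph a) + (-1)) / d a"
  proof (rule has_integral_le[OF C_int U_int])
    fix \<gamma>
    have "(sin (ph \<gamma>) + (-1)) * (d' \<gamma> / (d \<gamma>)^2) \<le> 0"
      by (rule mult_nonpos_nonneg) (use q in auto)
    then show "cos (ph \<gamma>) \<le> cos (ph \<gamma>) - (sin (ph \<gamma>) + (-1)) * (d' \<gamma> / (d \<gamma>)^2)" by simp
  qed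
  also have "\<dots> \<le> 0 - (- 2 / d a)"
  proof (rule diff_mono)
    show "(sin (ph b) + (-1)) / d b \<le> 0"
      using dpos[of b] a by (simp add: divide_le_0_iff)
    have "- 2 \<le> sin (ph a) + (-1)" using sin_ge_minus_one[of "ph a"] by linarith
    then show "- 2 / d a \<le> (sin (ph a) + (-1)) / d a"
      using dpos[of a] by (intro divide_right_mono) auto
  qed
  finally have upper: "integral {a..b} (\<lambda>\<gamma>. cos (ph \<gamma>)) \<le> 2 / d a" by simp
  have "0 - 2 / d a \<le> (sin (ph b) + 1) / d b - (sin (ph a) + 1) / d a"
  proof (rule diff_mono)
    have "0 \<le> sin (ph b) + 1" using sin_ge_minus_one[of "ph b"] by linarith
    then show "0 \<le> (sin (ph b) + 1) / d b"
      using dpos[of b] a by (intro divide_nonneg_nonneg) auto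
    show "(sin (ph a) + 1) / d a \<le> 2 / d a"
      using dpos[of a] by (intro divide_right_mono) auto
  qed
  also have "\<dots> \<le> integral {a..b} (\<lambda>\<gamma>. cos (ph \<gamma>))"
  proof (rule has_integral_le[OF U_int C_int])
    fix \<gamma>
    have "0 \<le> sin (ph \<gamma>) + 1" using sin_ge_minus_one[of "ph \<gamma>"] by linarith
    then have "0 \<le> (sin (ph \<gamma>) + 1) * (d' \<gamma> / (d \<gamma>)^2)" using q by (rule mult_nonneg_nonneg)
    then show "cos (ph \<gamma>) - (sin (ph \<gamma>) + 1) * (d' \<gamma> / (d \<gamma>)^2) \<le> cos (ph \<gamma>)" by simp
  qed
  finally have "\<bar>integral {a..b} (\<lambda>\<gamma>. cos (ph \<gamma>))\<bar> \<le> 2 / d a" using upper by linarith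
  then show ?thesis using e unfolding ph_def by linarith
qed

section \<open>Uniform bounds and convergence of the Airy-type integral\<close>

lemma continuous_on_cos_power_phase:
  fixes \<alpha> s x :: real
  assumes "0 < \<alpha>"
  shows "continuous_on {0..} (\<lambda>\<gamma>. cos (s * \<gamma> powr \<alpha> - x * \<gamma>))"
  using assms by (intro continuous_intros continuous_on_powr') auto

lemma power_phase_integrable:
  fixes \<alpha> s x :: real
  assumes "0 < \<alpha>" "0 \<le> a"
  shows "(\<lambda>\<gamma>. cos (s * \<gamma> powr \<alpha> - x * \<gamma>)) integrable_on {a..b}"
  using assms
  by (intro integrable_continuous_real continuous_on_subset[OF continuous_on_cos_power_phase]) auto

text \<open>The range is split at a1 + a2, and the part below is bounded by its length. Beyond a1,
  where s \<alpha> a1^(\<alpha>-1) = 2|x|, the linear term takes at most half of the phase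
  derivative; beyond a2, the scale at which s \<gamma>^\<alpha> = 1, the van der Corput bound is at
  most 4 a2. The total a1 + 5 a2 does not involve R.\<close>

lemma power_phase_bound:
  fixes \<alpha> s x R :: real
  assumes \<alpha>: "1 < \<alpha>" and s: "0 < s" and R: "0 \<le> R"
  shows "\<bar>integral {0..R} (\<lambda>\<gamma>. cos (s * \<gamma> powr \<alpha> - x * \<gamma>))\<bar>
    \<le> (2 * \<bar>x\<bar> / \<alpha>) powr (1 / (\<alpha> - 1)) * s powr (- (1 / (\<alpha> - 1))) + 5 * s powr (- (1 / \<alpha>))"
proof -
  let ?f = "\<lambda>\<gamma>. cos (s * \<gamma> powr \<alpha> - x * \<gamma>)"
  define a1 where "a1 = (2 * \<bar>x\<bar> / \<alpha>) powr (1 / (\<alpha> - 1)) * s powr (- (1 / (\<alpha> - 1)))"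
  define a2 where "a2 = s powr (- (1 / \<alpha>))"
  have a1: "0 \<le> a1" by (simp add: a1_def)
  have a2: "0 < a2" using s by (simp add: a2_def)
  have trivial: "\<bar>integral {0..r} ?f\<bar> \<le> r" if "0 \<le> r" for r
    using integral_bound[OF that continuous_on_subset[OF continuous_on_cos_power_phase], of \<alpha> s x 1] \<alpha> by simp
  show ?thesis
  proof (cases "R \<le> a1 + a2")
    case True
    then show ?thesis using trivial[OF R] a2 unfolding a1_def a2_def by linarith
  next
    case False
    let ?a = "a1 + a2"
    have a: "0 < ?a" "?a \<le> R" using a1 a2 False by auto
    have "s * \<alpha> * a1 powr (\<alpha> - 1) = 2 * \<bar>x\<bar>"
    proof -
      have "a1 powr (\<alpha> - 1) = (2 * \<bar>x\<bar> / \<alpha>) powr (1 / (\<alpha> - 1) * (\<alpha> - 1)) * s powr (- (1 / (\<alpha> - 1)) * (\<alpha> - 1))"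
        unfolding a1_def powr_powr[symmetric] by (rule powr_mult)
      also have "\<dots> = 2 * \<bar>x\<bar> / \<alpha> * s powr (- 1)"
        using \<alpha> by simp
      finally show ?thesis using s \<alpha> by (simp add: powr_minus)
    qed
    moreover have "a1 powr (\<alpha> - 1) \<le> ?a powr (\<alpha> - 1)" using a1 a2 \<alpha> by (intro powr_mono2) auto
    ultimately have x: "2 * \<bar>x\<bar> \<le> s * \<alpha> * ?a powr (\<alpha> - 1)"
      using mult_left_mono[of "a1 powr (\<alpha> - 1)" "?a powr (\<alpha> - 1)" "s * \<alpha>"] s \<alpha> by simp
    have "1 + - (1 / \<alpha>) * (\<alpha> - 1) = 1 / \<alpha>" using \<alpha> by (simp add: field_simps)
    then have "s powr 1 * s powr (- (1 / \<alpha>) * (\<alpha> - 1)) = s powr (1 / \<alpha>)"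
      by (simp only: powr_add[symmetric])
    then have "s * a2 powr (\<alpha> - 1) = s powr (1 / \<alpha>)"
      using s by (simp add: a2_def powr_powr)
    moreover have "s * a2 powr (\<alpha> - 1) \<le> s * ?a powr (\<alpha> - 1)"
      using a1 a2 \<alpha> s by (intro mult_left_mono powr_mono2) auto
    ultimately have "s powr (1 / \<alpha>) \<le> s * ?a powr (\<alpha> - 1)" by simp
    also have "\<dots> \<le> \<alpha> * (s * ?a powr (\<alpha> - 1))"
      using mult_right_mono[of 1 \<alpha> "s * ?a powr (\<alpha> - 1)"] \<alpha> s by simp
    finally have "4 / (s * \<alpha> * ?a powr (\<alpha> - 1)) \<le> 4 / s powr (1 / \<alpha>)"
      using s a1 a2 \<alpha> by (intro divide_left_mono) (auto simp: ac_simps)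
    also have "\<dots> = 4 * a2" by (simp add: a2_def powr_minus divide_inverse)
    finally have "\<bar>integral {?a..R} ?f\<bar> \<le> 4 * a2"
      using van_der_Corput_power[OF \<alpha> s a x] by linarith
    moreover have "integral {0..R} ?f = integral {0..?a} ?f + integral {?a..R} ?f"
      using a \<alpha> by (intro Henstock_Kurzweil_Integration.integral_combine[symmetric] power_phase_integrable) auto
    moreover have "\<bar>integral {0..?a} ?f\<bar> \<le> ?a" using a by (intro trivial) auto
    ultimately show ?thesis unfolding a1_def a2_def by linarith
  qed
qed

text \<open>The van der Corput bound tends to 0 as the left endpoint grows, whatever the right
  endpoint, which is Cauchy's criterion. Without convergence the \<open>Lim\<close> in the Airy
  function would be an unspecified value.\<close>

lemma power_phase_convergent:
  fixes \<alpha> s x :: real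
  assumes \<alpha>: "1 < \<alpha>" and s: "0 < s"
  shows "\<exists>l. ((\<lambda>R. integral {0..R} (\<lambda>\<gamma>. cos (s * \<gamma> powr \<alpha> - x * \<gamma>))) \<longlongrightarrow> l) at_top"
proof -
  let ?f = "\<lambda>\<gamma>. cos (s * \<gamma> powr \<alpha> - x * \<gamma>)"
  let ?I = "\<lambda>R. integral {0..R} ?f"
  have pw: "filterlim (\<lambda>a. s * \<alpha> * a powr (\<alpha> - 1)) at_top at_top"
    using s \<alpha> by real_asymp
  have "\<exists>N>0. \<forall>a b. N \<le> a \<longrightarrow> a \<le> b \<longrightarrow> \<bar>?I b - ?I a\<bar> < e" if e: "0 < e" for e
  proof -
    have "\<forall>\<^sub>F a in at_top. max (2 * \<bar>x\<bar>) (4 / e + 1) \<le> s * \<alpha> * a powr (\<alpha> - 1) \<and> 0 < a"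
      using pw unfolding filterlim_at_top by (intro eventually_conj eventually_gt_at_top) blast
    then obtain N where N: "\<And>a. N \<le> a \<Longrightarrow> max (2 * \<bar>x\<bar>) (4 / e + 1) \<le> s * \<alpha> * a powr (\<alpha> - 1) \<and> 0 < a"
      unfolding eventually_at_top_linorder by auto
    have "\<bar>?I b - ?I a\<bar> < e" if "N \<le> a" "a \<le> b" for a b
    proof -
      have a: "0 < a" and big: "4 / e < s * \<alpha> * a powr (\<alpha> - 1)" and x: "2 * \<bar>x\<bar> \<le> s * \<alpha> * a powr (\<alpha> - 1)"
        using N[OF that(1)] by auto
      have "?I b = ?I a + integral {a..b} ?f"
        using a that \<alpha> by (intro Henstock_Kurzweil_Integration.integral_combine[symmetric] power_phase_integrable) auto
      moreover have "\<bar>integral {a..b} ?f\<bar> \<le> 4 / (s * \<alpha> * a powr (\<alpha> - 1))"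
        by (rule van_der_Corput_power[OF \<alpha> s a that(2) x])
      moreover have "4 / (s * \<alpha> * a powr (\<alpha> - 1)) < e"
        using big e a s \<alpha> by (simp add: field_simps)
      ultimately show ?thesis by linarith
    qed
    then show ?thesis using N[of N] by (intro exI[of _ N]) auto
  qed
  note cauchy = this
  have "Cauchy (\<lambda>n. ?I (real n))"
  proof (rule metric_CauchyI)
    fix e :: real assume "0 < e"
    then obtain N where N: "\<And>a b. N \<le> a \<Longrightarrow> a \<le> b \<Longrightarrow> \<bar>?I b - ?I a\<bar> < e" using cauchy by blast
    obtain M :: nat where M: "N \<le> M" using real_arch_simple by blast
    have "dist (?I (real m)) (?I (real n)) < e" if "M \<le> m" "M \<le> n" for m n
      using N[of "real m" "real n"] N[of "real n" "real m"] that M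
      by (cases "m \<le> n") (auto simp: dist_real_def abs_minus_commute)
    then show "\<exists>M. \<forall>m\<ge>M. \<forall>n\<ge>M. dist (?I (real m)) (?I (real n)) < e" by blast
  qed
  then obtain l where l: "(\<lambda>n. ?I (real n)) \<longlonglongrightarrow> l"
    using Cauchy_convergent convergent_def by blast
  have "(?I \<longlongrightarrow> l) at_top"
    unfolding tendsto_iff
  proof (intro allI impI)
    fix e :: real assume e: "0 < e"
    then obtain N where N: "\<And>a b. N \<le> a \<Longrightarrow> a \<le> b \<Longrightarrow> \<bar>?I b - ?I a\<bar> < e / 2"
      using cauchy[of "e / 2"] by auto
    obtain M where M: "\<And>n. M \<le> n \<Longrightarrow> dist (?I (real n)) l < e / 2"
      using l e unfolding lim_sequentially by (meson half_gt_zero)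
    have "dist (?I R) l < e" if R: "N \<le> R" for R
    proof -
      obtain n :: nat where n: "max R M \<le> n" using real_arch_simple by blast
      then have "\<bar>?I n - ?I R\<bar> < e / 2" "dist (?I (real n)) l < e / 2" using N[OF R] M by auto
      then show ?thesis unfolding dist_real_def by linarith
    qed
    then show "\<forall>\<^sub>F R in at_top. dist (?I R) l < e" unfolding eventually_at_top_linorder by blast
  qed
  then show ?thesis by blast
qed

section \<open>Laplace transform and negative moments of the subordinator\<close>

text \<open>Extended by 0 to the left half-plane, f stays continuous because it vanishes on the
  imaginary axis, so pasting across that line makes it entire; the identity theorem does the
  rest.\<close>

lemma right_half_plane_uniqueness:
  fixes f :: "complex \<Rightarrow> complex"
  assumes hol: "f holomorphic_on {z. 0 < Re z}" and cont: "continuous_on {z. 0 \<le> Re z} f"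
    and zero: "\<And>z. Re z = 0 \<Longrightarrow> f z = 0" and z: "0 \<le> Re z"
  shows "f z = 0"
proof -
  define F where "F z = (if Re z \<ge> 0 then f z else 0)" for z
  have contF: "continuous_on ({z. 0 \<le> Re z} \<union> {z. Re z \<le> 0}) F"
    unfolding F_def
  proof (rule continuous_on_cases)
    show "closed {z. 0 \<le> Re z}" "closed {z. Re z \<le> 0}"
      by (rule closed_halfspace_Re_ge, rule closed_halfspace_Re_le)
    show "\<forall>x. x \<in> {z. 0 \<le> Re z} \<and> \<not> 0 \<le> Re x \<or> x \<in> {z. Re z \<le> 0} \<and> 0 \<le> Re x \<longrightarrow> f x = 0"
      by (auto intro: zero)
  qed (auto intro: cont)
  have UN: "{z. 0 \<le> Re z} \<union> {z. Re z \<le> 0} = UNIV" by auto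
  have "F holomorphic_on UNIV"
  proof (rule holomorphic_on_paste_across_line[of UNIV 1 F 0])
    have "(\<lambda>_. 0) holomorphic_on UNIV \<inter> {z. 1 \<bullet> z < 0}" by (rule holomorphic_on_const)
    then show "F holomorphic_on UNIV \<inter> {z. 1 \<bullet> z < 0}"
      by (rule holomorphic_transform) (auto simp: F_def inner_complex_def)
    have "f holomorphic_on UNIV \<inter> {z. 0 < 1 \<bullet> z}" using hol by (simp add: inner_complex_def)
    then show "F holomorphic_on UNIV \<inter> {z. 0 < 1 \<bullet> z}"
      by (rule holomorphic_transform) (auto simp: F_def inner_complex_def)
    show "continuous_on UNIV F" using contF unfolding UN .
  qed auto
  moreover have "(\<lambda>_. 0) holomorphic_on (UNIV :: complex set)" by (rule holomorphic_on_const)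
  ultimately have "F z = (\<lambda>_. 0) z"
    by (intro analytic_continuation_open[of "{z. Re z < 0}" UNIV F "\<lambda>_. 0" z])
       (auto simp: F_def open_halfspace_Re_lt intro!: exI[of _ "-1"])
  then show ?thesis using z by (simp add: F_def)
qed

text \<open>With r = Re z, the ball of radius r/2 around z stays in Re w > r/2, where x exp(-r x /
  2) \<le> 2/r bounds the difference quotients. Differentiation under the integral thus needs no
  moments of M.\<close>

lemma laplace_transform_holomorphic:
  assumes M: "real_distribution M" and pos: "AE x in M. 0 \<le> x"
  shows "(\<lambda>z. CLINT x|M. exp (- (z * of_real x))) holomorphic_on {z. 0 < Re z}"
    and "continuous_on {z. 0 \<le> Re z} (\<lambda>z. CLINT x|M. exp (- (z * of_real x)))"
proof -
  interpret real_distribution M by fact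
  define g where "g z = (CLINT x|M. exp (- (z * of_real x)))" for z
  have bd: "AE x in M. norm (exp (- (z * of_real x))) \<le> 1" if "0 \<le> Re z" for z
    using pos by eventually_elim (use that in simp)
  have int: "integrable M (\<lambda>x. exp (- (z * of_real x)))" if "0 \<le> Re z" for z
    by (rule integrable_const_bound[where B=1]) (use bd[OF that] in auto)
  have "continuous_on {z. 0 \<le> Re z} g"
    unfolding continuous_on_sequentially comp_def
  proof safe
    fix X :: "nat \<Rightarrow> complex" and z
    assume X: "\<forall>n. X n \<in> {z. 0 \<le> Re z}" "X \<longlonglongrightarrow> z" "0 \<le> Re z"
    show "(\<lambda>n. g (X n)) \<longlonglongrightarrow> g z"
      unfolding g_def
    proof (rule integral_dominated_convergence[where w="\<lambda>_. 1"])
      show "AE x in M. (\<lambda>n. exp (- (X n * of_real x))) \<longlonglongrightarrow> exp (- (z * of_real x))"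
        by (intro AE_I2 tendsto_intros X)
      show "AE x in M. norm (exp (- (X n * of_real x))) \<le> 1" for n using X by (intro bd) auto
    qed auto
  qed
  then show "continuous_on {z. 0 \<le> Re z} (\<lambda>z. CLINT x|M. exp (- (z * of_real x)))"
    by (simp add: g_def[abs_def])
  have "g field_differentiable (at z)" if z: "0 < Re z" for z
  proof -
    define r where "r = Re z"
    have r: "0 < r" using z by (simp add: r_def)
    let ?B = "ball z (r / 2)"
    have ReB: "r / 2 < Re w" if "w \<in> ?B" for w
    proof -
      have "\<bar>Re (z - w)\<bar> < r / 2" using that abs_Re_le_cmod[of "z - w"] by (simp add: dist_norm)
      then have "\<bar>Re z - Re w\<bar> < r / 2" by simp
      then show ?thesis unfolding r_def by linarith
    qed
    have quot: "norm ((exp (- (w * of_real x)) - exp (- (z * of_real x))) / (w - z)) \<le> 2 / r"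
      if w: "w \<in> ?B" "w \<noteq> z" and x: "0 \<le> x" for w and x :: real
    proof -
      have "norm (exp (- (w * of_real x)) - exp (- (z * of_real x))) \<le> 2 / r * norm (w - z)"
      proof (rule field_differentiable_bound[where S="?B"])
        show "((\<lambda>w. exp (- (w * of_real x))) has_field_derivative - of_real x * exp (- (u * of_real x))) (at u within ?B)" for u
          by (auto intro!: derivative_eq_intros)
        show "norm (- of_real x * exp (- (u * of_real x))) \<le> 2 / r" if "u \<in> ?B" for u
        proof -
          have "norm (- of_real x * exp (- (u * of_real x))) = x * exp (- (Re u * x))"
            using x by (simp add: norm_mult)
          also have "\<dots> \<le> x * exp (- (r / 2 * x))"
            using mult_right_mono[of "r / 2" "Re u" x] ReB[OF that] x by (intro mult_left_mono) auto
          also have "\<dots> \<le> 2 / r"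
          proof -
            have "r / 2 * x \<le> exp (r / 2 * x)" using exp_ge_add_one_self[of "r / 2 * x"] by linarith
            then show ?thesis using r by (simp add: exp_minus field_simps)
          qed
          finally show ?thesis .
        qed
      qed (use w r in auto)
      then show ?thesis using w by (simp add: norm_divide divide_le_eq)
    qed
    have "((\<lambda>w. (g w - g z) / (w - z)) \<longlongrightarrow> (CLINT x|M. - of_real x * exp (- (z * of_real x)))) (at z within ?B)"
      unfolding tendsto_at_iff_sequentially comp_def
    proof (intro allI impI)
      fix X assume X: "\<forall>i. X i \<in> ?B - {z}" "X \<longlonglongrightarrow> z"
      have eq: "(g (X i) - g z) / (X i - z) = (CLINT x|M. (exp (- (X i * of_real x)) - exp (- (z * of_real x))) / (X i - z))" for i
      proof -
        have "0 \<le> Re (X i)" using ReB[of "X i"] X r by auto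
        then show ?thesis unfolding g_def using z
          by (simp add: Bochner_Integration.integral_diff[OF int int])
      qed
      show "(\<lambda>i. (g (X i) - g z) / (X i - z)) \<longlonglongrightarrow> (CLINT x|M. - of_real x * exp (- (z * of_real x)))"
        unfolding eq
      proof (rule integral_dominated_convergence[where w="\<lambda>_. 2 / r"])
        show "AE x in M. (\<lambda>i. (exp (- (X i * of_real x)) - exp (- (z * of_real x))) / (X i - z)) \<longlonglongrightarrow> - of_real x * exp (- (z * of_real x))"
        proof (rule AE_I2)
          fix x :: real
          have "((\<lambda>w. exp (- (w * of_real x))) has_field_derivative - of_real x * exp (- (z * of_real x))) (at z within ?B)"
            by (auto intro!: derivative_eq_intros)
          then show "(\<lambda>i. (exp (- (X i * of_real x)) - exp (- (z * of_real x))) / (X i - z)) \<longlonglongrightarrow> - of_real x * exp (- (z * of_real x))"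
            using X unfolding has_field_derivative_iff tendsto_at_iff_sequentially comp_def by blast
        qed
        show "AE x in M. norm ((exp (- (X i * of_real x)) - exp (- (z * of_real x))) / (X i - z)) \<le> 2 / r" for i
          using pos by eventually_elim (use X in \<open>auto intro!: quot\<close>)
      qed auto
    qed
    then have "(g has_field_derivative (CLINT x|M. - of_real x * exp (- (z * of_real x)))) (at z within ?B)"
      by (simp add: has_field_derivative_iff)
    then show ?thesis
      using r by (auto simp: field_differentiable_def at_within_open[of z ?B])
  qed
  then have "g holomorphic_on {z. 0 < Re z}"
    by (auto simp: holomorphic_on_def intro: field_differentiable_at_within)
  then show "(\<lambda>z. CLINT x|M. exp (- (z * of_real x))) holomorphic_on {z. 0 < Re z}"
    by (simp add: g_def[abs_def])
qed

text \<open>The principal logarithm of -i\<gamma> is ln |\<gamma>| - i (pi/2) sgn \<gamma>. Hence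
  the phase in the subordinator's characteristic function is the boundary value of z^\<theta> at z =
  -i\<gamma>, the point where exp(-z x) = exp(i\<gamma> x).\<close>

lemma powr_minus_ii_mult:
  fixes \<gamma> \<theta> :: real
  assumes \<theta>: "0 < \<theta>"
  shows "(- \<i> * of_real \<gamma>) powr of_real \<theta> = of_real (\<bar>\<gamma>\<bar> powr \<theta>) * exp (- \<i> * of_real (pi * \<theta> / 2 * sgn \<gamma>))"
proof (cases "\<gamma> = 0")
  case False
  have "Ln (- \<i> * of_real \<gamma>) = of_real (ln \<bar>\<gamma>\<bar>) - \<i> * of_real (pi / 2 * sgn \<gamma>)"
  proof (rule Ln_unique)
    have "exp (- (\<i> * of_real (pi / 2 * sgn \<gamma>))) = - \<i> * of_real (sgn \<gamma>)"
      using False by (cases "0 < \<gamma>") (auto simp: complex_eq_iff Re_exp Im_exp)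
    then have "exp (of_real (ln \<bar>\<gamma>\<bar>) + - (\<i> * of_real (pi / 2 * sgn \<gamma>))) = of_real \<bar>\<gamma>\<bar> * (- \<i> * of_real (sgn \<gamma>))"
      unfolding exp_add exp_of_real using False by simp
    also have "\<dots> = - \<i> * of_real (\<bar>\<gamma>\<bar> * sgn \<gamma>)" by simp
    also have "\<bar>\<gamma>\<bar> * sgn \<gamma> = \<gamma>" by (rule abs_mult_sgn)
    finally show "exp (of_real (ln \<bar>\<gamma>\<bar>) - \<i> * of_real (pi / 2 * sgn \<gamma>)) = - \<i> * of_real \<gamma>"
      by (simp only: diff_conv_add_uminus)
    show "- pi < Im (of_real (ln \<bar>\<gamma>\<bar>) - \<i> * of_real (pi / 2 * sgn \<gamma>))"
      "Im (of_real (ln \<bar>\<gamma>\<bar>) - \<i> * of_real (pi / 2 * sgn \<gamma>)) \<le> pi"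
      using False pi_gt_zero by (auto simp: sgn_if intro: order_trans[of _ 0])
  qed
  then have "(- \<i> * of_real \<gamma>) powr of_real \<theta> = exp (of_real \<theta> * (of_real (ln \<bar>\<gamma>\<bar>) - \<i> * of_real (pi / 2 * sgn \<gamma>)))"
    using False by (simp add: powr_def)
  also have "\<dots> = exp (of_real (\<theta> * ln \<bar>\<gamma>\<bar>)) * exp (- \<i> * of_real (pi * \<theta> / 2 * sgn \<gamma>))"
    unfolding exp_add[symmetric] by (rule arg_cong[where f=exp]) (simp add: algebra_simps)
  also have "exp (complex_of_real (\<theta> * ln \<bar>\<gamma>\<bar>)) = of_real (\<bar>\<gamma>\<bar> powr \<theta>)"
    using False by (simp add: powr_def flip: exp_of_real)
  finally show ?thesis .
qed simp

lemma subordinator_laplace_transform: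
  assumes M: "real_distribution M" and pos: "AE x in M. 0 \<le> x" and \<theta>: "0 < \<theta>"
    and char: "\<And>\<gamma>. char M \<gamma> = exp (- complex_of_real (t * \<bar>\<gamma>\<bar> powr \<theta>) * exp (- \<i> * complex_of_real (pi * \<theta> / 2 * sgn \<gamma>)))"
    and \<kappa>: "0 \<le> \<kappa>"
  shows "(LINT x|M. exp (- (\<kappa> * x))) = exp (- (t * \<kappa> powr \<theta>))"
proof -
  define k where "k z = exp (- (of_real t * z powr of_real \<theta>))" for z :: complex
  let ?g = "\<lambda>z. CLINT x|M. exp (- (z * of_real x))"
  have "?g (of_real \<kappa>) - k (of_real \<kappa>) = 0"
  proof (rule right_half_plane_uniqueness[where f="\<lambda>z. ?g z - k z"])
    show "(\<lambda>z. ?g z - k z) holomorphic_on {z. 0 < Re z}"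
      unfolding k_def
      by (intro holomorphic_intros laplace_transform_holomorphic M pos) (auto simp: complex_nonpos_Reals_iff)
    \<comment> \<open>The closed half-plane meets the branch cut of \<open>powr\<close> only at 0,
      where \<theta> > 0 gives continuity.\<close>
    show "continuous_on {z. 0 \<le> Re z} (\<lambda>z. ?g z - k z)"
      unfolding k_def
      using \<theta> by (intro continuous_intros laplace_transform_holomorphic M pos) auto
    show "?g z - k z = 0" if "Re z = 0" for z
    proof -
      define \<gamma> where "\<gamma> = - Im z"
      have z: "z = - \<i> * of_real \<gamma>" using that by (simp add: complex_eq_iff \<gamma>_def)
      have "?g z = char M \<gamma>" by (simp add: char_def z mult.assoc)
      also have "\<dots> = k z" unfolding char k_def z powr_minus_ii_mult[OF \<theta>] by (simp add: mult.assoc)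
      finally show ?thesis by simp
    qed
  qed (use \<kappa> in auto)
  moreover have "?g (of_real \<kappa>) = of_real (LINT x|M. exp (- (\<kappa> * x)))"
    unfolding integral_complex_of_real[symmetric]
    by (intro Bochner_Integration.integral_cong refl) (simp flip: exp_of_real)
  moreover have "k (of_real \<kappa>) = of_real (exp (- (t * \<kappa> powr \<theta>)))"
    unfolding k_def using \<kappa> by (simp add: powr_of_real flip: exp_of_real)
  ultimately show ?thesis by (simp only: right_minus_eq of_real_eq_iff)
qed

text \<open>Serves the negative moments with q = \<theta> and, with a = 1 and q = \<nu>, the
  integrability of the stable characteristic function.\<close>

lemma powr_exp_powr_integrable:
  fixes a c q :: real
  assumes a: "0 < a" and c: "0 < c" and q: "0 < q"
  shows "set_integrable lborel {0<..} (\<lambda>x. x powr (a - 1) * exp (- (c * x powr q)))"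
proof -
  \<comment> \<open>Chosen so that y^k is a multiple of x^(a+1) for y = c x^q: then exp(-y) \<le> (k
    / y)^k decays like x^(-(a+1)), and x^(-2) is left after the factor x^(a-1).\<close>
  define k where "k = (a + 1) / q"
  have k: "0 < k" using a q by (simp add: k_def)
  define C where "C = (k / c) powr k"
  have decay: "exp (- (c * x powr q)) \<le> C * x powr (- (a + 1))" if x: "0 < x" for x
  proof -
    define y where "y = c * x powr q"
    have y: "0 < y" using c x by (simp add: y_def)
    have "y / k \<le> exp (y / k)" using exp_ge_add_one_self[of "y / k"] by linarith
    then have "(y / k) powr k \<le> exp (y / k) powr k" using y k by (intro powr_mono2) auto
    also have "\<dots> = exp y" using k by (simp add: exp_powr_real)
    finally have "exp (- y) \<le> 1 / (y / k) powr k"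
      using y k by (simp add: exp_minus field_simps)
    also have "\<dots> = (k / y) powr k" using y k by (simp add: powr_divide)
    also have "k / y = (k / c) * x powr (- q)" using c x by (simp add: y_def powr_minus field_simps)
    also have "\<dots> powr k = C * x powr (- q * k)" unfolding C_def powr_powr[symmetric] by (rule powr_mult)
    also have "- q * k = - (a + 1)" using q by (simp add: k_def)
    finally show ?thesis by (simp add: y_def)
  qed
  have i1: "set_integrable lborel {0<..<1} (\<lambda>x. x powr (a - 1))" using powr_set_integral_Ioo[OF a, of 1] by simp
  have "((\<lambda>x. x powr (- 2)) has_integral - (1 powr (- 2 + 1)) / (- 2 + 1)) {1::real..}"
    by (rule has_integral_powr_to_inf) auto
  from has_integral_nonneg_imp_set_integrable(1)[OF _ _ _ this]
  have i2: "set_integrable lborel {1..} (\<lambda>x::real. x powr (- 2))" by auto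
  have i2': "set_integrable lborel {1..} (\<lambda>x::real. C * x powr (- 2))"
    by (rule set_integrable_mult_right[OF i2])
  show ?thesis
    unfolding set_integrable_def
  proof (rule Bochner_Integration.integrable_bound[OF Bochner_Integration.integrable_add[OF i1[unfolded set_integrable_def] i2'[unfolded set_integrable_def]]])
    show "AE x in lborel. norm (indicator {0<..} x *\<^sub>R (x powr (a - 1) * exp (- (c * x powr q))))
        \<le> norm (indicator {0<..<1} x *\<^sub>R x powr (a - 1) + indicator {1..} x *\<^sub>R (C * x powr (- 2)))"
    proof (rule AE_I2)
      fix x :: real
      consider "x \<le> 0" | "0 < x" "x < 1" | "1 \<le> x" by linarith
      then show "norm (indicator {0<..} x *\<^sub>R (x powr (a - 1) * exp (- (c * x powr q))))
        \<le> norm (indicator {0<..<1} x *\<^sub>R x powr (a - 1) + indicator {1..} x *\<^sub>R (C * x powr (- 2)))"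
      proof cases
        case 2
        then have "exp (- (c * x powr q)) \<le> 1" using c by simp
        then show ?thesis using 2 by (simp add: abs_mult mult_left_le)
      next
        case 3
        have "x powr (a - 1) * exp (- (c * x powr q)) \<le> x powr (a - 1) * (C * x powr (- (a + 1)))"
          using decay[of x] 3 by (intro mult_left_mono) auto
        also have "\<dots> = C * (x powr (a - 1) * x powr (- (a + 1)))" by simp
        also have "\<dots> = C * x powr (- 2)" by (simp only: powr_add[symmetric]) simp
        finally show ?thesis using 3 by (simp add: C_def abs_mult)
      qed simp
    qed
  qed simp
qed

text \<open>Up to a constant x^(-a) is the integral of \<kappa>^(a-1) exp(-\<kappa> x) over \<kappa>
  > 0, so Tonelli trades the moment for an integral of the Laplace transform. An upper bound
  suffices: keeping only \<kappa> < 1/x, where exp(-\<kappa> x) \<ge> 1/e, gives the constant a e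
  without the Gamma function.\<close>

lemma negative_moment_finite:
  assumes M: "real_distribution M" and pos: "AE x in M. 0 < x" and t: "0 < t" and \<theta>: "0 < \<theta>"
    and laplace: "\<And>\<kappa>. 0 \<le> \<kappa> \<Longrightarrow> (LINT x|M. exp (- (\<kappa> * x))) = exp (- (t * \<kappa> powr \<theta>))"
    and a: "0 < a"
  shows "integrable M (\<lambda>x. x powr (- a))"
proof -
  interpret real_distribution M by fact
  interpret P: pair_sigma_finite M lborel ..
  have pw: "ennreal (x powr (- a)) \<le> ennreal (a * exp 1) *
      (\<integral>\<^sup>+\<kappa>. ennreal (indicator {0<..} \<kappa> * (\<kappa> powr (a - 1) * exp (- (\<kappa> * x)))) \<partial>lborel)" if x: "0 < x" for x
  proof -
    have "set_integrable lborel {0<..<1 / x} (\<lambda>\<kappa>. \<kappa> powr (a - 1))"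
      "(LBINT \<kappa>:{0<..<1 / x}. \<kappa> powr (a - 1)) = (1 / x) powr a / a"
      using powr_set_integral_Ioo[OF a, of "1 / x"] x by auto
    then have "ennreal ((1 / x) powr a / a) = (\<integral>\<^sup>+\<kappa>. ennreal (indicator {0<..<1 / x} \<kappa> * \<kappa> powr (a - 1)) \<partial>lborel)"
      by (subst nn_integral_eq_integral) (auto simp: set_integrable_def set_lebesgue_integral_def)
    also have "\<dots> \<le> (\<integral>\<^sup>+\<kappa>. ennreal (exp 1) * ennreal (indicator {0<..} \<kappa> * (\<kappa> powr (a - 1) * exp (- (\<kappa> * x)))) \<partial>lborel)"
    proof (rule nn_integral_mono)
      fix \<kappa> :: real
      have "\<kappa> powr (a - 1) \<le> exp 1 * (\<kappa> powr (a - 1) * exp (- (\<kappa> * x)))" if "0 < \<kappa>" "\<kappa> < 1 / x"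
      proof -
        have "\<kappa> * x \<le> 1" using that x by (simp add: field_simps)
        then have "1 \<le> exp 1 * exp (- (\<kappa> * x))" unfolding exp_add[symmetric] by simp
        then have "\<kappa> powr (a - 1) * 1 \<le> \<kappa> powr (a - 1) * (exp 1 * exp (- (\<kappa> * x)))"
          by (rule mult_left_mono) simp
        then show ?thesis by (simp add: mult_ac)
      qed
      then show "ennreal (indicator {0<..<1 / x} \<kappa> * \<kappa> powr (a - 1)) \<le>
          ennreal (exp 1) * ennreal (indicator {0<..} \<kappa> * (\<kappa> powr (a - 1) * exp (- (\<kappa> * x))))"
        by (auto simp: ennreal_mult'[symmetric] intro!: ennreal_leI split: split_indicator)
    qed
    also have "\<dots> = ennreal (exp 1) * (\<integral>\<^sup>+\<kappa>. ennreal (indicator {0<..} \<kappa> * (\<kappa> powr (a - 1) * exp (- (\<kappa> * x)))) \<partial>lborel)"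
      by (rule nn_integral_cmult) simp
    finally have "ennreal a * ennreal ((1 / x) powr a / a) \<le> ennreal a * (ennreal (exp 1) *
        (\<integral>\<^sup>+\<kappa>. ennreal (indicator {0<..} \<kappa> * (\<kappa> powr (a - 1) * exp (- (\<kappa> * x)))) \<partial>lborel))"
      by (rule mult_left_mono) simp
    moreover have "ennreal a * ennreal ((1 / x) powr a / a) = ennreal (x powr (- a))"
      using a x by (simp add: ennreal_mult'[symmetric] powr_minus_divide powr_divide)
    ultimately show ?thesis using a by (simp add: ennreal_mult mult.assoc)
  qed
  have "(\<integral>\<^sup>+x. ennreal (x powr (- a)) \<partial>M) \<le> (\<integral>\<^sup>+x. ennreal (a * exp 1) *
      (\<integral>\<^sup>+\<kappa>. ennreal (indicator {0<..} \<kappa> * (\<kappa> powr (a - 1) * exp (- (\<kappa> * x)))) \<partial>lborel) \<partial>M)"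
    using pos by (intro nn_integral_mono_AE) (auto elim!: eventually_mono intro: pw)
  also have "\<dots> = ennreal (a * exp 1) * (\<integral>\<^sup>+x. \<integral>\<^sup>+\<kappa>. ennreal (indicator {0<..} \<kappa> * (\<kappa> powr (a - 1) * exp (- (\<kappa> * x)))) \<partial>lborel \<partial>M)"
    by (rule nn_integral_cmult) measurable
  also have "(\<integral>\<^sup>+x. \<integral>\<^sup>+\<kappa>. ennreal (indicator {0<..} \<kappa> * (\<kappa> powr (a - 1) * exp (- (\<kappa> * x)))) \<partial>lborel \<partial>M)
      = (\<integral>\<^sup>+\<kappa>. \<integral>\<^sup>+x. ennreal (indicator {0<..} \<kappa> * (\<kappa> powr (a - 1) * exp (- (\<kappa> * x)))) \<partial>M \<partial>lborel)"
    by (rule P.Fubini'[symmetric]) measurable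
  also have "\<dots> = (\<integral>\<^sup>+\<kappa>. ennreal (indicator {0<..} \<kappa> * (\<kappa> powr (a - 1) * exp (- (t * \<kappa> powr \<theta>)))) \<partial>lborel)"
  proof (rule nn_integral_cong)
    fix \<kappa> :: real
    show "(\<integral>\<^sup>+x. ennreal (indicator {0<..} \<kappa> * (\<kappa> powr (a - 1) * exp (- (\<kappa> * x)))) \<partial>M) =
        ennreal (indicator {0<..} \<kappa> * (\<kappa> powr (a - 1) * exp (- (t * \<kappa> powr \<theta>))))"
    proof (cases "0 < \<kappa>")
      case True
      have "AE x in M. norm (exp (- (\<kappa> * x))) \<le> 1" using pos by eventually_elim (use True in simp)
      then have "integrable M (\<lambda>x. exp (- (\<kappa> * x)))" by (intro integrable_const_bound[where B=1]) auto
      then have "integrable M (\<lambda>x. \<kappa> powr (a - 1) * exp (- (\<kappa> * x)))" by simp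
      then have "(\<integral>\<^sup>+x. ennreal (\<kappa> powr (a - 1) * exp (- (\<kappa> * x))) \<partial>M) = ennreal (LINT x|M. \<kappa> powr (a - 1) * exp (- (\<kappa> * x)))"
        by (rule nn_integral_eq_integral) simp
      then show ?thesis using True laplace[of \<kappa>] by simp
    qed simp
  qed
  also have "ennreal (a * exp 1) * (\<integral>\<^sup>+\<kappa>. ennreal (indicator {0<..} \<kappa> * (\<kappa> powr (a - 1) * exp (- (t * \<kappa> powr \<theta>)))) \<partial>lborel) < \<infinity>"
    using powr_exp_powr_integrable[OF a t \<theta>]
    by (subst nn_integral_eq_integral) (auto simp: set_integrable_def ennreal_mult_less_top)
  finally show ?thesis
    by (intro integrableI_nonneg) auto
qed

section \<open>Subordination of the Fresnel kernel\<close>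

text \<open>\<open>fresnel_kernel \<alpha> x s\<close> is the density of the case \<open>p = 1\<close>, written after the substitution
  \<open>\<gamma> \<mapsto> (\<alpha> s) powr (1 / \<alpha>) \<gamma>\<close> in the Airy integral.\<close>

definition fresnel_kernel :: "real \<Rightarrow> real \<Rightarrow> real \<Rightarrow> real" where
  "fresnel_kernel \<alpha> x s = 1 / pi * Lim at_top (\<lambda>R. integral {0..R} (\<lambda>\<gamma>. cos (s * \<gamma> powr \<alpha> - x * \<gamma>)))"

lemma fresnel_kernel_tendsto:
  assumes "1 < \<alpha>" "0 < s"
  shows "((\<lambda>R. 1 / pi * integral {0..R} (\<lambda>\<gamma>. cos (s * \<gamma> powr \<alpha> - x * \<gamma>))) \<longlongrightarrow> fresnel_kernel \<alpha> x s) at_top"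
proof -
  obtain l where l: "((\<lambda>R. integral {0..R} (\<lambda>\<gamma>. cos (s * \<gamma> powr \<alpha> - x * \<gamma>))) \<longlongrightarrow> l) at_top"
    using power_phase_convergent[OF assms] by blast
  then have "Lim at_top (\<lambda>R. integral {0..R} (\<lambda>\<gamma>. cos (s * \<gamma> powr \<alpha> - x * \<gamma>))) = l"
    by (intro tendsto_Lim) auto
  with tendsto_mult_left[OF l, of "1 / pi"] show ?thesis by (simp add: fresnel_kernel_def)
qed

text \<open>Since k^\<alpha> = \<alpha> s, the substitution u = k \<gamma> turns u^\<alpha> /
  \<alpha> into s \<gamma>^\<alpha>; its Jacobian cancels the prefactor 1 / k, and the new upper
  limit R / k still tends to infinity.\<close>

lemma gen_airy_scaled:
  assumes \<alpha>: "1 < \<alpha>" and s: "0 < s"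
  shows "1 / (\<alpha> * s) powr (1 / \<alpha>) * gen_airy \<alpha> (- x / (\<alpha> * s) powr (1 / \<alpha>)) = fresnel_kernel \<alpha> x s"
proof -
  define k where "k = (\<alpha> * s) powr (1 / \<alpha>)"
  have k: "0 < k" using \<alpha> s by (simp add: k_def)
  have k\<alpha>: "k powr \<alpha> = \<alpha> * s" using \<alpha> s by (simp add: k_def powr_powr)
  let ?I = "\<lambda>R. integral {0..R} (\<lambda>\<gamma>. cos (s * \<gamma> powr \<alpha> - x * \<gamma>))"
  let ?J = "\<lambda>R. integral {0..R} (\<lambda>u. cos (u * (- x / k) + u powr \<alpha> / \<alpha>))"
  obtain l where l: "(?I \<longlongrightarrow> l) at_top" using power_phase_convergent[OF \<alpha> s] by blast
  have scale: "?J R = k * ?I (R / k)" if R: "0 < R" for R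
  proof -
    have "integral ((\<lambda>x. x / k) ` {0..R}) (\<lambda>\<gamma>. cos ((k * \<gamma>) * (- x / k) + (k * \<gamma>) powr \<alpha> / \<alpha>)) = (1 / \<bar>k\<bar>) *\<^sub>R ?J R"
      using k by (intro integral_stretch_real) auto
    also have "(\<lambda>x. x / k) ` {0..R} = {0..R / k}" using k by simp
    also have "integral {0..R / k} (\<lambda>\<gamma>. cos ((k * \<gamma>) * (- x / k) + (k * \<gamma>) powr \<alpha> / \<alpha>)) = ?I (R / k)"
      using k \<alpha> by (intro Henstock_Kurzweil_Integration.integral_cong) (simp add: powr_mult k\<alpha> mult.commute)
    finally show ?thesis using k by simp
  qed
  have "filterlim (\<lambda>R. R / k) at_top at_top"
    using k by real_asymp
  from tendsto_mult_left[OF filterlim_compose[OF l this], of k]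
  have "((\<lambda>R. k * ?I (R / k)) \<longlongrightarrow> k * l) at_top" .
  then have "(?J \<longlongrightarrow> k * l) at_top"
    by (rule Lim_transform_eventually) (rule eventually_mono[OF eventually_gt_at_top[of 0] scale[symmetric]])
  then have "Lim at_top ?J = k * l" by (intro tendsto_Lim) auto
  moreover have "Lim at_top ?I = l" using l by (intro tendsto_Lim) auto
  ultimately show ?thesis
    using k unfolding gen_airy_def fresnel_kernel_def k_def[symmetric] by simp
qed

lemma fresnel_density_eq:
  assumes "1 < \<alpha>" "0 < s"
  shows "fresnel_density \<alpha> p x s = p * fresnel_kernel \<alpha> x s + (1 - p) * fresnel_kernel \<alpha> (- x) s"
  using gen_airy_scaled[OF assms, of x] gen_airy_scaled[OF assms, of "- x"]
  by (simp add: fresnel_density_def distrib_left mult.left_commute mult_ac)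

lemma power_phase_integral_eq:
  fixes \<alpha> s x R :: real
  assumes "0 < \<alpha>"
  shows "integral {0..R} (\<lambda>\<gamma>. cos (s * \<gamma> powr \<alpha> - x * \<gamma>)) = (LBINT \<gamma>:{0..R}. cos (s * \<gamma> powr \<alpha> - x * \<gamma>))"
proof -
  have "set_integrable lborel {0..R} (\<lambda>\<gamma>. cos (s * \<gamma> powr \<alpha> - x * \<gamma>))"
    unfolding set_integrable_def
    by (rule borel_integrable_compact[OF compact_Icc])
       (auto intro: continuous_on_subset[OF continuous_on_cos_power_phase[OF assms]])
  then show ?thesis by (rule set_borel_integral_eq_integral(2)[symmetric])
qed

text \<open>Fubini is applied at finite R because over the whole half-line the cosine is not
  absolutely integrable. It is the real part of e^(-i\<gamma> x) e^(i s \<gamma>^\<alpha>), whose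
  mean over s is a value of the characteristic function.\<close>

lemma expectation_power_phase:
  fixes \<alpha> x R :: real
  assumes M: "real_distribution M" and \<alpha>: "0 < \<alpha>"
  shows "(LINT s|M. 1 / pi * integral {0..R} (\<lambda>\<gamma>. cos (s * \<gamma> powr \<alpha> - x * \<gamma>))) =
    1 / pi * (LBINT \<gamma>:{0..R}. Re (iexp (- (\<gamma> * x)) * char M (\<gamma> powr \<alpha>)))"
proof -
  interpret M: real_distribution M by fact
  interpret P: pair_sigma_finite M lborel ..
  have int: "integrable (M \<Otimes>\<^sub>M lborel) (case_prod (\<lambda>s \<gamma>. indicator {0..R} \<gamma> *\<^sub>R cos (s * \<gamma> powr \<alpha> - x * \<gamma>)))"
  proof (rule integrableI_bounded_set[where A="UNIV \<times> {0..R}" and B=1])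
    show "emeasure (M \<Otimes>\<^sub>M lborel) (UNIV \<times> {0..R}) < \<infinity>"
      using M.emeasure_space_1
      by (cases "0 \<le> R") (auto simp: lborel.emeasure_pair_measure_Times ennreal_mult_less_top)
  qed (auto intro!: AE_I2 simp: indicator_def split: if_splits)
  have "(LINT s|M. (LBINT \<gamma>. indicator {0..R} \<gamma> *\<^sub>R cos (s * \<gamma> powr \<alpha> - x * \<gamma>))) =
      (LBINT \<gamma>. (LINT s|M. indicator {0..R} \<gamma> *\<^sub>R cos (s * \<gamma> powr \<alpha> - x * \<gamma>)))"
    by (rule P.Fubini_integral[OF int, symmetric])
  also have "\<dots> = (LBINT \<gamma>. indicator {0..R} \<gamma> *\<^sub>R Re (iexp (- (\<gamma> * x)) * char M (\<gamma> powr \<alpha>)))"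
  proof (rule Bochner_Integration.integral_cong[OF refl])
    fix \<gamma> :: real
    have "(LINT s|M. cos (s * \<gamma> powr \<alpha> - x * \<gamma>)) = (LINT s|M. Re (iexp (- (\<gamma> * x)) * iexp (\<gamma> powr \<alpha> * s)))"
      by (intro Bochner_Integration.integral_cong refl)
         (simp add: exp_add[symmetric] Re_exp algebra_simps flip: of_real_mult of_real_diff)
    also have "\<dots> = Re (CLINT s|M. iexp (- (\<gamma> * x)) * iexp (\<gamma> powr \<alpha> * s))"
      by (rule integral_Re) (auto intro: M.integrable_const_bound[where B=1] simp: norm_mult)
    also have "\<dots> = Re (iexp (- (\<gamma> * x)) * char M (\<gamma> powr \<alpha>))"
      by (simp add: char_def)
    finally show "(LINT s|M. indicator {0..R} \<gamma> *\<^sub>R cos (s * \<gamma> powr \<alpha> - x * \<gamma>)) =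
        indicator {0..R} \<gamma> *\<^sub>R Re (iexp (- (\<gamma> * x)) * char M (\<gamma> powr \<alpha>))" by simp
  qed
  finally show ?thesis
    by (simp add: power_phase_integral_eq[OF \<alpha>] set_lebesgue_integral_def)
qed

text \<open>The bound \<open>power_phase_bound\<close>, uniform in \<open>R\<close>, is integrable because \<open>M\<close> has
  finite negative moments; this justifies taking the limit \<open>R \<rightarrow> \<infinity>\<close> under the expectation.\<close>

lemma expectation_fresnel_kernel:
  assumes M: "real_distribution M" and pos: "AE s in M. 0 < s" and \<alpha>: "1 < \<alpha>"
    and moments: "\<And>a. 0 < a \<Longrightarrow> integrable M (\<lambda>s. s powr (- a))"
    and int: "set_integrable lborel {0<..} (\<lambda>\<gamma>. char M (\<gamma> powr \<alpha>))"
  shows "integrable M (\<lambda>s. indicator {0<..} s * fresnel_kernel \<alpha> x s)"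
    and "(LINT s|M. indicator {0<..} s * fresnel_kernel \<alpha> x s) =
      1 / pi * (LBINT \<gamma>:{0<..}. Re (iexp (- (\<gamma> * x)) * char M (\<gamma> powr \<alpha>)))"
proof -
  interpret M: real_distribution M by fact
  have \<alpha>0: "0 < \<alpha>" using \<alpha> by simp
  define D where "D n s = 1 / pi * integral {0..real n} (\<lambda>\<gamma>. cos (s * \<gamma> powr \<alpha> - x * \<gamma>))" for n s
  \<comment> \<open>The right-hand side of \<open>power_phase_bound\<close>, so the negative moments
    of orders 1/(\<alpha>-1) and 1/\<alpha> make it integrable.\<close>
  define w where "w s = 1 / pi * ((2 * \<bar>x\<bar> / \<alpha>) powr (1 / (\<alpha> - 1)) * s powr (- (1 / (\<alpha> - 1))) + 5 * s powr (- (1 / \<alpha>)))" for s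
  have D_meas [measurable]: "D n \<in> borel_measurable borel" for n
    unfolding D_def power_phase_integral_eq[OF \<alpha>0] set_lebesgue_integral_def by measurable
  have lim: "(\<lambda>n. D n s) \<longlonglongrightarrow> fresnel_kernel \<alpha> x s" if "0 < s" for s
    unfolding D_def
    by (rule filterlim_compose[OF fresnel_kernel_tendsto[OF \<alpha> that] filterlim_real_sequentially])
  \<comment> \<open>For s \<le> 0 the \<open>Lim\<close> inside \<open>fresnel_kernel\<close> need
    not exist; the indicator makes the sequence converge everywhere.\<close>
  have lim': "(\<lambda>n. indicator {0<..} s * D n s) \<longlonglongrightarrow> indicator {0<..} s * fresnel_kernel \<alpha> x s" for s
    by (cases "0 < s") (auto intro: lim)
  have K_meas: "(\<lambda>s. indicator {0<..} s * fresnel_kernel \<alpha> x s) \<in> borel_measurable M"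
    by (rule borel_measurable_LIMSEQ_real[OF lim']) measurable
  have w: "integrable M w"
    unfolding w_def using \<alpha> moments[of "1 / (\<alpha> - 1)"] moments[of "1 / \<alpha>"]
    by (intro integrable_mult_right Bochner_Integration.integrable_add) auto
  have Dw: "norm (indicator {0<..} s * D n s) \<le> w s" for n s
  proof (cases "0 < s")
    case True
    have "\<bar>D n s\<bar> = 1 / pi * \<bar>integral {0..real n} (\<lambda>\<gamma>. cos (s * \<gamma> powr \<alpha> - x * \<gamma>))\<bar>"
      by (simp add: D_def abs_mult)
    also have "\<dots> \<le> w s"
      unfolding w_def by (intro mult_left_mono power_phase_bound \<alpha> True) auto
    finally show ?thesis using True by simp
  next
    case False
    have "0 \<le> w s" by (auto simp: w_def intro!: mult_nonneg_nonneg add_nonneg_nonneg)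
    then show ?thesis using False by simp
  qed
  show "integrable M (\<lambda>s. indicator {0<..} s * fresnel_kernel \<alpha> x s)"
    by (rule integrable_dominated_convergence[OF K_meas _ w _ AE_I2, where s="\<lambda>n s. indicator {0<..} s * D n s"])
       (use lim' Dw in auto)
  have "(\<lambda>n. LINT s|M. indicator {0<..} s * D n s) \<longlonglongrightarrow> (LINT s|M. indicator {0<..} s * fresnel_kernel \<alpha> x s)"
    by (rule integral_dominated_convergence[OF K_meas _ w]) (use lim' Dw in auto)
  moreover have "(LINT s|M. indicator {0<..} s * D n s) = (LINT s|M. D n s)" for n
    using pos by (intro integral_cong_AE) (auto elim!: eventually_mono)
  ultimately have "(\<lambda>n. LINT s|M. D n s) \<longlonglongrightarrow> (LINT s|M. indicator {0<..} s * fresnel_kernel \<alpha> x s)"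
    by simp
  moreover have "(\<lambda>n. LINT s|M. D n s) \<longlonglongrightarrow> 1 / pi * (LBINT \<gamma>:{0<..}. Re (iexp (- (\<gamma> * x)) * char M (\<gamma> powr \<alpha>)))"
    unfolding D_def expectation_power_phase[OF M \<alpha>0] set_lebesgue_integral_def
  proof (intro tendsto_mult_left integral_dominated_convergence[where w="\<lambda>\<gamma>. norm (indicator {0<..} \<gamma> *\<^sub>R char M (\<gamma> powr \<alpha>))"])
    show "integrable lborel (\<lambda>\<gamma>. norm (indicator {0<..} \<gamma> *\<^sub>R char M (\<gamma> powr \<alpha>)))"
      using int unfolding set_integrable_def by (rule integrable_norm)
    show "AE \<gamma> in lborel. (\<lambda>n. indicator {0..real n} \<gamma> *\<^sub>R Re (iexp (- (\<gamma> * x)) * char M (\<gamma> powr \<alpha>)))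
        \<longlonglongrightarrow> indicator {0<..} \<gamma> *\<^sub>R Re (iexp (- (\<gamma> * x)) * char M (\<gamma> powr \<alpha>))"
    proof (rule AE_mp[OF AE_lborel_singleton[of 0]], rule AE_I2, rule impI, rule tendsto_eventually)
      fix \<gamma> :: real assume \<gamma>: "\<gamma> \<noteq> 0"
      obtain N :: nat where "\<gamma> \<le> N" using real_arch_simple by blast
      then show "\<forall>\<^sub>F n in sequentially. indicator {0..real n} \<gamma> *\<^sub>R Re (iexp (- (\<gamma> * x)) * char M (\<gamma> powr \<alpha>)) =
          indicator {0<..} \<gamma> *\<^sub>R Re (iexp (- (\<gamma> * x)) * char M (\<gamma> powr \<alpha>))"
        using \<gamma> by (intro eventually_sequentiallyI[of N]) (auto split: split_indicator)
    qed
    show "AE \<gamma> in lborel. norm (indicator {0..real n} \<gamma> *\<^sub>R Re (iexp (- (\<gamma> * x)) * char M (\<gamma> powr \<alpha>)))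
        \<le> norm (indicator {0<..} \<gamma> *\<^sub>R char M (\<gamma> powr \<alpha>))" for n
    proof (rule AE_mp[OF AE_lborel_singleton[of 0]], rule AE_I2, rule impI)
      fix \<gamma> :: real assume \<gamma>: "\<gamma> \<noteq> 0"
      have "\<bar>Re (iexp (- (\<gamma> * x)) * char M (\<gamma> powr \<alpha>))\<bar> \<le> norm (iexp (- (\<gamma> * x)) * char M (\<gamma> powr \<alpha>))"
        by (rule abs_Re_le_cmod)
      also have "\<dots> = norm (char M (\<gamma> powr \<alpha>))" by (simp add: norm_mult)
      finally show "norm (indicator {0..real n} \<gamma> *\<^sub>R Re (iexp (- (\<gamma> * x)) * char M (\<gamma> powr \<alpha>)))
        \<le> norm (indicator {0<..} \<gamma> *\<^sub>R char M (\<gamma> powr \<alpha>))"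
        using \<gamma> by (auto split: split_indicator)
    qed
  qed auto
  ultimately show "(LINT s|M. indicator {0<..} s * fresnel_kernel \<alpha> x s) =
      1 / pi * (LBINT \<gamma>:{0<..}. Re (iexp (- (\<gamma> * x)) * char M (\<gamma> powr \<alpha>)))"
    by (rule LIMSEQ_unique)
qed

section \<open>The characteristic function in polar form\<close>

text \<open>For \<nu> = \<alpha>\<theta> the exponent is that of the subordinator at
  |\<gamma>|^\<alpha>, with the sign of \<gamma> kept in the phase; the skewness is encoded in the
  angle pi \<theta> / 2.\<close>

definition strictly_stable_cf :: "real \<Rightarrow> real \<Rightarrow> real \<Rightarrow> real \<Rightarrow> complex" where
  "strictly_stable_cf \<nu> \<theta> t \<gamma> =
     exp (- complex_of_real (t * \<bar>\<gamma>\<bar> powr \<nu>) * exp (- \<i> * complex_of_real (pi * \<theta> / 2 * sgn \<gamma>)))"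

text \<open>The origin of \<sigma>: with a = pi \<theta> / 2, cos a (1 - i tan a) = exp(-i a), and
  \<sigma>^\<nu> = cos a supplies the factor that brings the modulus to 1.\<close>

lemma stable_cf_eq_strictly_stable_cf:
  assumes \<nu>: "0 < \<nu>" and \<theta>: "0 < \<theta>" "\<theta> < 1" and \<beta>: "\<beta> * tan (pi * \<nu> / 2) = tan (pi * \<theta> / 2)"
  shows "stable_cf \<nu> (cos (pi * \<theta> / 2) powr (1 / \<nu>)) \<beta> 0 t \<gamma> = strictly_stable_cf \<nu> \<theta> t \<gamma>"
proof -
  define c where "c = cos (pi * \<theta> / 2)"
  have c: "0 < c" unfolding c_def using \<theta> by (intro cos_gt_zero) auto
  have \<sigma>: "(c powr (1 / \<nu>)) powr \<nu> = c" using c \<nu> by (simp add: powr_powr)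
  \<comment> \<open>Excludes \<gamma> = 0, where \<open>sgn 0 = 0\<close> would turn the claim into
    \<open>c = 1\<close>; there |\<gamma>|^\<nu> = 0 makes the two functions agree.\<close>
  have rot: "of_real c * (1 - \<i> * complex_of_real (\<beta> * sgn \<gamma> * tan (pi * \<nu> / 2)))
      = exp (- \<i> * complex_of_real (pi * \<theta> / 2 * sgn \<gamma>))" if "\<gamma> \<noteq> 0"
  proof -
    have "\<beta> * sgn \<gamma> * tan (pi * \<nu> / 2) = sgn \<gamma> * tan (pi * \<theta> / 2)" using \<beta> by (metis mult.assoc mult.commute)
    moreover have "c * tan (pi * \<theta> / 2) = sin (pi * \<theta> / 2)" using c by (simp add: tan_def c_def)
    ultimately show ?thesis
      using that by (cases "0 < \<gamma>") (auto simp: complex_eq_iff Re_exp Im_exp c_def)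
  qed
  show ?thesis
  proof (cases "\<gamma> = 0")
    case False
    then show ?thesis
      unfolding stable_cf_def strictly_stable_cf_def c_def[symmetric] \<sigma> rot[OF False, symmetric]
      by (simp add: mult_ac)
  qed (simp add: stable_cf_def strictly_stable_cf_def)
qed

section \<open>Integrability and the half-line form of the inversion integral\<close>

lemma norm_strictly_stable_cf:
  "norm (strictly_stable_cf \<nu> \<theta> t \<gamma>) \<le> exp (- (t * cos (pi * \<theta> / 2) * \<bar>\<gamma>\<bar> powr \<nu>))"
proof (cases "\<gamma> = 0")
  case False
  then show ?thesis
    by (cases "0 < \<gamma>") (auto simp: strictly_stable_cf_def Re_exp)
qed (simp add: strictly_stable_cf_def)

lemma strictly_stable_cf_uminus: "strictly_stable_cf \<nu> \<theta> t (- \<gamma>) = cnj (strictly_stable_cf \<nu> \<theta> t \<gamma>)"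
  by (simp add: strictly_stable_cf_def exp_cnj sgn_minus)

lemma strictly_stable_cf_measurable [measurable]: "strictly_stable_cf \<nu> \<theta> t \<in> borel_measurable borel"
  unfolding strictly_stable_cf_def[abs_def] by measurable

lemma lborel_integrable_even:
  fixes f :: "real \<Rightarrow> 'a :: {banach, second_countable_topology}"
  assumes int: "set_integrable lborel {0<..} f" and even: "\<And>x. f (- x) = f x"
  shows "integrable lborel f" and "(LBINT x. f x) = 2 *\<^sub>R (LBINT x:{0<..}. f x)"
proof -
  define g where "g x = indicator {0<..} x *\<^sub>R f x" for x :: real
  have g: "integrable lborel g" using int by (simp add: set_integrable_def g_def[abs_def])
  have g': "integrable lborel (\<lambda>x. g (- x))"
    using lborel_integrable_real_affine[OF g, of "-1" 0] by simp
  have eq: "AE x in lborel. g x + g (- x) = f x"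
    by (rule AE_mp[OF AE_lborel_singleton[of 0]]) (auto simp: g_def even split: split_indicator)
  have f_meas: "f \<in> borel_measurable lborel"
  proof -
    \<comment> \<open>The two half-line pieces miss the value at 0, which has to be restored to get
      measurability of f itself.\<close>
    have "f x = g x + g (- x) + indicator {0} x *\<^sub>R f 0" for x
      by (auto simp: g_def even split: split_indicator)
    then have "f = (\<lambda>x. g x + g (- x) + indicator {0} x *\<^sub>R f 0)" by (rule ext)
    moreover have "(\<lambda>x. g x + g (- x) + indicator {0} x *\<^sub>R f 0) \<in> borel_measurable lborel"
      using g g' by (intro borel_measurable_add borel_measurable_integrable) auto
    ultimately show ?thesis by simp
  qed
  have gg: "integrable lborel (\<lambda>x. g x + g (- x))" using g g' by simp
  show "integrable lborel f"
    by (rule integrable_cong_AE_imp[OF gg f_meas]) (use eq in \<open>auto elim!: eventually_mono\<close>)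
  have "(LBINT x. f x) = (LBINT x. g x + g (- x))"
    by (rule integral_cong_AE[OF f_meas borel_measurable_integrable[OF gg]])
       (use eq in \<open>auto elim!: eventually_mono\<close>)
  also have "\<dots> = (LBINT x. g x) + (LBINT x. g (- x))" using g g' by simp
  also have "(LBINT x. g (- x)) = (LBINT x. g x)"
    using lborel_integral_real_affine[of "-1" g 0] by simp
  finally show "(LBINT x. f x) = 2 *\<^sub>R (LBINT x:{0<..}. f x)"
    by (simp add: set_lebesgue_integral_def g_def[abs_def] scaleR_2)
qed

text \<open>\<theta> < 1 keeps the angle pi \<theta> / 2 below a right angle, so the exponent has a
  negative real part that grows like |\<gamma>|^\<nu>.\<close>

lemma strictly_stable_cf_integrable:
  assumes \<nu>: "0 < \<nu>" and t: "0 < t" and \<theta>: "0 < \<theta>" "\<theta> < 1"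
  shows "integrable lborel (strictly_stable_cf \<nu> \<theta> t)"
proof -
  define c where "c = t * cos (pi * \<theta> / 2)"
  have "0 < cos (pi * \<theta> / 2)" using \<theta> by (intro cos_gt_zero) auto
  then have c: "0 < c" using t by (simp add: c_def)
  have "set_integrable lborel {0<..} (\<lambda>x. exp (- (c * \<bar>x\<bar> powr \<nu>)))"
    using powr_exp_powr_integrable[of 1 c \<nu>] c \<nu>
    by (subst set_integrable_cong[OF refl refl, of _ _ "\<lambda>x. x powr (1 - 1) * exp (- (c * x powr \<nu>))"]) auto
  then have "integrable lborel (\<lambda>x. exp (- (c * \<bar>x\<bar> powr \<nu>)))"
    by (rule lborel_integrable_even) simp
  then show ?thesis
    by (rule Bochner_Integration.integrable_bound)
       (use norm_strictly_stable_cf[of \<nu> \<theta> t] in \<open>auto simp: c_def\<close>)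
qed

text \<open>Fourier inversion integrates over the whole line, the Airy side over \<gamma> > 0 only.
  Conjugate symmetry makes the real part even, and the resulting factor 2 turns 1/(2 pi) into
  1/pi.\<close>

lemma strictly_stable_density_eq:
  assumes int: "integrable lborel (strictly_stable_cf \<nu> \<theta> t)"
  shows "Re (1 / (2 * pi) * (CLBINT \<gamma>. iexp (- (\<gamma> * x)) * strictly_stable_cf \<nu> \<theta> t \<gamma>)) =
    1 / pi * (LBINT \<gamma>:{0<..}. Re (iexp (- (\<gamma> * x)) * strictly_stable_cf \<nu> \<theta> t \<gamma>))"
proof -
  let ?G = "\<lambda>\<gamma>. iexp (- (\<gamma> * x)) * strictly_stable_cf \<nu> \<theta> t \<gamma>"
  have G: "integrable lborel ?G"
    by (rule Bochner_Integration.integrable_bound[OF int]) (auto simp: norm_mult)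
  then have ReG: "integrable lborel (\<lambda>\<gamma>. Re (?G \<gamma>))" by (rule integrable_Re)
  have "set_integrable lborel {0<..} (\<lambda>\<gamma>. Re (?G \<gamma>))"
    unfolding set_integrable_def by (rule integrable_mult_indicator[OF _ ReG]) simp
  moreover have "Re (?G (- \<gamma>)) = Re (?G \<gamma>)" for \<gamma>
  proof -
    have "?G (- \<gamma>) = cnj (?G \<gamma>)" by (simp add: strictly_stable_cf_uminus exp_cnj)
    then show ?thesis by simp
  qed
  ultimately have "(LBINT \<gamma>. Re (?G \<gamma>)) = 2 *\<^sub>R (LBINT \<gamma>:{0<..}. Re (?G \<gamma>))"
    by (rule lborel_integrable_even)
  moreover have "Re (CLBINT \<gamma>. ?G \<gamma>) = (LBINT \<gamma>. Re (?G \<gamma>))"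
    by (rule integral_Re[OF G, symmetric])
  moreover have "Re (1 / (2 * pi) * z) = 1 / (2 * pi) * Re z" for z
  proof -
    have "1 / (2 * complex_of_real pi) = of_real (1 / (2 * pi))" by simp
    then show ?thesis by (simp only: of_real_numeral of_real_mult Re_complex_of_real) (simp add: Re_divide_of_real)
  qed
  ultimately show ?thesis by simp
qed

section \<open>The distribution of the subordinated process\<close>

lemma density_lborel_measure:
  assumes D: "real_distribution (density lborel f)" and [measurable]: "f \<in> borel_measurable borel"
    and nn: "\<And>x. 0 \<le> f x"
  shows "integrable lborel f" and "A \<in> sets borel \<Longrightarrow> measure (density lborel f) A = (LBINT x:A. f x)"
proof -
  interpret real_distribution "density lborel f" by fact
  have "(\<integral>\<^sup>+x. ennreal (f x) \<partial>lborel) = 1"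
    using emeasure_space_1 by (simp add: emeasure_density)
  then show int: "integrable lborel f" by (intro integrableI_nonneg) (auto simp: nn)
  assume A [measurable]: "A \<in> sets borel"
  have intA: "integrable lborel (\<lambda>x. indicator A x *\<^sub>R f x)"
    by (rule integrable_mult_indicator[OF _ int]) simp
  have "emeasure (density lborel f) A = (\<integral>\<^sup>+x. ennreal (indicator A x *\<^sub>R f x) \<partial>lborel)"
    by (subst emeasure_density) (auto intro!: nn_integral_cong split: split_indicator)
  also have "\<dots> = ennreal (LBINT x:A. f x)"
    unfolding set_lebesgue_integral_def by (rule nn_integral_eq_integral[OF intA]) (simp add: nn)
  finally show "measure (density lborel f) A = (LBINT x:A. f x)"
    by (simp add: measure_def set_lebesgue_integral_def nn)
qed

lemma set_integral_reflect_lborel: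
  fixes f :: "real \<Rightarrow> real"
  shows "(LBINT x:A. f (- x)) = (LBINT x:uminus -` A. f x)"
  unfolding set_lebesgue_integral_def
  using lborel_integral_real_affine[of "-1" "\<lambda>x. indicator (uminus -` A) x *\<^sub>R f x" 0]
  by (simp add: indicator_def)

lemma vimage_uminus_borel:
  fixes A :: "real set"
  assumes "A \<in> sets borel"
  shows "uminus -` A \<in> sets borel"
proof -
  have "uminus -` A \<inter> space borel \<in> sets borel" by (rule measurable_sets[OF _ assms]) measurable
  then show ?thesis by simp
qed

text \<open>Where \<epsilon> = 1 the value of H must lie in A, elsewhere in the reflection of A;
  independence factorises the probability of each event.\<close>

lemma distr_random_sign:
  fixes H \<epsilon> :: "'a \<Rightarrow> real"
  assumes M: "prob_space M" and [measurable]: "H \<in> borel_measurable M" "\<epsilon> \<in> borel_measurable M"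
    and p: "measure M {\<omega> \<in> space M. \<epsilon> \<omega> = 1} = p"
    and indep: "prob_space.indep_var M borel H borel \<epsilon>" and A [measurable]: "A \<in> sets borel"
  shows "measure (distr M borel (\<lambda>\<omega>. if \<epsilon> \<omega> = 1 then H \<omega> else - H \<omega>)) A =
    p * measure (distr M borel H) A + (1 - p) * measure (distr M borel H) (uminus -` A)"
proof -
  interpret prob_space M by fact
  note A' [measurable] = vimage_uminus_borel[OF A]
  define E1 where "E1 = {\<omega> \<in> space M. H \<omega> \<in> A \<and> \<epsilon> \<omega> \<in> {1}}"
  define E2 where "E2 = {\<omega> \<in> space M. H \<omega> \<in> uminus -` A \<and> \<epsilon> \<omega> \<in> - {1}}"
  have [measurable]: "E1 \<in> sets M" "E2 \<in> sets M" unfolding E1_def E2_def by measurable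
  have split: "prob {\<omega> \<in> space M. H \<omega> \<in> S \<and> \<epsilon> \<omega> \<in> T} =
      prob {\<omega> \<in> space M. H \<omega> \<in> S} * prob {\<omega> \<in> space M. \<epsilon> \<omega> \<in> T}"
    if "S \<in> sets borel" "T \<in> sets borel" for S T
  proof -
    have "{\<omega> \<in> space M. H \<omega> \<in> S \<and> \<epsilon> \<omega> \<in> T} = (\<lambda>\<omega>. (H \<omega>, \<epsilon> \<omega>)) -` (S \<times> T) \<inter> space M"
      "{\<omega> \<in> space M. H \<omega> \<in> S} = H -` S \<inter> space M" "{\<omega> \<in> space M. \<epsilon> \<omega> \<in> T} = \<epsilon> -` T \<inter> space M" by auto
    then show ?thesis using indep_varD[OF indep that] by simp
  qed
  have compl: "prob {\<omega> \<in> space M. \<epsilon> \<omega> \<noteq> 1} = 1 - p"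
  proof -
    have "{\<omega> \<in> space M. \<epsilon> \<omega> \<noteq> 1} = space M - {\<omega> \<in> space M. \<epsilon> \<omega> = 1}" by auto
    then show ?thesis using p by (simp add: prob_compl)
  qed
  have distr_H: "measure (distr M borel H) S = prob {\<omega> \<in> space M. H \<omega> \<in> S}" if "S \<in> sets borel" for S
    using that by (subst measure_distr) (auto intro!: arg_cong[where f=prob])
  have "measure (distr M borel (\<lambda>\<omega>. if \<epsilon> \<omega> = 1 then H \<omega> else - H \<omega>)) A = prob (E1 \<union> E2)"
    by (subst measure_distr) (auto intro!: arg_cong[where f=prob] simp: E1_def E2_def split: if_splits)
  also have "\<dots> = prob E1 + prob E2"
    by (rule finite_measure_Union) (auto simp: E1_def E2_def)
  also have "prob E1 = p * measure (distr M borel H) A"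
    unfolding E1_def using p by (subst split) (auto simp: distr_H)
  also have "prob E2 = (1 - p) * measure (distr M borel H) (uminus -` A)"
    unfolding E2_def by (subst split) (auto simp: distr_H compl simp del: vimage_eq)
  finally show ?thesis .
qed

text \<open>The kernel and its reflection are both integrable against the subordinator law, so the
  mixture over p splits by linearity. At this stage f is just a Fourier integral; that it is a
  probability density is a separate matter.\<close>

lemma Y_density_eq:
  fixes \<alpha> \<theta> t p x :: real
  assumes \<alpha>: "1 < \<alpha>" and \<theta>: "0 < \<theta>" "\<theta> < 1" and t: "0 < t"
    and h: "stable_subordinator_density \<theta> t (\<lambda>s. h s t)"
  defines "f \<equiv> \<lambda>x. Re (1 / (2 * pi) * (CLBINT \<gamma>. iexp (- (\<gamma> * x)) * strictly_stable_cf (\<alpha> * \<theta>) \<theta> t \<gamma>))"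
  shows "Y_density \<alpha> p h t x = p * f x + (1 - p) * f (- x)"
proof -
  define q where "q s = h s t" for s
  have q [measurable]: "q \<in> borel_measurable borel" and q0: "\<And>s. 0 \<le> q s" "\<And>s. s \<le> 0 \<Longrightarrow> q s = 0"
    and prob: "prob_space (density lborel q)"
    and char: "\<And>\<gamma>. char (density lborel q) \<gamma> =
      exp (- complex_of_real (t * \<bar>\<gamma>\<bar> powr \<theta>) * exp (- \<i> * complex_of_real (pi * \<theta> / 2 * sgn \<gamma>)))"
    using h unfolding stable_subordinator_density_def q_def[abs_def] by auto
  let ?M = "density lborel q"
  have M: "real_distribution ?M"
    using prob by (simp add: real_distribution_def real_distribution_axioms_def)
  have "0 < s" if "0 < q s" for s using q0(2)[of s] that by (cases "0 < s") auto
  then have pos: "AE s in ?M. 0 < s" by (subst AE_density) auto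
  then have pos': "AE s in ?M. 0 \<le> s" by eventually_elim simp
  have moments: "integrable ?M (\<lambda>s. s powr (- a))" if "0 < a" for a
    by (rule negative_moment_finite[OF M pos t \<theta>(1) subordinator_laplace_transform[OF M pos' \<theta>(1) char] that])
  \<comment> \<open>(\<gamma>^\<alpha>)^\<theta> = \<gamma>^(\<alpha>\<theta>) is the origin of the
    index \<nu> = \<alpha>\<theta>.\<close>
  have char_powr: "char ?M (\<gamma> powr \<alpha>) = strictly_stable_cf (\<alpha> * \<theta>) \<theta> t \<gamma>" if "0 < \<gamma>" for \<gamma>
    unfolding char strictly_stable_cf_def using that by (simp add: powr_powr)
  have cf_int: "integrable lborel (strictly_stable_cf (\<alpha> * \<theta>) \<theta> t)"
    using \<alpha> \<theta> t by (intro strictly_stable_cf_integrable) auto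
  have "set_integrable lborel {0<..} (strictly_stable_cf (\<alpha> * \<theta>) \<theta> t)"
    unfolding set_integrable_def by (rule integrable_mult_indicator[OF _ cf_int]) simp
  then have int: "set_integrable lborel {0<..} (\<lambda>\<gamma>. char ?M (\<gamma> powr \<alpha>))"
    by (subst set_integrable_cong[OF refl refl char_powr]) auto
  have f: "f x = 1 / pi * (LBINT \<gamma>:{0<..}. Re (iexp (- (\<gamma> * x)) * char ?M (\<gamma> powr \<alpha>)))" for x
    unfolding f_def strictly_stable_density_eq[OF cf_int]
    by (intro arg_cong[where f="\<lambda>z. 1 / pi * z"] set_lebesgue_integral_cong) (auto simp: char_powr)
  let ?K = "\<lambda>x s. indicator {0<..} s * fresnel_kernel \<alpha> x s"
  have K: "integrable ?M (?K x)" "(LINT s|?M. ?K x s) = f x" for x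
    unfolding f by (rule expectation_fresnel_kernel[OF M pos \<alpha> moments int]; assumption)+
  have Kint: "integrable ?M (\<lambda>s. p * ?K x s + (1 - p) * ?K (- x) s)"
    using K(1) by (intro Bochner_Integration.integrable_add integrable_mult_right)
  have "Y_density \<alpha> p h t x = (LBINT s. q s *\<^sub>R (p * ?K x s + (1 - p) * ?K (- x) s))"
    unfolding Y_density_def set_lebesgue_integral_def
    by (intro Bochner_Integration.integral_cong refl)
       (auto simp: fresnel_density_eq[OF \<alpha>] q_def split: split_indicator)
  also have "\<dots> = (LINT s|?M. p * ?K x s + (1 - p) * ?K (- x) s)"
    using borel_measurable_integrable[OF Kint] q0(1) by (intro integral_density[symmetric]) auto
  also have "\<dots> = p * f x + (1 - p) * f (- x)"
    using K by (simp add: Bochner_Integration.integral_add)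
  finally show ?thesis .
qed

text \<open>Integrability is a conjunct of its own because the integral of a non-integrable function
  is 0 by convention, so \<open>Y_distribution\<close> alone would not show that the signed measure
  exists. The existence of L is one because the last conjunct speaks only of given H and \<epsilon>
  and would be vacuous if no such H existed.\<close>

theorem mainTheorem9:
  fixes p \<alpha> \<theta> \<nu> \<beta> \<sigma> \<mu> t :: real
    and h :: "real \<Rightarrow> real \<Rightarrow> real"
  assumes p: "0 \<le> p" "p \<le> 1"
    and \<alpha>: "1 < \<alpha>"
    and \<theta>: "0 < \<theta>" "\<theta> < 1"
    and \<nu>_eq: "\<nu> = \<alpha> * \<theta>"
    and \<beta>_eq: "\<beta> = tan (pi * \<theta> / 2) / tan (pi * \<alpha> * \<theta> / 2)"
    and \<sigma>_eq: "\<sigma> = cos (pi * \<theta> / 2) powr (1 / \<nu>)"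
    and \<mu>_eq: "\<mu> = 0"
    and \<nu>: "0 < \<nu>" "\<nu> \<le> 2" "\<nu> \<noteq> 1"
    and \<beta>_defined: "tan (pi * \<alpha> * \<theta> / 2) \<noteq> 0"
    and \<beta>: "-1 \<le> \<beta>" "\<beta> \<le> 1"
    and h: "\<And>r. 0 < r \<Longrightarrow> stable_subordinator_density \<theta> r (\<lambda>s. h s r)"
    and t: "0 < t"
  shows "integrable lborel (Y_density \<alpha> p h t) \<and>
    (\<exists>P. real_distribution P \<and> (\<forall>A\<in>sets borel. measure P A = Y_distribution \<alpha> p h t A)) \<and>
    (\<exists>L. real_distribution L \<and> (\<forall>\<gamma>. char L \<gamma> = stable_cf \<nu> \<sigma> \<beta> \<mu> t \<gamma>)) \<and>
    (\<forall>(M :: 'a measure) (H :: 'a \<Rightarrow> real) (\<epsilon> :: 'a \<Rightarrow> real).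
      prob_space M \<longrightarrow>
      H \<in> borel_measurable M \<longrightarrow>
      (\<forall>\<gamma>. char (distr M borel H) \<gamma> = stable_cf \<nu> \<sigma> \<beta> \<mu> t \<gamma>) \<longrightarrow>
      \<epsilon> \<in> borel_measurable M \<longrightarrow>
      (\<forall>\<omega>\<in>space M. \<epsilon> \<omega> = 1 \<or> \<epsilon> \<omega> = -1) \<longrightarrow>
      measure M {\<omega> \<in> space M. \<epsilon> \<omega> = 1} = p \<longrightarrow>
      prob_space.indep_var M borel H borel \<epsilon> \<longrightarrow>
      (\<forall>A\<in>sets borel. Y_distribution \<alpha> p h t A =
         measure (distr M borel (\<lambda>\<omega>. if \<epsilon> \<omega> = 1 then H \<omega> else - H \<omega>)) A))"
proof -
  have \<nu>': "pi * \<alpha> * \<theta> / 2 = pi * \<nu> / 2" by (simp add: \<nu>_eq)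
  \<comment> \<open>tan pi = 0, so a well-defined \<beta> excludes the Gaussian endpoint, which
    \<open>stable_exists\<close> does not cover.\<close>
  have "\<nu> \<noteq> 2" using \<beta>_defined unfolding \<nu>' by (auto simp: tan_def)
  then have \<nu>2: "\<nu> < 2" using \<nu> by simp
  have \<beta>_tan: "\<beta> * tan (pi * \<nu> / 2) = tan (pi * \<theta> / 2)"
    using \<beta>_eq \<beta>_defined by (simp add: \<nu>')
  have cf_eq: "stable_cf \<nu> \<sigma> \<beta> \<mu> t = strictly_stable_cf \<nu> \<theta> t"
    unfolding \<sigma>_eq \<mu>_eq by (rule ext) (rule stable_cf_eq_strictly_stable_cf[OF \<nu>(1) \<theta> \<beta>_tan])
  have "0 \<le> t * \<sigma> powr \<nu>" using t by simp
  from stable_exists[OF \<nu>(1) \<nu>2 \<nu>(3) this \<beta>]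
  obtain L where L: "real_distribution L" and "\<And>\<gamma>. char L \<gamma> = stable_cf \<nu> \<sigma> \<beta> \<mu> t \<gamma>"
    by (auto simp: stable_cf_def \<mu>_eq)
  then have char_L: "char L = strictly_stable_cf \<nu> \<theta> t" by (auto simp: cf_eq)
  have int: "integrable lborel (char L)"
    unfolding char_L by (rule strictly_stable_cf_integrable[OF \<nu>(1) t \<theta>])
  define f where "f x = Re (1 / (2 * pi) * (CLBINT \<gamma>. iexp (- (\<gamma> * x)) * char L \<gamma>))" for x
  have f0: "0 \<le> f x" for x unfolding f_def by (rule real_distribution.Fourier_inversion(1)[OF L int])
  have L_eq: "L = density lborel f"
    unfolding f_def[abs_def] by (rule real_distribution.Fourier_inversion(2)[OF L int])
  have "isCont f x" for x
    unfolding f_def by (intro isCont_Re continuous_mult continuous_const isCont_fourier_integral int)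
  then have f_meas [measurable]: "f \<in> borel_measurable borel"
    by (intro borel_measurable_continuous_onI continuous_at_imp_continuous_on) auto
  have f_int: "integrable lborel f" and L_meas: "\<And>A. A \<in> sets borel \<Longrightarrow> measure L A = (LBINT x:A. f x)"
    using density_lborel_measure[OF L[unfolded L_eq] f_meas f0] unfolding L_eq[symmetric] by auto
  have f'_int: "integrable lborel (\<lambda>x. f (- x))"
    using lborel_integrable_real_affine[OF f_int, of "-1" 0] by simp
  have Y: "Y_density \<alpha> p h t = (\<lambda>x. p * f x + (1 - p) * f (- x))"
    using Y_density_eq[where h=h, OF \<alpha> \<theta> t h[OF t]] by (intro ext) (simp add: f_def char_L \<nu>_eq)
  have Y_int: "integrable lborel (Y_density \<alpha> p h t)"
    unfolding Y using f_int f'_int by simp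
  have Y_dist: "Y_distribution \<alpha> p h t A = p * measure L A + (1 - p) * measure L (uminus -` A)"
    if A [measurable]: "A \<in> sets borel" for A
  proof -
    note A' = vimage_uminus_borel[OF A]
    have "set_integrable lborel A (\<lambda>x. p * f x)" "set_integrable lborel A (\<lambda>x. (1 - p) * f (- x))"
      unfolding set_integrable_def using f_int f'_int
      by (auto intro!: integrable_mult_indicator simp del: real_scaleR_def)
    then have "Y_distribution \<alpha> p h t A = p * (LBINT x:A. f x) + (1 - p) * (LBINT x:A. f (- x))"
      unfolding Y_distribution_def Y by (simp add: set_integral_add)
    then show ?thesis by (simp add: L_meas[OF A] L_meas[OF A'] set_integral_reflect_lborel)
  qed
  have Y0: "0 \<le> Y_density \<alpha> p h t x" for x unfolding Y using f0 p by simp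
  have P: "real_distribution (density lborel (Y_density \<alpha> p h t))"
  proof -
    interpret L: real_distribution L by (rule L)
    have "(LBINT x. Y_density \<alpha> p h t x) = Y_distribution \<alpha> p h t UNIV"
      by (simp add: Y_distribution_def set_lebesgue_integral_def)
    also have "\<dots> = 1" using Y_dist[of UNIV] L.prob_space by simp
    finally have "emeasure (density lborel (Y_density \<alpha> p h t)) UNIV = 1"
      using nn_integral_eq_integral[OF Y_int] Y0 borel_measurable_integrable[OF Y_int]
      by (simp add: emeasure_density)
    then show ?thesis
      by (simp add: real_distribution_def real_distribution_axioms_def prob_spaceI)
  qed
  show ?thesis
  proof (intro conjI allI impI ballI)
    show "integrable lborel (Y_density \<alpha> p h t)" by (rule Y_int)
    show "\<exists>P. real_distribution P \<and> (\<forall>A\<in>sets borel. measure P A = Y_distribution \<alpha> p h t A)"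
      using density_lborel_measure(2)[OF P _ Y0] borel_measurable_integrable[OF Y_int] P
      by (auto simp: Y_distribution_def)
    show "\<exists>L. real_distribution L \<and> (\<forall>\<gamma>. char L \<gamma> = stable_cf \<nu> \<sigma> \<beta> \<mu> t \<gamma>)"
      using L char_L cf_eq by auto
  next
    fix M :: "'a measure" and H \<epsilon> :: "'a \<Rightarrow> real" and A :: "real set"
    assume M: "prob_space M" and H: "H \<in> borel_measurable M"
      and char: "\<forall>\<gamma>. char (distr M borel H) \<gamma> = stable_cf \<nu> \<sigma> \<beta> \<mu> t \<gamma>"
      and \<epsilon>: "\<epsilon> \<in> borel_measurable M" and p: "measure M {\<omega> \<in> space M. \<epsilon> \<omega> = 1} = p"
      and indep: "prob_space.indep_var M borel H borel \<epsilon>" and A: "A \<in> sets borel"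
    \<comment> \<open>The characteristic function determines the law, so the one constructed L
      stands for every admissible H.\<close>
    have "distr M borel H = L"
      by (rule Levy_uniqueness[OF real_distribution_distr[OF M H] L]) (use char char_L cf_eq in auto)
    then show "Y_distribution \<alpha> p h t A =
        measure (distr M borel (\<lambda>\<omega>. if \<epsilon> \<omega> = 1 then H \<omega> else - H \<omega>)) A"
      using distr_random_sign[OF M H \<epsilon> p indep A] Y_dist[OF A] by simp
  qed
qed

end
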